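(* Let $\mathbf k$ be a field, $K$ a simplicial complex on $[m]$ with $K\neq\{\,\}$ and $K\ne\Delta^{[m]}$, and $\underline r=(r_1,\dots,r_m)$ a sequence of positive integers. Then $$I_{(K;\underline r)}=\mathcal Z^\otimes(K^\circ;(x^{r_1}),\dots,(x^{r_m})),$$ $$\mathrm{Tor}_*^{\mathbf k[m]}(I_{(K;\underline r)},\mathbf k)\cong\bigoplus_{\sigma\in K^\circ}H_*^{\sigma,[m]\setminus\sigma}(K^\circ)\cong\bigoplus_{\omega\notin K}H^{|\omega|-*-1}_{\emptyset,\omega}(K),$$ where $K^\circ$ is the dual of $K$ relative to $[m]$ and all the rings $R_k$ in the composition ideal are the same polynomial ring $\mathbf k[x]$.
   Context: $[m]=\{1,\dots,m\}$; a simplicial complex on $[m]$ is a set of subsets of $[m]$ closed under taking subsets (ghost vertices, the void complex $\{\,\}$ and $\{\emptyset\}$ allowed); $\Delta^{[m]}$ is all subsets. $K^\circ=\{[m]\setminus\sigma:\sigma\subset[m],\sigma\notin K\}$. $\mathbf k[m]=\mathbf k[x_1,\dots,x_m]$, identified with $\mathbf k[x]^{\otimes m}$, and $\mathbf k$ is the trivial module (variables act as $0$). $I_{(K;\underline r)}$ is the ideal of $\mathbf k[m]$ generated by all monomials $x_{i_1}^{r_{i_1}}\cdots x_{i_s}^{r_{i_s}}$ with $\{i_1,\dots,i_s\}\notin K$. For ideals $I_k\subset R_k$, the composition ideal is $\mathcal Z^\otimes(K;I_1,\dots,I_m)=\sum_{\tau\in K}Y_1\otimes\cdots\otimes Y_m\subset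 R_1\otimes\cdots\otimes R_m$, $Y_k=R_k$ if $k\in\tau$, $Y_k=I_k$ otherwise. Homology is with coefficients in $\mathbf k$. Let $T_*$ have basis $\mathrm e,\mathrm n,\mathrm i$ (degree $0$), $\bar{\mathrm n}$ (degree $1$), $d\bar{\mathrm n}=\mathrm n$, and $S_*$ basis $\mathrm n,\mathrm i$; $\mathrm n,\bar{\mathrm n}$ have index $\mathrm n$. $T_*(K)=\sum_{\tau\in K}U_1\otimes\cdots\otimes U_m\subset T_*^{\otimes m}$, $U_k=T_*$ if $k\in\tau$, $S_*$ otherwise. For disjoint $\sigma,\omega\subset[m]$, $H_*^{\sigma,\omega}(K)$ is the homology of the summand of $T_*(K)$ spanned by basis tensors with index $\mathrm e$ exactly on $\sigma$ and index $\mathrm n$ exactly on $\omega$, and $H^*_{\sigma,\omega}(K)$ that of its dual; equivalently $\widetilde H_{*-1}(K_{\sigma,\omega})$ and $\widetilde H^{*-1}(K_{\sigma,\omega})$ with $K_{\sigma,\omega}=\{\tau\subset\omega:\tau\cup\sigma\in K\}$ if $\sigma\in K$ and the void complex otherwise. In the last sum the degree $t$ part is $H^{|\omega|-t-1}_{\emptyset,\omega}(K)$. *)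

theory Defs
  imports
    "HOL-Computational_Algebra.Polynomial"
    "HOL-Library.Poly_Mapping"
    "HOL-Library.Set_Algebras"
    "HOL-Library.Function_Algebras"
begin

section \<open>Simplicial complexes and polynomial rings\<close>

text \<open>
  The vertex set $[m]$ is the universe of a finite linearly ordered type; the order only enters
  through the signs of the differential of $T_*^{\otimes m}$. Such a type has at least one element.
  Nothing is lost for $m = 0$: there the only complexes are the void one and $\{\emptyset\}$,
  which is the full simplex.
\<close>

definition simplicial_complex :: "'m set set \<Rightarrow> bool"
  where "simplicial_complex K \<longleftrightarrow> (\<forall>\<tau>\<in>K. \<forall>\<sigma>. \<sigma> \<subseteq> \<tau> \<longrightarrow> \<sigma> \<in> K)"

definition dual_complex :: "'m set set \<Rightarrow> 'm set set"
  where "dual_complex K = {UNIV - \<sigma> | \<sigma>. \<sigma> \<notin> K}"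

type_synonym ('m, 'k) mpoly = "('m \<Rightarrow>\<^sub>0 nat) \<Rightarrow>\<^sub>0 'k"

definition Const :: "'k::comm_ring_1 \<Rightarrow> ('m, 'k) mpoly"
  where "Const c = Poly_Mapping.single 0 c"

definition Var :: "'m \<Rightarrow> ('m, 'k::comm_ring_1) mpoly"
  where "Var i = Poly_Mapping.single (Poly_Mapping.single i 1) 1"

definition ideal_generated :: "'r::comm_ring_1 set \<Rightarrow> 'r set"
  where "ideal_generated S = module.span (*) S"

definition monomial_ideal :: "'m set set \<Rightarrow> ('m \<Rightarrow> nat) \<Rightarrow> ('m, 'k::comm_ring_1) mpoly set"
  where "monomial_ideal K r = ideal_generated {\<Prod>i\<in>\<sigma>. Var i ^ r i | \<sigma>. \<sigma> \<notin> K}"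

text \<open>
  Under $\mathbf k[x]^{\otimes m} = \mathbf k[m]$ the tensor $y_1 \otimes \dots \otimes y_m$ is the
  product of the $y_i(x_i)$, and $Y_1 \otimes \dots \otimes Y_m$ is the linear span of the tensors
  with all $y_i \in Y_i$.
\<close>

definition pure_tensor :: "('m::finite \<Rightarrow> 'k::field poly) \<Rightarrow> ('m, 'k) mpoly"
  where "pure_tensor y = (\<Prod>i\<in>UNIV. poly (map_poly Const (y i)) (Var i))"

definition tensor_subspace :: "('m::finite \<Rightarrow> 'k::field poly set) \<Rightarrow> ('m, 'k) mpoly set"
  where "tensor_subspace Y =
    module.span (\<lambda>c p. Const c * p) {pure_tensor y | y. \<forall>i. y i \<in> Y i}"

text \<open>The sum below is the Minkowski sum of sets from \<^theory>\<open>HOL-Library.Set_Algebras\<close>.\<close>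

definition composition_ideal ::
    "'m::finite set set \<Rightarrow> ('m \<Rightarrow> 'k::field poly set) \<Rightarrow> ('m, 'k) mpoly set"
  where "composition_ideal K I = (\<Sum>\<tau>\<in>K. tensor_subspace (\<lambda>i. if i \<in> \<tau> then UNIV else I i))"


section \<open>Subquotients, direct sums, homology\<close>

text \<open>The pair \<open>(Z, B)\<close> of submodules \<open>B \<subseteq> Z\<close> stands for the quotient $Z/B$.\<close>

type_synonym 'v subquotient = "'v set \<times> 'v set"

definition cosets :: "'v::ab_group_add subquotient \<Rightarrow> 'v set set"
  where "cosets Q = {z +o snd Q | z. z \<in> fst Q}"

definition isomorphic ::
    "('k \<Rightarrow> 'v \<Rightarrow> 'v) \<Rightarrow> 'v::ab_group_add subquotient \<Rightarrow>
     ('k \<Rightarrow> 'w \<Rightarrow> 'w) \<Rightarrow> 'w::ab_group_add subquotient \<Rightarrow> bool"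
  where "isomorphic s Q s' Q' \<longleftrightarrow> (\<exists>\<phi>. bij_betw \<phi> (cosets Q) (cosets Q') \<and>
    (\<forall>x\<in>fst Q. \<forall>y\<in>fst Q. \<forall>u\<in>\<phi> (x +o snd Q). \<forall>v\<in>\<phi> (y +o snd Q).
      \<phi> ((x + y) +o snd Q) = (u + v) +o snd Q') \<and>
    (\<forall>c. \<forall>x\<in>fst Q. \<forall>u\<in>\<phi> (x +o snd Q). \<phi> (s c x +o snd Q) = s' c u +o snd Q'))"

text \<open>The direct sum of the $Z_i/B_i$ is represented as $(\bigoplus Z_i)/(\bigoplus B_i)$.\<close>

definition direct_sum :: "'i set \<Rightarrow> ('i \<Rightarrow> 'v::ab_group_add subquotient) \<Rightarrow> ('i \<Rightarrow>\<^sub>0 'v) subquotient"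
  where "direct_sum S Q =
    ({f. Poly_Mapping.keys f \<subseteq> S \<and> (\<forall>i\<in>S. Poly_Mapping.lookup f i \<in> fst (Q i))},
     {f. Poly_Mapping.keys f \<subseteq> S \<and> (\<forall>i\<in>S. Poly_Mapping.lookup f i \<in> snd (Q i))})"

definition sum_scale :: "('k \<Rightarrow> 'v::ab_group_add \<Rightarrow> 'v) \<Rightarrow> 'k \<Rightarrow> ('i \<Rightarrow>\<^sub>0 'v) \<Rightarrow> ('i \<Rightarrow>\<^sub>0 'v)"
  where "sum_scale s c = Poly_Mapping.map (s c)"

definition linear_on ::
    "('r \<Rightarrow> 'v \<Rightarrow> 'v) \<Rightarrow> ('r \<Rightarrow> 'w \<Rightarrow> 'w) \<Rightarrow> 'v::ab_group_add set \<Rightarrow> ('v \<Rightarrow> 'w::ab_group_add) \<Rightarrow> bool"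
  where "linear_on s s' A f \<longleftrightarrow>
    (\<forall>x\<in>A. \<forall>y\<in>A. f (x + y) = f x + f y) \<and> (\<forall>c. \<forall>x\<in>A. f (s c x) = s' c (f x))"

text \<open>
  \<open>homology Q\<^sub>1 f Q\<^sub>2 g Q\<^sub>3\<close> is the homology at the middle of $Q_1 \to Q_2 \to Q_3$, where \<open>f\<close> and
  \<open>g\<close> are given on representatives: the kernel and the image, both taken in $Z_2/B_2$, are replaced
  by their preimages in $Z_2$.
\<close>

definition homology ::
    "'u::ab_group_add subquotient \<Rightarrow> ('u \<Rightarrow> 'v) \<Rightarrow> 'v::ab_group_add subquotient \<Rightarrow> ('v \<Rightarrow> 'w) \<Rightarrow>
     'w::ab_group_add subquotient \<Rightarrow> 'v subquotient"
  where "homology Q\<^sub>1 f Q\<^sub>2 g Q\<^sub>3 = ({z \<in> fst Q\<^sub>2. g z \<in> snd Q\<^sub>3}, f ` fst Q\<^sub>1 + snd Q\<^sub>2)"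


section \<open>Tor\<close>

text \<open>
  A free resolution of the submodule \<open>M\<close>: the modules \<open>F t\<close> are submodules of one ambient module
  (which may be taken to be their direct sum), indexed by the integers and zero in negative degrees.
\<close>

definition free_resolution ::
    "('r::comm_ring_1 \<Rightarrow> 'f::ab_group_add \<Rightarrow> 'f) \<Rightarrow> (int \<Rightarrow> 'f set) \<Rightarrow> (int \<Rightarrow> 'f \<Rightarrow> 'f) \<Rightarrow> ('f \<Rightarrow> 'a) \<Rightarrow>
     ('r \<Rightarrow> 'a \<Rightarrow> 'a) \<Rightarrow> 'a::ab_group_add set \<Rightarrow> bool"
  where "free_resolution s F d \<epsilon> s' M \<longleftrightarrow>
    module s \<and>
    (\<forall>t. \<exists>B. \<not> module.dependent s B \<and> module.span s B = F t) \<and>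
    (\<forall>t<0. F t = {0}) \<and>
    (\<forall>t. linear_on s s (F t) (d t) \<and> d t ` F t \<subseteq> F (t - 1)) \<and>
    linear_on s s' (F 0) \<epsilon> \<and> \<epsilon> ` F 0 = M \<and>
    {x \<in> F 0. \<epsilon> x = 0} = d 1 ` F 1 \<and>
    (\<forall>t\<ge>1. {x \<in> F t. d t x = 0} = d (t + 1) ` F (t + 1))"

text \<open>
  Every module has such a resolution: take all elements of the module as generators of $F_0$ and,
  inductively, all presentations \<open>l\<close> of elements of the previous kernel as generators \<open>Syz l\<close>.
\<close>

lemma lookup_sum_scale:
  fixes p :: "'i \<Rightarrow>\<^sub>0 'r::comm_ring_1"
  shows "Poly_Mapping.lookup (sum_scale (*) c p) x = c * Poly_Mapping.lookup p x"
  by (simp add: sum_scale_def Poly_Mapping.map.rep_eq when_def)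

lemma module_sum_scale: "module (sum_scale (*) :: 'r::comm_ring_1 \<Rightarrow> ('i \<Rightarrow>\<^sub>0 'r) \<Rightarrow> _)"
  by unfold_locales
    (auto intro!: poly_mapping_eqI simp: lookup_sum_scale lookup_add algebra_simps)

lemma keys_span_single:
  fixes G :: "'i set"
  defines "B \<equiv> (\<lambda>g. Poly_Mapping.single g (1::'r::comm_ring_1)) ` G"
  shows "\<not> module.dependent (sum_scale (*)) B"
    and "module.span (sum_scale (*)) B = {p. Poly_Mapping.keys p \<subseteq> G}"
proof -
  interpret module "sum_scale (*) :: 'r \<Rightarrow> ('i \<Rightarrow>\<^sub>0 'r) \<Rightarrow> _" by (rule module_sum_scale)
  have inj: "inj_on (\<lambda>g. Poly_Mapping.single g (1::'r)) G"
    by (rule inj_onI) (metis lookup_single_eq lookup_single_not_eq zero_neq_one)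
  show "\<not> dependent B"
    unfolding dependent_explicit
  proof clarify
    fix t u v
    assume fin: "finite t" and sub: "t \<subseteq> B" and z: "(\<Sum>v\<in>t. sum_scale (*) (u v) v) = 0"
      and v: "v \<in> t" "u v \<noteq> 0"
    obtain g where g: "v = Poly_Mapping.single g 1" "g \<in> G" using v sub B_def by auto
    have "0 = Poly_Mapping.lookup (\<Sum>v\<in>t. sum_scale (*) (u v) v) g" using z by simp
    also have "\<dots> = (\<Sum>w\<in>t. u w * Poly_Mapping.lookup w g)"
      by (simp add: lookup_sum lookup_sum_scale)
    also have "\<dots> = (\<Sum>w\<in>t. if w = v then u v else 0)"
    proof (rule sum.cong)
      fix w assume "w \<in> t"
      then obtain h where h: "w = Poly_Mapping.single h 1" using sub B_def by auto
      show "u w * Poly_Mapping.lookup w g = (if w = v then u v else 0)"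
        using g h by (cases "h = g") (auto simp: lookup_single dest: arg_cong[of _ _ "\<lambda>p. Poly_Mapping.lookup p g"])
    qed simp
    also have "\<dots> = u v" using fin v by simp
    finally show False using v by simp
  qed
  show "span B = {p. Poly_Mapping.keys p \<subseteq> G}"
  proof (rule span_unique)
    show "B \<subseteq> {p. Poly_Mapping.keys p \<subseteq> G}" by (auto simp: B_def)
    show "subspace {p :: 'i \<Rightarrow>\<^sub>0 'r. Poly_Mapping.keys p \<subseteq> G}"
    proof (rule subspaceI; clarsimp)
      fix p q :: "'i \<Rightarrow>\<^sub>0 'r" and x
      assume "Poly_Mapping.keys p \<subseteq> G" "Poly_Mapping.keys q \<subseteq> G" "x \<in> Poly_Mapping.keys (p + q)"
      then show "x \<in> G" using keys_add[of p q] by auto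
    next
      fix c and p :: "'i \<Rightarrow>\<^sub>0 'r" and x
      assume "Poly_Mapping.keys p \<subseteq> G" "x \<in> Poly_Mapping.keys (sum_scale (*) c p)"
      then have "Poly_Mapping.lookup p x \<noteq> 0" by (auto simp: in_keys_iff lookup_sum_scale)
      then show "x \<in> G" using \<open>Poly_Mapping.keys p \<subseteq> G\<close> by (auto simp: in_keys_iff)
    qed
    fix T :: "('i \<Rightarrow>\<^sub>0 'r) set" assume T: "B \<subseteq> T" "subspace T"
    show "{p. Poly_Mapping.keys p \<subseteq> G} \<subseteq> T"
    proof clarify
      fix p :: "'i \<Rightarrow>\<^sub>0 'r" assume p: "Poly_Mapping.keys p \<subseteq> G"
      have "p = (\<Sum>g\<in>Poly_Mapping.keys p. sum_scale (*) (Poly_Mapping.lookup p g) (Poly_Mapping.single g 1))"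
      proof (rule poly_mapping_eqI)
        fix x
        show "Poly_Mapping.lookup p x = Poly_Mapping.lookup (\<Sum>g\<in>Poly_Mapping.keys p. sum_scale (*) (Poly_Mapping.lookup p g) (Poly_Mapping.single g 1)) x"
          by (simp add: lookup_sum lookup_sum_scale lookup_single when_def in_keys_iff if_distrib cong: if_cong)
      qed
      also have "\<dots> \<in> T"
        using p T by (intro subspace_sum subspace_scale) (auto simp: B_def)
      finally show "p \<in> T" .
    qed
  qed
qed

datatype ('r, 'a) rgen = Gen 'a | Syz "('r \<times> ('r, 'a) rgen) list"

definition lin_ext :: "('r::comm_ring_1 \<Rightarrow> 'b::ab_group_add \<Rightarrow> 'b) \<Rightarrow> ('i \<Rightarrow> 'b) \<Rightarrow> ('i \<Rightarrow>\<^sub>0 'r) \<Rightarrow> 'b"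
  where "lin_ext s f p = (\<Sum>g\<in>Poly_Mapping.keys p. s (Poly_Mapping.lookup p g) (f g))"

lemma lin_ext_superset:
  assumes "module s" "finite A" "Poly_Mapping.keys p \<subseteq> A"
  shows "lin_ext s f p = (\<Sum>g\<in>A. s (Poly_Mapping.lookup p g) (f g))"
  unfolding lin_ext_def using assms
  by (intro sum.mono_neutral_left) (auto simp: in_keys_iff module.scale_zero_left)

lemma linear_lin_ext:
  assumes s: "module s"
  shows "linear_on (sum_scale (*)) s A (lin_ext s f)"
proof -
  interpret module s by (rule s)
  show ?thesis unfolding linear_on_def
  proof (intro conjI ballI allI)
    fix x y
    show "lin_ext s f (x + y) = lin_ext s f x + lin_ext s f y"
      using keys_add[of x y]
      by (simp add: lin_ext_superset[OF s, of "Poly_Mapping.keys x \<union> Poly_Mapping.keys y"]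
          lookup_add scale_left_distrib sum.distrib)
  next
    fix c x
    show "lin_ext s f (sum_scale (*) c x) = s c (lin_ext s f x)"
    proof -
      have "Poly_Mapping.keys (sum_scale (*) c x) \<subseteq> Poly_Mapping.keys x"
        by (auto simp: lookup_sum_scale in_keys_iff)
      then show ?thesis
        by (simp add: lin_ext_superset[OF s, of "Poly_Mapping.keys x"] lookup_sum_scale scale_sum_right)
    qed
  qed
qed

lemma lin_ext_single: "module s \<Longrightarrow> lin_ext s f (Poly_Mapping.single g 1) = f g"
  by (simp add: lin_ext_def module.scale_one)

definition rcomb :: "('r::comm_ring_1 \<times> ('r, 'a) rgen) list \<Rightarrow> (('r, 'a) rgen \<Rightarrow>\<^sub>0 'r)"
  where "rcomb l = (\<Sum>(c, g)\<leftarrow>l. Poly_Mapping.single g c)"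

lemma rcomb_surj:
  fixes p :: "('r::comm_ring_1, 'a) rgen \<Rightarrow>\<^sub>0 'r"
  shows "\<exists>l. rcomb l = p"
proof -
  obtain ks where ks: "set ks = Poly_Mapping.keys p" "distinct ks"
    using finite_distinct_list[OF finite_keys, of p] by auto
  have "rcomb (map (\<lambda>g. (Poly_Mapping.lookup p g, g)) ks)
     = (\<Sum>g\<in>Poly_Mapping.keys p. Poly_Mapping.single g (Poly_Mapping.lookup p g))"
    unfolding rcomb_def ks(1)[symmetric] sum.distinct_set_conv_list[OF ks(2)]
    by (simp add: o_def)
  also have "\<dots> = p"
    by (rule poly_mapping_eqI) (simp add: lookup_sum lookup_single when_def in_keys_iff)
  finally show ?thesis by (rule exI)
qed

fun rdiff :: "('r::comm_ring_1, 'a) rgen \<Rightarrow> (('r, 'a) rgen \<Rightarrow>\<^sub>0 'r)"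
  where "rdiff (Gen a) = 0" | "rdiff (Syz l) = rcomb l"

fun raug :: "('r, 'a::zero) rgen \<Rightarrow> 'a"
  where "raug (Gen a) = a" | "raug (Syz l) = 0"

context
  fixes s :: "'r::comm_ring_1 \<Rightarrow> 'a::ab_group_add \<Rightarrow> 'a" and M :: "'a set"
begin

fun rgens :: "nat \<Rightarrow> ('r, 'a) rgen set" where
  "rgens 0 = Gen ` M"
| "rgens (Suc 0) = {Syz l | l. Poly_Mapping.keys (rcomb l) \<subseteq> rgens 0 \<and> lin_ext s raug (rcomb l) = 0}"
| "rgens (Suc (Suc n)) = {Syz l | l. Poly_Mapping.keys (rcomb l) \<subseteq> rgens (Suc n)
     \<and> lin_ext (sum_scale (*)) rdiff (rcomb l) = 0}"

end

lemma free_resolution_exists: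
  fixes s :: "'r::comm_ring_1 \<Rightarrow> 'a::ab_group_add \<Rightarrow> 'a"
  assumes s: "module s" and M: "module.subspace s M"
  shows "\<exists>(F :: int \<Rightarrow> (('r, 'a) rgen \<Rightarrow>\<^sub>0 'r) set) d \<epsilon>. free_resolution (sum_scale (*)) F d \<epsilon> s M"
proof -
  interpret A: module s by (rule s)
  interpret P: module "sum_scale (*) :: 'r \<Rightarrow> (('r, 'a) rgen \<Rightarrow>\<^sub>0 'r) \<Rightarrow> _" by (rule module_sum_scale)
  note mP = P.module_axioms
  define G :: "int \<Rightarrow> ('r, 'a) rgen set" where "G t = (if t < 0 then {} else rgens s M (nat t))" for t
  define F :: "int \<Rightarrow> (('r, 'a) rgen \<Rightarrow>\<^sub>0 'r) set" where "F t = {p. Poly_Mapping.keys p \<subseteq> G t}" for t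
  define D :: "(('r, 'a) rgen \<Rightarrow>\<^sub>0 'r) \<Rightarrow> _" where "D = lin_ext (sum_scale (*)) rdiff"
  define E :: "(('r, 'a) rgen \<Rightarrow>\<^sub>0 'r) \<Rightarrow> 'a" where "E = lin_ext s raug"
  have span: "F t = P.span ((\<lambda>g. Poly_Mapping.single g 1) ` G t)" for t
    by (simp add: F_def keys_span_single)
  have subF: "P.subspace (F t)" for t by (simp add: span)
  have G1: "G 1 = {Syz l | l. rcomb l \<in> F 0 \<and> E (rcomb l) = 0}"
    by (simp add: G_def F_def E_def)
  have G2: "G (t + 1) = {Syz l | l. rcomb l \<in> F t \<and> D (rcomb l) = 0}" if "t \<ge> 1" for t
  proof -
    define n where "n = nat (t - 1)"
    have n: "nat (t + 1) = Suc (Suc n)" "nat t = Suc n" using that by (auto simp: n_def)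
    show ?thesis using that unfolding G_def F_def D_def n by simp
  qed
  have mono: "\<exists>x. p = D x \<and> x \<in> F (t + 1)" if "p \<in> F t" "Syz ` {l. rcomb l = p} \<subseteq> G (t + 1)" for p t
  proof -
    obtain l where l: "rcomb l = p" using rcomb_surj by blast
    show ?thesis
      by (rule exI[of _ "Poly_Mapping.single (Syz l) 1"])
         (use that l in \<open>auto simp: F_def D_def lin_ext_single[OF mP]\<close>)
  qed
  have im: "D ` F t \<subseteq> S" if "P.subspace S" "\<And>g. g \<in> G t \<Longrightarrow> rdiff g \<in> S" for S t
    using that by (auto simp: F_def D_def lin_ext_def intro!: P.subspace_sum P.subspace_scale)
  have linD: "linear_on (sum_scale (*)) (sum_scale (*)) A D" for A
    unfolding D_def by (rule linear_lin_ext[OF mP])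
  have linE: "linear_on (sum_scale (*)) s A E" for A
    unfolding E_def by (rule linear_lin_ext[OF s])
  have subK: "P.subspace {x \<in> F t. D x = 0}" for t
  proof (rule P.subspaceI)
    show "0 \<in> {x \<in> F t. D x = 0}" using P.subspace_0[OF subF] by (simp add: D_def lin_ext_def)
  qed (use linD[of UNIV] P.subspace_add[OF subF] P.subspace_scale[OF subF] in
      \<open>auto simp: linear_on_def\<close>)
  have subKE: "P.subspace {x \<in> F 0. E x = 0}"
  proof (rule P.subspaceI)
    show "0 \<in> {x \<in> F 0. E x = 0}" using P.subspace_0[OF subF] by (simp add: E_def lin_ext_def)
  qed (use linE[of UNIV] P.subspace_add[OF subF] P.subspace_scale[OF subF] in
      \<open>auto simp: linear_on_def\<close>)
  have ex0: "{x \<in> F 0. E x = 0} = D ` F 1"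
  proof
    show "D ` F 1 \<subseteq> {x \<in> F 0. E x = 0}" by (rule im[OF subKE]) (auto simp: G1)
    show "{x \<in> F 0. E x = 0} \<subseteq> D ` F 1"
    proof clarify
      fix p assume p: "p \<in> F 0" "E p = 0"
      show "p \<in> D ` F 1" using mono[OF p(1)] p by (auto simp: G1 image_subset_iff)
    qed
  qed
  have ex1: "{x \<in> F t. D x = 0} = D ` F (t + 1)" if "t \<ge> 1" for t
  proof
    show "D ` F (t + 1) \<subseteq> {x \<in> F t. D x = 0}" by (rule im[OF subK]) (auto simp: G2[OF that])
    show "{x \<in> F t. D x = 0} \<subseteq> D ` F (t + 1)"
    proof clarify
      fix p assume p: "p \<in> F t" "D p = 0"
      show "p \<in> D ` F (t + 1)" using mono[OF p(1)] p
        by (auto simp: G2[OF that] image_subset_iff)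
    qed
  qed
  have neg: "F t = {0}" if "t < 0" for t using that by (auto simp: F_def G_def)
  have sub: "D ` F t \<subseteq> F (t - 1)" for t
  proof -
    consider "t < 0" | "t = 0" | "t = 1" | "t > 1" by linarith
    then show ?thesis
    proof cases
      case 1 then show ?thesis by (simp add: neg D_def lin_ext_def)
    next
      case 2 show ?thesis by (rule im[OF subF]) (auto simp: 2 G_def neg)
    next
      case 3 then show ?thesis using ex0 by auto
    next
      case 4 then show ?thesis using ex1[of "t - 1"] by auto
    qed
  qed
  have "E ` F 0 = M"
  proof
    have "raug g \<in> M" if "p \<in> F 0" "g \<in> Poly_Mapping.keys p" for p g
      using that by (auto simp: F_def G_def)
    then show "E ` F 0 \<subseteq> M"
      using M by (auto simp: E_def lin_ext_def intro!: A.subspace_sum A.subspace_scale)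
    show "M \<subseteq> E ` F 0"
    proof
      fix x assume "x \<in> M"
      then have "Poly_Mapping.single (Gen x) 1 \<in> F 0" by (simp add: F_def G_def)
      moreover have "E (Poly_Mapping.single (Gen x) 1) = x" by (simp add: E_def lin_ext_single[OF s])
      ultimately show "x \<in> E ` F 0" by force
    qed
  qed
  then have surj: "E ` F 0 = M" .
  have free: "\<forall>t. \<exists>B. \<not> P.dependent B \<and> P.span B = F t"
  proof
    fix t
    show "\<exists>B. \<not> P.dependent B \<and> P.span B = F t"
      by (rule exI[of _ "(\<lambda>g. Poly_Mapping.single g 1) ` G t"]) (simp add: span keys_span_single(1))
  qed
  have "free_resolution (sum_scale (*)) F (\<lambda>_. D) E s M"
    unfolding free_resolution_def
    by (intro conjI allI impI) (fact mP free[rule_format] neg linD linE sub surj ex0 ex1)+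
  then show ?thesis by blast
qed

text \<open>
  The tensor product over \<open>'r\<close> of submodules \<open>A\<close> and \<open>N\<close> is the free module on $A \times N$ modulo
  the bilinearity relations.
\<close>

definition tensor_product ::
    "('r::comm_ring_1 \<Rightarrow> 'a::ab_group_add \<Rightarrow> 'a) \<Rightarrow> 'a set \<Rightarrow> ('r \<Rightarrow> 'n::ab_group_add \<Rightarrow> 'n) \<Rightarrow> 'n set \<Rightarrow>
     ('a \<times> 'n \<Rightarrow>\<^sub>0 'r) subquotient"
  where "tensor_product s A s' N = (let gen = (\<lambda>a n. Poly_Mapping.single (a, n) 1) in
    ({p. Poly_Mapping.keys p \<subseteq> A \<times> N},
     module.span (sum_scale (*))
      ({gen (a + a') n - gen a n - gen a' n | a a' n. a \<in> A \<and> a' \<in> A \<and> n \<in> N} \<union>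
       {gen a (n + n') - gen a n - gen a n' | a n n'. a \<in> A \<and> n \<in> N \<and> n' \<in> N} \<union>
       {gen (s c a) n - sum_scale (*) c (gen a n) | c a n. a \<in> A \<and> n \<in> N} \<union>
       {gen a (s' c n) - sum_scale (*) c (gen a n) | c a n. a \<in> A \<and> n \<in> N})))"

definition tensor_map :: "('a \<Rightarrow> 'b) \<Rightarrow> ('a \<times> 'n \<Rightarrow>\<^sub>0 'r::comm_ring_1) \<Rightarrow> ('b \<times> 'n \<Rightarrow>\<^sub>0 'r)"
  where "tensor_map f p =
    (\<Sum>(a, n)\<in>Poly_Mapping.keys p. Poly_Mapping.single (f a, n) (Poly_Mapping.lookup p (a, n)))"

text \<open>If \<open>(F, d)\<close> is a free resolution of \<open>M\<close>, the following is $\mathrm{Tor}_t(M, N)$.\<close>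

definition Tor ::
    "('r::comm_ring_1 \<Rightarrow> 'f::ab_group_add \<Rightarrow> 'f) \<Rightarrow> (int \<Rightarrow> 'f set) \<Rightarrow> (int \<Rightarrow> 'f \<Rightarrow> 'f) \<Rightarrow>
     ('r \<Rightarrow> 'n::ab_group_add \<Rightarrow> 'n) \<Rightarrow> 'n set \<Rightarrow> int \<Rightarrow> ('f \<times> 'n \<Rightarrow>\<^sub>0 'r) subquotient"
  where "Tor s F d s' N t = homology
    (tensor_product s (F (t + 1)) s' N) (tensor_map (d (t + 1)))
    (tensor_product s (F t) s' N) (tensor_map (d t))
    (tensor_product s (F (t - 1)) s' N)"

text \<open>The action of $\mathbf k[m]$ on the trivial module $\mathbf k$.\<close>

definition trivial_scale :: "('m, 'k::comm_ring_1) mpoly \<Rightarrow> 'k \<Rightarrow> 'k"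
  where "trivial_scale p c = Poly_Mapping.lookup p 0 * c"


section \<open>The complex $T_*(K)$\<close>

text \<open>\<open>TNbar\<close> is the generator $\bar{\mathrm n}$ of degree 1.\<close>

datatype tgen = TE | TN | TNbar | TI

definition tdeg :: "('m::finite \<Rightarrow> tgen) \<Rightarrow> int"
  where "tdeg b = int (card {i. b i = TNbar})"

text \<open>
  Basis tensors of $T_*^{\otimes m}$ are functions \<open>b\<close> from the vertices to the generators. On a
  tensor product of complexes the differential carries the sign $(-1)^{|b_1| + \dots + |b_{i-1}|}$
  in the \<open>i\<close>-th factor.
\<close>

definition tdiff ::
    "(('m::{finite,linorder} \<Rightarrow> tgen) \<Rightarrow>\<^sub>0 'k::field) \<Rightarrow> (('m \<Rightarrow> tgen) \<Rightarrow>\<^sub>0 'k)"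
  where "tdiff p = (\<Sum>b\<in>Poly_Mapping.keys p. \<Sum>i | b i = TNbar.
    Poly_Mapping.single (b(i := TN))
      ((-1) ^ card {j. j < i \<and> b j = TNbar} * Poly_Mapping.lookup p b))"

definition tbasis :: "'m set set \<Rightarrow> ('m \<Rightarrow> tgen) set"
  where "tbasis K =
    (\<Union>\<tau>\<in>K. {b. \<forall>i. b i \<in> (if i \<in> \<tau> then {TE, TN, TNbar, TI} else {TN, TI})})"

definition tchains ::
    "'m::finite set set \<Rightarrow> 'm set \<Rightarrow> 'm set \<Rightarrow> int \<Rightarrow> (('m \<Rightarrow> tgen) \<Rightarrow>\<^sub>0 'k::field) set"
  where "tchains K \<sigma> \<omega> t = {p. Poly_Mapping.keys p \<subseteq>
    {b \<in> tbasis K. {i. b i = TE} = \<sigma> \<and> {i. b i \<in> {TN, TNbar}} = \<omega> \<and> tdeg b = t}}"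

definition thomology ::
    "'m::{finite,linorder} set set \<Rightarrow> 'm set \<Rightarrow> 'm set \<Rightarrow> int \<Rightarrow> (('m \<Rightarrow> tgen) \<Rightarrow>\<^sub>0 'k::field) subquotient"
  where "thomology K \<sigma> \<omega> t = homology
    (tchains K \<sigma> \<omega> (t + 1), {0}) tdiff
    (tchains K \<sigma> \<omega> t, {0}) tdiff
    (tchains K \<sigma> \<omega> (t - 1), {0})"

text \<open>Linear functionals on a space of chains, extended by 0 outside that space.\<close>

definition tcochains ::
    "'m::finite set set \<Rightarrow> 'm set \<Rightarrow> 'm set \<Rightarrow> int \<Rightarrow> ((('m \<Rightarrow> tgen) \<Rightarrow>\<^sub>0 'k::field) \<Rightarrow> 'k) set"
  where "tcochains K \<sigma> \<omega> t =
    {f. linear_on (sum_scale (*)) (*) (tchains K \<sigma> \<omega> t) f \<and> (\<forall>p. p \<notin> tchains K \<sigma> \<omega> t \<longrightarrow> f p = 0)}"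

definition tcodiff ::
    "'m::{finite,linorder} set set \<Rightarrow> 'm set \<Rightarrow> 'm set \<Rightarrow> int \<Rightarrow>
     ((('m \<Rightarrow> tgen) \<Rightarrow>\<^sub>0 'k::field) \<Rightarrow> 'k) \<Rightarrow> ((('m \<Rightarrow> tgen) \<Rightarrow>\<^sub>0 'k) \<Rightarrow> 'k)"
  where "tcodiff K \<sigma> \<omega> t f = (\<lambda>p. if p \<in> tchains K \<sigma> \<omega> (t + 1) then f (tdiff p) else 0)"

definition tcohomology ::
    "'m::{finite,linorder} set set \<Rightarrow> 'm set \<Rightarrow> 'm set \<Rightarrow> int \<Rightarrow>
     ((('m \<Rightarrow> tgen) \<Rightarrow>\<^sub>0 'k::field) \<Rightarrow> 'k) subquotient"
  where "tcohomology K \<sigma> \<omega> t = homology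
    (tcochains K \<sigma> \<omega> (t - 1), {0}) (tcodiff K \<sigma> \<omega> (t - 1))
    (tcochains K \<sigma> \<omega> t, {0}) (tcodiff K \<sigma> \<omega> t)
    (tcochains K \<sigma> \<omega> (t + 1), {0})"

definition fun_scale :: "'k::times \<Rightarrow> ('v \<Rightarrow> 'k) \<Rightarrow> 'v \<Rightarrow> 'k"
  where "fun_scale c f = (\<lambda>x. c * f x)"

end

theory Submission
  imports Defs
begin

text \<open>
  All three objects are controlled by one complex. Over \<open>k[x]\<close> the complex with basis \<open>e, n\<close> in
  degree 0 and \<open>nbar\<close> in degree 1, with \<open>d nbar = n - x^r e\<close> and augmentation \<open>e \<mapsto> 1\<close>,
  \<open>n \<mapsto> x^r\<close>, resolves \<open>k[x]\<close>, and its subcomplex spanned by \<open>n\<close> resolves the ideal \<open>(x^r)\<close>.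
  Tensoring \<open>m\<close> such pairs along a simplicial complex \<open>L\<close>, that is, keeping the basis tensors whose
  set of factors \<open>e\<close> or \<open>nbar\<close> is a face of \<open>L\<close>, gives a complex of free \<open>k[m]\<close>-modules with
  augmentation onto the composition ideal of \<open>L\<close>. For \<open>L = dual_complex K\<close> this ideal is generated
  by the monomials of the non-faces of \<open>K\<close>.

  The complex is a resolution (\<open>free_resolution_monomial_ideal\<close>). In a single factor, moving
  \<open>x^r q e\<close> to \<open>- q nbar\<close> is a \<open>k\<close>-linear homotopy that pushes every class to a normal form: \<open>n\<close> where
  the exponent of the monomial is at least \<open>r\<close>, and \<open>e\<close> where it is smaller. The homotopy does
  not enlarge the set of factors \<open>e\<close> or \<open>nbar\<close>, so it can be used one factor after the other for any
  \<open>L\<close>. In normal form nothing is left in positive degrees, and the augmentation is injective in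
  degree 0, since a monomial determines its normal form.

  Setting the variables to 0 turns \<open>d nbar = n - x^r e\<close> into \<open>d nbar = n\<close>. So the reduced complex is
  the part without \<open>i\<close> of \<open>T(L)\<close>, which splits according to the set of factors \<open>e\<close>
  (\<open>homology_mod_res_iso_direct_sum\<close>). The homology of the reduction does not depend on the chosen
  free resolution, by the usual comparison of resolutions (\<open>homology_mod_resolution_independent\<close>),
  and tensoring with the trivial module is reduction modulo the variables
  (\<open>Tor_trivial_iso_homology_mod\<close>). Together these compute Tor.

  The last isomorphism is combinatorial Alexander duality (\<open>alexander_duality\<close>), one non-face \<open>\<omega>\<close> of
  \<open>K\<close> at a time. Replacing a subset of \<open>\<omega>\<close> by its complement identifies the chains of the dual
  complex with the cochains of the full simplex on \<open>\<omega>\<close> that vanish on \<open>K\<close>; as \<open>\<omega>\<close> is nonempty, the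
  full simplex has no cohomology, and the connecting homomorphism of the pair shifts the degree
  by one.
\<close>

abbreviation "lookup \<equiv> Poly_Mapping.lookup"
abbreviation "keys \<equiv> Poly_Mapping.keys"
abbreviation "single \<equiv> Poly_Mapping.single"


section \<open>Isomorphisms of subquotients\<close>

lemma linear_onD:
  assumes "linear_on s s' A f"
  shows "x \<in> A \<Longrightarrow> y \<in> A \<Longrightarrow> f (x + y) = f x + f y" "x \<in> A \<Longrightarrow> f (s c x) = s' c (f x)"
  using assms by (auto simp: linear_on_def)

lemma linear_onI:
  assumes "\<And>x y. x \<in> A \<Longrightarrow> y \<in> A \<Longrightarrow> f (x + y) = f x + f y" "\<And>c x. x \<in> A \<Longrightarrow> f (s c x) = s' c (f x)"
  shows "linear_on s s' A f"
  using assms by (auto simp: linear_on_def)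

lemma linear_on_subset: "linear_on s s' A f \<Longrightarrow> B \<subseteq> A \<Longrightarrow> linear_on s s' B f"
  unfolding linear_on_def by blast

lemma linear_on_compose:
  assumes "linear_on s s' A f" "linear_on s' s'' B g" "f ` A \<subseteq> B"
  shows "linear_on s s'' A (\<lambda>x. g (f x))"
  using assms by (auto simp: linear_on_def image_subset_iff)

lemma linear_on_zero:
  assumes "module s" "module s'" "module.subspace s A" "linear_on s s' A f"
  shows "f 0 = 0"
proof -
  interpret m: module s by fact
  interpret m': module s' by fact
  have "f (s 0 0) = s' 0 (f 0)" using assms m.subspace_0 by (intro linear_onD) auto
  then show ?thesis by simp
qed

lemma linear_on_diff:
  assumes "module s" "module s'" "module.subspace s A" "linear_on s s' A f" "x \<in> A" "y \<in> A"
  shows "f (x - y) = f x - f y"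
proof -
  interpret m: module s by fact
  have "f ((x - y) + y) = f (x - y) + f y"
    using assms m.subspace_diff by (intro linear_onD(1)) auto
  then show ?thesis by simp
qed

lemma linear_on_sum:
  assumes "module s" "module s'" "module.subspace s A" "linear_on s s' A f" "\<And>i. i \<in> J \<Longrightarrow> g i \<in> A"
  shows "f (\<Sum>i\<in>J. g i) = (\<Sum>i\<in>J. f (g i))"
  using assms(5)
proof (induction J rule: infinite_finite_induct)
  case (insert i J)
  interpret m: module s by fact
  have "(\<Sum>i\<in>J. g i) \<in> A" using insert assms(3) by (intro m.subspace_sum) auto
  then show ?case using insert linear_onD(1)[OF assms(4)] by auto
qed (simp_all add: linear_on_zero[OF assms(1-4)])

lemma linear_on_diff_maps:
  assumes "module s'" "linear_on s s' A f" "linear_on s s' A g"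
  shows "linear_on s s' A (\<lambda>x. f x - g x)"
proof -
  interpret m': module s' by fact
  show ?thesis using assms by (auto simp: linear_on_def algebra_simps)
qed

lemma subspace_linear_image:
  assumes "module s" "module s'" "module.subspace s A" "linear_on s s' A f"
  shows "module.subspace s' (f ` A)"
proof -
  interpret m: module s by fact
  interpret m': module s' by fact
  show ?thesis
  proof (rule m'.subspaceI)
    show "0 \<in> f ` A"
      using linear_on_zero[OF assms] m.subspace_0[OF assms(3)] by (metis imageI)
    show "x + y \<in> f ` A" if "x \<in> f ` A" "y \<in> f ` A" for x y
      using that m.subspace_add[OF assms(3)] linear_onD(1)[OF assms(4)]
      by (metis (no_types, lifting) image_iff)
    show "s' c x \<in> f ` A" if "x \<in> f ` A" for x c
      using that m.subspace_scale[OF assms(3)] linear_onD(2)[OF assms(4)]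
      by (metis (no_types, lifting) image_iff)
  qed
qed

lemma subspace_linear_preimage_on:
  assumes "module s" "module s'" "module.subspace s A" "linear_on s s' A f" "module.subspace s' B"
  shows "module.subspace s {x \<in> A. f x \<in> B}"
proof -
  interpret m: module s by fact
  interpret m': module s' by fact
  show ?thesis
    using assms(3,5) linear_on_zero[OF assms(1-4)] linear_onD[OF assms(4)]
    by (intro m.subspaceI)
      (auto simp: m.subspace_0 m.subspace_add m.subspace_scale m'.subspace_0 m'.subspace_add m'.subspace_scale)
qed

lemma subspace_set_plus:
  assumes "module s" "module.subspace s A" "module.subspace s B"
  shows "module.subspace s (A + B)"
proof -
  interpret module s by fact
  show ?thesis
  proof (rule subspaceI)
    show "0 \<in> A + B"
      using set_plus_intro[OF subspace_0[OF assms(2)] subspace_0[OF assms(3)]] by simp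
  next
    fix x y assume "x \<in> A + B" "y \<in> A + B"
    then obtain a b a' b' where "x = a + b" "y = a' + b'" "a \<in> A" "b \<in> B" "a' \<in> A" "b' \<in> B"
      by (auto elim!: set_plus_elim)
    then show "x + y \<in> A + B"
      using set_plus_intro[OF subspace_add[OF assms(2), of a a'] subspace_add[OF assms(3), of b b']]
      by (simp add: algebra_simps)
  next
    fix c x assume "x \<in> A + B"
    then obtain a b where "x = a + b" "a \<in> A" "b \<in> B" by (rule set_plus_elim)
    then show "s c x \<in> A + B"
      using set_plus_intro[OF subspace_scale[OF assms(2), of a c] subspace_scale[OF assms(3), of b c]]
      by (simp add: scale_right_distrib)
  qed
qed

definition subquotient_module :: "('k::comm_ring_1 \<Rightarrow> 'v \<Rightarrow> 'v) \<Rightarrow> 'v::ab_group_add subquotient \<Rightarrow> bool"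
  where "subquotient_module s Q \<longleftrightarrow>
    module s \<and> module.subspace s (fst Q) \<and> module.subspace s (snd Q)"

text \<open>
  An isomorphism $Z/B \cong Z'/B'$ given by a linear map on representatives. Surjectivity is asked
  for modulo \<open>B'\<close> only, so a formula for one direction and a preimage up to boundaries suffice,
  and such maps compose without any choice of representatives.
\<close>

definition quotient_iso ::
    "('k::comm_ring_1 \<Rightarrow> 'v \<Rightarrow> 'v) \<Rightarrow> 'v::ab_group_add subquotient \<Rightarrow>
     ('k \<Rightarrow> 'w \<Rightarrow> 'w) \<Rightarrow> 'w::ab_group_add subquotient \<Rightarrow> ('v \<Rightarrow> 'w) \<Rightarrow> bool"
  where "quotient_iso s Q s' Q' f \<longleftrightarrow>
    subquotient_module s Q \<and> subquotient_module s' Q' \<and>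
    linear_on s s' (fst Q) f \<and> f ` fst Q \<subseteq> fst Q' \<and>
    (\<forall>x\<in>fst Q. f x \<in> snd Q' \<longleftrightarrow> x \<in> snd Q) \<and>
    (\<forall>y\<in>fst Q'. \<exists>x\<in>fst Q. y - f x \<in> snd Q')"

lemma quotient_isoD:
  assumes "quotient_iso s Q s' Q' f"
  shows "subquotient_module s Q" "subquotient_module s' Q'" "linear_on s s' (fst Q) f"
    "f ` fst Q \<subseteq> fst Q'" "x \<in> fst Q \<Longrightarrow> f x \<in> snd Q' \<longleftrightarrow> x \<in> snd Q"
    "y \<in> fst Q' \<Longrightarrow> \<exists>x\<in>fst Q. y - f x \<in> snd Q'"
  using assms by (simp_all add: quotient_iso_def)

lemma quotient_isoI:
  assumes "subquotient_module s Q" "subquotient_module s' Q'" "linear_on s s' (fst Q) f"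
    "\<And>x. x \<in> fst Q \<Longrightarrow> f x \<in> fst Q'" "\<And>x. x \<in> fst Q \<Longrightarrow> f x \<in> snd Q' \<longleftrightarrow> x \<in> snd Q"
    "\<And>y. y \<in> fst Q' \<Longrightarrow> \<exists>x\<in>fst Q. y - f x \<in> snd Q'"
  shows "quotient_iso s Q s' Q' f"
  using assms by (simp add: quotient_iso_def image_subset_iff)

lemma coset_eq_iff:
  assumes "module s" "module.subspace s B"
  shows "x +o B = y +o B \<longleftrightarrow> x - y \<in> B"
proof -
  interpret module s by fact
  note B = assms(2)
  show ?thesis
  proof
    assume "x +o B = y +o B"
    then have "x + 0 \<in> y +o B" using subspace_0[OF B] by (metis set_plus_intro2)
    then show "x - y \<in> B" by (auto simp: elt_set_plus_def)
  next
    assume d: "x - y \<in> B"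
    have *: "x +o B \<subseteq> y +o B" if "x - y \<in> B" for x y
    proof
      fix z assume "z \<in> x +o B"
      then obtain b where b: "b \<in> B" "z = x + b" by (auto simp: elt_set_plus_def)
      have "z = y + ((x - y) + b)" by (simp add: b)
      then show "z \<in> y +o B" using subspace_add[OF B that b(1)] by (metis set_plus_intro2)
    qed
    show "x +o B = y +o B"
      using *[OF d] *[of y x] subspace_neg[OF B d] by simp
  qed
qed

text \<open>
  The induced map on cosets is well defined because \<open>f\<close> maps \<open>B\<close> into \<open>B'\<close>, and injective because
  only elements of \<open>B\<close> go to \<open>B'\<close>.
\<close>

lemma isomorphic_if_quotient_iso:
  assumes "quotient_iso s Q s' Q' f"
  shows "isomorphic s Q s' Q'"
proof -
  have s: "module s" "module s'"
    and Z: "module.subspace s (fst Q)" and B: "module.subspace s (snd Q)"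
    and Z': "module.subspace s' (fst Q')" and B': "module.subspace s' (snd Q')"
    and lin: "linear_on s s' (fst Q) f" and maps: "f ` fst Q \<subseteq> fst Q'"
    and ker: "\<And>x. x \<in> fst Q \<Longrightarrow> f x \<in> snd Q' \<longleftrightarrow> x \<in> snd Q"
    and surj: "\<And>y. y \<in> fst Q' \<Longrightarrow> \<exists>x\<in>fst Q. y - f x \<in> snd Q'"
    using assms by (auto simp: quotient_iso_def subquotient_module_def)
  interpret m: module s by fact
  interpret m': module s' by fact
  note eq = coset_eq_iff[OF s(1) B] and eq' = coset_eq_iff[OF s(2) B']
  have diff: "f (x - y) = f x - f y" if "x \<in> fst Q" "y \<in> fst Q" for x y
    by (rule linear_on_diff[OF s Z lin that])
  define F where "F C = f (SOME x. x \<in> fst Q \<and> C = x +o snd Q) +o snd Q'" for C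
  have F: "F (x +o snd Q) = f x +o snd Q'" if "x \<in> fst Q" for x
  proof -
    define y where "y = (SOME y. y \<in> fst Q \<and> x +o snd Q = y +o snd Q)"
    have y: "y \<in> fst Q" "x +o snd Q = y +o snd Q"
      using someI[of "\<lambda>y. y \<in> fst Q \<and> x +o snd Q = y +o snd Q" x] that by (auto simp: y_def)
    have "y - x \<in> snd Q" using y(2) eq[of y x] by simp
    then have "f y - f x \<in> snd Q'"
      using ker[of "y - x"] m.subspace_diff[OF Z y(1) that] diff[OF y(1) that] by simp
    then show ?thesis by (simp add: F_def y_def eq')
  qed
  have rep: "u - f x \<in> snd Q'" if "u \<in> F (x +o snd Q)" "x \<in> fst Q" for u x
    using that(1) unfolding F[OF that(2)] by (auto simp: elt_set_plus_def)
  have "bij_betw F (cosets Q) (cosets Q')"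
  proof (rule bij_betwI')
    fix C D assume "C \<in> cosets Q" "D \<in> cosets Q"
    then obtain x y where C: "C = x +o snd Q" "x \<in> fst Q" and D: "D = y +o snd Q" "y \<in> fst Q"
      by (auto simp: cosets_def)
    show "F C = F D \<longleftrightarrow> C = D"
      using ker[of "x - y"] m.subspace_diff[OF Z C(2) D(2)]
      by (simp add: C D F eq eq' diff)
  next
    fix C assume "C \<in> cosets Q"
    then obtain x where "C = x +o snd Q" "x \<in> fst Q" by (auto simp: cosets_def)
    then show "F C \<in> cosets Q'" unfolding cosets_def using maps F[of x] by blast
  next
    fix D assume "D \<in> cosets Q'"
    then obtain y where y: "D = y +o snd Q'" "y \<in> fst Q'" by (auto simp: cosets_def)
    obtain x where "x \<in> fst Q" "y - f x \<in> snd Q'" using surj y by auto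
    then show "\<exists>C\<in>cosets Q. D = F C"
      by (intro bexI[of _ "x +o snd Q"]) (auto simp: y F eq' cosets_def)
  qed
  moreover have "F ((x + y) +o snd Q) = (u + v) +o snd Q'"
    if "x \<in> fst Q" "y \<in> fst Q" "u \<in> F (x +o snd Q)" "v \<in> F (y +o snd Q)" for x y u v
  proof -
    have "(u - f x) + (v - f y) \<in> snd Q'" using that rep by (intro m'.subspace_add[OF B']) auto
    then have "(u + v) - f (x + y) \<in> snd Q'"
      using linear_onD(1)[OF lin, of x y] that by (simp add: algebra_simps)
    then have "(u + v) +o snd Q' = f (x + y) +o snd Q'" by (simp only: eq')
    then show ?thesis using F[of "x + y"] m.subspace_add[OF Z] that by simp
  qed
  moreover have "F (s c x +o snd Q) = s' c u +o snd Q'"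
    if "x \<in> fst Q" "u \<in> F (x +o snd Q)" for x u c
  proof -
    have "s' c (u - f x) \<in> snd Q'" using that rep by (intro m'.subspace_scale[OF B']) auto
    then have "s' c u - f (s c x) \<in> snd Q'"
      using linear_onD(2)[OF lin, of x] that by (simp add: algebra_simps)
    then have "s' c u +o snd Q' = f (s c x) +o snd Q'" by (simp only: eq')
    then show ?thesis using F[of "s c x"] m.subspace_scale[OF Z] that by simp
  qed
  ultimately show ?thesis unfolding isomorphic_def by (intro exI[of _ F]) blast
qed

lemma quotient_iso_trans:
  assumes f: "quotient_iso s Q s' Q' f" and g: "quotient_iso s' Q' s'' Q'' g"
  shows "quotient_iso s Q s'' Q'' (\<lambda>x. g (f x))"
proof -
  have s: "module s'" "module s''" and Z': "module.subspace s' (fst Q')"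
    and B'': "module.subspace s'' (snd Q'')"
    using f g by (auto simp: quotient_iso_def subquotient_module_def)
  interpret m': module s' by fact
  interpret m'': module s'' by fact
  have "\<exists>x\<in>fst Q. z - g (f x) \<in> snd Q''" if z: "z \<in> fst Q''" for z
  proof -
    obtain y where y: "y \<in> fst Q'" "z - g y \<in> snd Q''"
      using g z by (auto simp: quotient_iso_def)
    obtain x where x: "x \<in> fst Q" "y - f x \<in> snd Q'"
      using f y by (auto simp: quotient_iso_def)
    have fx: "f x \<in> fst Q'" using f x by (auto simp: quotient_iso_def)
    have "g (y - f x) \<in> snd Q''"
      using g x m'.subspace_diff[OF Z' y(1) fx] by (auto simp: quotient_iso_def)
    moreover have "g (y - f x) = g y - g (f x)"
      using g fx y by (intro linear_on_diff[OF s Z']) (auto simp: quotient_iso_def)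
    ultimately have "g y - g (f x) \<in> snd Q''" by simp
    from m''.subspace_add[OF B'' y(2) this] have "z - g (f x) \<in> snd Q''" by simp
    then show ?thesis using x by blast
  qed
  moreover have "linear_on s s'' (fst Q) (\<lambda>x. g (f x))"
    by (rule linear_on_compose[OF quotient_isoD(3)[OF f] quotient_isoD(3)[OF g] quotient_isoD(4)[OF f]])
  moreover have "g (f x) \<in> snd Q'' \<longleftrightarrow> x \<in> snd Q" "g (f x) \<in> fst Q''" if "x \<in> fst Q" for x
    using quotient_isoD(4,5)[OF f] quotient_isoD(4,5)[OF g] that by blast+
  ultimately show ?thesis
    using quotient_isoD(1)[OF f] quotient_isoD(2)[OF g] by (intro quotient_isoI) auto
qed

lemma lookup_sum_scale_module:
  assumes "module s"
  shows "lookup (sum_scale s c p) x = s c (lookup p x)"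
  using module.scale_zero_right[OF assms]
  by (simp add: sum_scale_def Poly_Mapping.map.rep_eq when_def)

lemma module_sum_scale_of_module:
  assumes "module s"
  shows "module (sum_scale s :: 'r::comm_ring_1 \<Rightarrow> ('i \<Rightarrow>\<^sub>0 'v::ab_group_add) \<Rightarrow> _)"
proof -
  interpret module s by fact
  show ?thesis
    by unfold_locales
      (auto intro!: poly_mapping_eqI simp: lookup_sum_scale_module[OF assms] lookup_add algebra_simps)
qed

lemma subspace_direct_sum:
  assumes "module s" and "\<And>i. i \<in> S \<Longrightarrow> module.subspace s (A i)"
  shows "module.subspace (sum_scale s)
    {f. keys f \<subseteq> S \<and> (\<forall>i\<in>S. lookup f i \<in> A i)}"
proof -
  interpret m: module s by fact
  show ?thesis
  proof (rule module.subspaceI[OF module_sum_scale_of_module[OF assms(1)]])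
    show "0 \<in> {f. keys f \<subseteq> S \<and> (\<forall>i\<in>S. lookup f i \<in> A i)}"
      using assms(2) by (simp add: m.subspace_0)
  next
    fix f g
    assume f: "f \<in> {f. keys f \<subseteq> S \<and> (\<forall>i\<in>S. lookup f i \<in> A i)}"
      and g: "g \<in> {f. keys f \<subseteq> S \<and> (\<forall>i\<in>S. lookup f i \<in> A i)}"
    show "f + g \<in> {f. keys f \<subseteq> S \<and> (\<forall>i\<in>S. lookup f i \<in> A i)}"
    proof (intro CollectI conjI ballI)
      show "keys (f + g) \<subseteq> S" using f g keys_add[of f g] by blast
      show "lookup (f + g) i \<in> A i" if "i \<in> S" for i
        unfolding lookup_add using f g that by (intro m.subspace_add assms(2)) auto
    qed
  next
    fix c f
    assume f: "f \<in> {f. keys f \<subseteq> S \<and> (\<forall>i\<in>S. lookup f i \<in> A i)}"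
    have "keys (sum_scale s c f) \<subseteq> keys f"
      by (auto simp: in_keys_iff lookup_sum_scale_module[OF assms(1)])
    then show "sum_scale s c f \<in> {f. keys f \<subseteq> S \<and> (\<forall>i\<in>S. lookup f i \<in> A i)}"
      using f m.subspace_scale[OF assms(2)] by (auto simp: lookup_sum_scale_module[OF assms(1)])
  qed
qed

lemma subquotient_module_direct_sum:
  assumes "module s" and "\<And>i. i \<in> S \<Longrightarrow> subquotient_module s (Q i)"
  shows "subquotient_module (sum_scale s) (direct_sum S Q)"
  unfolding subquotient_module_def direct_sum_def fst_conv snd_conv
  using assms(2) by (intro conjI module_sum_scale_of_module subspace_direct_sum assms(1))
    (auto simp: subquotient_module_def)

text \<open>
  The bijection \<open>h\<close> of index sets will be complementation, which turns faces of the dual complex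
  into non-faces.
\<close>

lemma quotient_iso_direct_sum:
  fixes s :: "'k::comm_ring_1 \<Rightarrow> 'v::ab_group_add \<Rightarrow> 'v" and s' :: "'k \<Rightarrow> 'w::ab_group_add \<Rightarrow> 'w"
  assumes "finite S" and h: "bij_betw h S S'" and s: "module s" "module s'"
    and iso: "\<And>i. i \<in> S \<Longrightarrow> quotient_iso s (Q i) s' (Q' (h i)) (f i)"
  obtains \<Phi> where "quotient_iso (sum_scale s) (direct_sum S Q) (sum_scale s') (direct_sum S' Q') \<Phi>"
proof -
  define k where "k = inv_into S h"
  have k: "k j \<in> S" "h (k j) = j" if "j \<in> S'" for j
    using that h by (auto simp: k_def bij_betw_def inv_into_into f_inv_into_f)
  have hk: "h i \<in> S'" "k (h i) = i" if "i \<in> S" for i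
    using that h by (auto simp: k_def bij_betw_def)
  have fin: "finite S'" using assms(1) h bij_betw_finite by auto
  have isok: "quotient_iso s (Q (k j)) s' (Q' j) (f (k j))" if "j \<in> S'" for j
    using iso[OF k(1)[OF that]] k(2)[OF that] by simp
  define \<Phi> where "\<Phi> p = Abs_poly_mapping (\<lambda>j. if j \<in> S' then f (k j) (lookup p (k j)) else 0)"
    for p :: "'a \<Rightarrow>\<^sub>0 'v"
  have lookup\<Phi>: "lookup (\<Phi> p) j = (if j \<in> S' then f (k j) (lookup p (k j)) else 0)" for p j
    unfolding \<Phi>_def by (subst lookup_Abs_poly_mapping) (auto intro: finite_subset[OF _ fin])
  have keys: "keys (\<Phi> p) \<subseteq> S'" for p
    by (auto simp: in_keys_iff lookup\<Phi> split: if_splits)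
  have Q: "subquotient_module s (Q i)" if "i \<in> S" for i using iso[OF that] by (simp add: quotient_iso_def)
  have Q': "subquotient_module s' (Q' j)" if "j \<in> S'" for j using isok[OF that] by (simp add: quotient_iso_def)
  have zero: "f (k j) 0 = 0" if "j \<in> S'" for j
    using isok[OF that] Q[OF k(1)[OF that]]
    by (intro linear_on_zero[OF s]) (auto simp: quotient_iso_def subquotient_module_def)
  have "quotient_iso (sum_scale s) (direct_sum S Q) (sum_scale s') (direct_sum S' Q') \<Phi>"
    unfolding quotient_iso_def
  proof (intro conjI ballI)
    show "subquotient_module (sum_scale s) (direct_sum S Q)"
      "subquotient_module (sum_scale s') (direct_sum S' Q')"
      using s Q Q' by (auto intro: subquotient_module_direct_sum)
    show "linear_on (sum_scale s) (sum_scale s') (fst (direct_sum S Q)) \<Phi>"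
    proof (rule linear_onI)
      fix x y assume xy: "x \<in> fst (direct_sum S Q)" "y \<in> fst (direct_sum S Q)"
      show "\<Phi> (x + y) = \<Phi> x + \<Phi> y"
      proof (rule poly_mapping_eqI)
        fix j show "lookup (\<Phi> (x + y)) j = lookup (\<Phi> x + \<Phi> y) j"
        proof (cases "j \<in> S'")
          case True
          then show ?thesis using xy k isok[OF True]
            by (auto simp: lookup\<Phi> lookup_add direct_sum_def quotient_iso_def linear_on_def)
        qed (simp add: lookup\<Phi> lookup_add)
      qed
    next
      fix c x assume x: "x \<in> fst (direct_sum S Q)"
      show "\<Phi> (sum_scale s c x) = sum_scale s' c (\<Phi> x)"
      proof (rule poly_mapping_eqI)
        fix j show "lookup (\<Phi> (sum_scale s c x)) j = lookup (sum_scale s' c (\<Phi> x)) j"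
        proof (cases "j \<in> S'")
          case True
          then show ?thesis using x k isok[OF True]
            by (auto simp: lookup\<Phi> lookup_sum_scale_module s direct_sum_def quotient_iso_def linear_on_def)
        qed (simp add: lookup\<Phi> lookup_sum_scale_module s module.scale_zero_right)
      qed
    qed
    show "\<Phi> ` fst (direct_sum S Q) \<subseteq> fst (direct_sum S' Q')"
      using keys k isok by (fastforce simp: direct_sum_def lookup\<Phi> quotient_iso_def)
    fix p assume p: "p \<in> fst (direct_sum S Q)"
    have ker: "f (k j) (lookup p (k j)) \<in> snd (Q' j) \<longleftrightarrow> lookup p (k j) \<in> snd (Q (k j))"
      if "j \<in> S'" for j
      using isok[OF that] p k(1)[OF that] by (auto simp: quotient_iso_def direct_sum_def)
    have "\<Phi> p \<in> snd (direct_sum S' Q') \<longleftrightarrow> (\<forall>j\<in>S'. lookup p (k j) \<in> snd (Q (k j)))"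
      using keys ker by (auto simp: direct_sum_def lookup\<Phi>)
    also have "\<dots> \<longleftrightarrow> (\<forall>i\<in>S. lookup p i \<in> snd (Q i))"
      using k hk by metis
    also have "\<dots> \<longleftrightarrow> p \<in> snd (direct_sum S Q)" using p by (auto simp: direct_sum_def)
    finally show "\<Phi> p \<in> snd (direct_sum S' Q') \<longleftrightarrow> p \<in> snd (direct_sum S Q)" .
  next
    fix q assume q: "q \<in> fst (direct_sum S' Q')"
    have "\<exists>x. \<forall>i\<in>S. x i \<in> fst (Q i) \<and> lookup q (h i) - f i (x i) \<in> snd (Q' (h i))"
    proof (rule bchoice, rule ballI)
      fix i assume i: "i \<in> S"
      then have "lookup q (h i) \<in> fst (Q' (h i))" using q hk by (auto simp: direct_sum_def)
      then show "\<exists>x. x \<in> fst (Q i) \<and> lookup q (h i) - f i x \<in> snd (Q' (h i))"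
        using iso[OF i] by (auto simp: quotient_iso_def)
    qed
    then obtain x where x: "\<And>i. i \<in> S \<Longrightarrow> x i \<in> fst (Q i)"
      "\<And>i. i \<in> S \<Longrightarrow> lookup q (h i) - f i (x i) \<in> snd (Q' (h i))" by blast
    define p where "p = Abs_poly_mapping (\<lambda>i. if i \<in> S then x i else 0)"
    have lp: "lookup p i = (if i \<in> S then x i else 0)" for i
      unfolding p_def by (subst lookup_Abs_poly_mapping) (auto intro: finite_subset[OF _ assms(1)])
    have "p \<in> fst (direct_sum S Q)" using x by (auto simp: direct_sum_def lp in_keys_iff split: if_splits)
    moreover have "q - \<Phi> p \<in> snd (direct_sum S' Q')"
    proof -
      have "lookup q j = 0" if "j \<notin> S'" for j
        using that q by (auto simp: direct_sum_def in_keys_iff)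
      then have "keys (q - \<Phi> p) \<subseteq> S'"
        by (auto simp: in_keys_iff lookup_minus lookup\<Phi> split: if_splits)
      moreover have "lookup (q - \<Phi> p) j \<in> snd (Q' j)" if "j \<in> S'" for j
        using x(2)[OF k(1)[OF that]] k[OF that] that by (simp add: lookup_minus lookup\<Phi> lp)
      ultimately show ?thesis by (auto simp: direct_sum_def)
    qed
    ultimately show "\<exists>p\<in>fst (direct_sum S Q). q - \<Phi> p \<in> snd (direct_sum S' Q')" by blast
  qed
  then show thesis by (rule that)
qed

section \<open>Comparison of free resolutions\<close>

lemma free_resolutionD:
  assumes "free_resolution s F d \<epsilon> s' M"
  shows "module s" "\<exists>B. \<not> module.dependent s B \<and> module.span s B = F t" "t < 0 \<Longrightarrow> F t = {0}"
    "linear_on s s (F t) (d t)" "x \<in> F t \<Longrightarrow> d t x \<in> F (t - 1)"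
    "linear_on s s' (F 0) \<epsilon>" "\<epsilon> ` F 0 = M"
    "x \<in> F 0 \<Longrightarrow> \<epsilon> x = 0 \<longleftrightarrow> x \<in> d 1 ` F 1"
    "t \<ge> 1 \<Longrightarrow> x \<in> F t \<Longrightarrow> d t x = 0 \<longleftrightarrow> x \<in> d (t + 1) ` F (t + 1)"
proof -
  note * = assms[unfolded free_resolution_def]
  show "module s" "\<exists>B. \<not> module.dependent s B \<and> module.span s B = F t" "t < 0 \<Longrightarrow> F t = {0}"
    "linear_on s s (F t) (d t)" "linear_on s s' (F 0) \<epsilon>" "\<epsilon> ` F 0 = M"
    using * by simp_all
  show "x \<in> F t \<Longrightarrow> d t x \<in> F (t - 1)" using * by blast
  show "x \<in> F 0 \<Longrightarrow> \<epsilon> x = 0 \<longleftrightarrow> x \<in> d 1 ` F 1" using * by blast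
  show "t \<ge> 1 \<Longrightarrow> x \<in> F t \<Longrightarrow> d t x = 0 \<longleftrightarrow> x \<in> d (t + 1) ` F (t + 1)" using * by blast
qed

lemma free_resolution_subspace:
  assumes "free_resolution s F d \<epsilon> s' M"
  shows "module.subspace s (F t)"
proof -
  interpret module s by (rule free_resolutionD(1)[OF assms])
  show ?thesis using free_resolutionD(2)[OF assms, of t] subspace_span by metis
qed

lemma free_resolution_dd:
  assumes F: "free_resolution s F d \<epsilon> s' M" and x: "x \<in> F t"
  shows "d (t - 1) (d t x) = 0"
proof (cases "t \<ge> 2")
  case True
  have "d t x \<in> d (t - 1 + 1) ` F (t - 1 + 1)" using x by simp
  then show ?thesis
    using free_resolutionD(9)[OF F, of "t - 1" "d t x"] free_resolutionD(5)[OF F x] True by simp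
next
  case False
  have "d (t - 1) (d t x) \<in> F (t - 1 - 1)"
    by (intro free_resolutionD(5)[OF F] x)
  then show ?thesis using False free_resolutionD(3)[OF F, of "t - 1 - 1"] by simp
qed

text \<open>
  Free modules are projective: choose preimages of the \<open>\<psi> b\<close> for a basis, and extend by means of
  the coordinates of a vector.
\<close>

lemma linear_lift_through_surjection:
  fixes s :: "'r::comm_ring_1 \<Rightarrow> 'a::ab_group_add \<Rightarrow> 'a"
    and s' :: "'r \<Rightarrow> 'b::ab_group_add \<Rightarrow> 'b" and s'' :: "'r \<Rightarrow> 'c::ab_group_add \<Rightarrow> 'c"
  assumes m: "module s" "module s'" "module s''"
    and free: "\<exists>B. \<not> module.dependent s B \<and> module.span s B = P"
    and Q: "module.subspace s' Q"
    and lin: "linear_on s s'' P \<psi>" "linear_on s' s'' Q D" and sub: "\<psi> ` P \<subseteq> D ` Q"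
  shows "\<exists>\<chi>. linear_on s s' P \<chi> \<and> \<chi> ` P \<subseteq> Q \<and> (\<forall>x\<in>P. D (\<chi> x) = \<psi> x)"
proof -
  interpret P: module s by fact
  interpret Q: module s' by fact
  interpret R: module s'' by fact
  obtain B where B: "P.independent B" "P.span B = P" using free by blast
  have subP: "P.subspace P" using P.subspace_span[of B] B(2) by simp
  have BP: "b \<in> P" if "b \<in> B" for b using P.span_base[OF that] B(2) by simp
  have "\<forall>b\<in>B. \<exists>c. c \<in> Q \<and> D c = \<psi> b" using sub BP by (metis (no_types, lifting) image_iff image_subset_iff)
  then obtain c where c: "\<And>b. b \<in> B \<Longrightarrow> c b \<in> Q" "\<And>b. b \<in> B \<Longrightarrow> D (c b) = \<psi> b"
    by metis
  define r where "r = P.representation B"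
  define \<chi> where "\<chi> x = (\<Sum>b | r x b \<noteq> 0. s' (r x b) (c b))" for x
  have fin: "finite {b. r x b \<noteq> 0}" for x by (simp add: r_def P.finite_representation)
  have rB: "r x b \<noteq> 0 \<Longrightarrow> b \<in> B" for x b unfolding r_def by (rule P.representation_ne_zero)
  have eq: "\<chi> x = (\<Sum>b\<in>T. s' (r x b) (c b))" if "finite T" "{b. r x b \<noteq> 0} \<subseteq> T" for x T
    unfolding \<chi>_def using that by (intro sum.mono_neutral_left) auto
  have "linear_on s s' P \<chi>"
  proof (rule linear_onI)
    fix x y assume xy: "x \<in> P" "y \<in> P"
    have r: "r (x + y) = (\<lambda>b. r x b + r y b)"
      unfolding r_def using B xy by (intro P.representation_add) auto
    let ?T = "{b. r x b \<noteq> 0} \<union> {b. r y b \<noteq> 0}"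
    have "\<chi> (x + y) = (\<Sum>b\<in>?T. s' (r (x + y) b) (c b))"
      by (rule eq) (auto simp: fin r)
    also have "\<dots> = (\<Sum>b\<in>?T. s' (r x b) (c b)) + (\<Sum>b\<in>?T. s' (r y b) (c b))"
      by (simp add: r Q.scale_left_distrib sum.distrib)
    also have "\<dots> = \<chi> x + \<chi> y" by (simp add: eq[of ?T] fin)
    finally show "\<chi> (x + y) = \<chi> x + \<chi> y" .
  next
    fix k x assume x: "x \<in> P"
    have r: "r (s k x) = (\<lambda>b. k * r x b)"
      unfolding r_def using B x by (intro P.representation_scale) auto
    have "\<chi> (s k x) = (\<Sum>b\<in>{b. r x b \<noteq> 0}. s' (r (s k x) b) (c b))"
      by (rule eq) (auto simp: fin r)
    also have "\<dots> = s' k (\<chi> x)" by (simp add: r \<chi>_def Q.scale_sum_right)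
    finally show "\<chi> (s k x) = s' k (\<chi> x)" .
  qed
  moreover have "\<chi> ` P \<subseteq> Q"
    using c(1) rB by (auto simp: \<chi>_def intro!: Q.subspace_sum[OF Q] Q.subspace_scale[OF Q])
  moreover have "D (\<chi> x) = \<psi> x" if x: "x \<in> P" for x
  proof -
    have "D (\<chi> x) = (\<Sum>b | r x b \<noteq> 0. D (s' (r x b) (c b)))"
      unfolding \<chi>_def using c(1) rB
      by (intro linear_on_sum[OF m(2,3) Q lin(2)]) (auto intro!: Q.subspace_scale[OF Q])
    also have "\<dots> = (\<Sum>b | r x b \<noteq> 0. \<psi> (s (r x b) b))"
    proof (rule sum.cong[OF refl])
      fix b assume "b \<in> {b. r x b \<noteq> 0}"
      then have b: "b \<in> B" using rB by simp
      show "D (s' (r x b) (c b)) = \<psi> (s (r x b) b)"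
        by (simp add: linear_onD(2)[OF lin(2) c(1)[OF b]] linear_onD(2)[OF lin(1) BP[OF b]] c(2)[OF b])
    qed
    also have "\<dots> = \<psi> (\<Sum>b | r x b \<noteq> 0. s (r x b) b)"
      using P.subspace_scale[OF subP BP[OF rB]]
      by (intro linear_on_sum[OF m(1,3) subP lin(1), symmetric]) simp
    also have "(\<Sum>b | r x b \<noteq> 0. s (r x b) b) = x"
      unfolding r_def using B x by (intro P.sum_nonzero_representation_eq) auto
    finally show ?thesis .
  qed
  ultimately show ?thesis by blast
qed

definition chain_map ::
    "('r \<Rightarrow> 'f \<Rightarrow> 'f) \<Rightarrow> (int \<Rightarrow> 'f::ab_group_add set) \<Rightarrow> (int \<Rightarrow> 'f \<Rightarrow> 'f) \<Rightarrow>
     ('r \<Rightarrow> 'g \<Rightarrow> 'g) \<Rightarrow> (int \<Rightarrow> 'g::ab_group_add set) \<Rightarrow> (int \<Rightarrow> 'g \<Rightarrow> 'g) \<Rightarrow> (int \<Rightarrow> 'f \<Rightarrow> 'g) \<Rightarrow> bool"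
  where "chain_map s F d s' G d' f \<longleftrightarrow> (\<forall>t. linear_on s s' (F t) (f t) \<and> f t ` F t \<subseteq> G t \<and>
    (\<forall>x\<in>F t. d' t (f t x) = f (t - 1) (d t x)))"

lemma chain_mapD:
  assumes "chain_map s F d s' G d' f"
  shows "linear_on s s' (F t) (f t)" "x \<in> F t \<Longrightarrow> f t x \<in> G t"
    "x \<in> F t \<Longrightarrow> d' t (f t x) = f (t - 1) (d t x)"
  using assms unfolding chain_map_def by blast+

text \<open>
  The lift to the next degree exists as soon as the map built so far sends boundaries to
  boundaries; exactness of the target then gives the same property for the lift. This property is
  therefore carried along in the recursion.
\<close>

lemma free_resolution_chain_map_exists:
  fixes s :: "'r::comm_ring_1 \<Rightarrow> 'f::ab_group_add \<Rightarrow> 'f" and s' :: "'r \<Rightarrow> 'g::ab_group_add \<Rightarrow> 'g"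
  assumes F: "free_resolution s F d \<epsilon> sM M" and G: "free_resolution s' G d' \<epsilon>' sM M" and sM: "module sM"
  shows "\<exists>f. chain_map s F d s' G d' f \<and> (\<forall>x\<in>F 0. \<epsilon>' (f 0 x) = \<epsilon> x)"
proof -
  note s = free_resolutionD(1)[OF F] and s' = free_resolutionD(1)[OF G]
  define PP where "PP n f \<longleftrightarrow> linear_on s s' (F (int n)) f \<and> f ` F (int n) \<subseteq> G (int n) \<and>
      (\<forall>y\<in>F (int n + 1). f (d (int n + 1) y) \<in> d' (int n + 1) ` G (int n + 1)) \<and>
      (n = 0 \<longrightarrow> (\<forall>x\<in>F 0. \<epsilon>' (f x) = \<epsilon> x))" for n f
  define QQ where "QQ n f g \<longleftrightarrow> (\<forall>x\<in>F (int n + 1). d' (int n + 1) (g x) = f (d (int n + 1) x))"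
    for n and f g :: "'f \<Rightarrow> 'g"
  have "\<exists>f. \<forall>n. PP n (f n) \<and> QQ n (f n) (f (Suc n))"
  proof (rule dependent_nat_choice)
    have "\<epsilon> ` F 0 \<subseteq> \<epsilon>' ` G 0" by (simp add: free_resolutionD(7)[OF F] free_resolutionD(7)[OF G])
    from linear_lift_through_surjection[OF s s' sM free_resolutionD(2)[OF F]
        free_resolution_subspace[OF G] free_resolutionD(6)[OF F] free_resolutionD(6)[OF G] this]
    obtain f where f: "linear_on s s' (F 0) f" "f ` F 0 \<subseteq> G 0" "\<And>x. x \<in> F 0 \<Longrightarrow> \<epsilon>' (f x) = \<epsilon> x"
      by blast
    have "f (d 1 y) \<in> d' 1 ` G 1" if "y \<in> F 1" for y
    proof -
      have "d 1 y \<in> F 0" using free_resolutionD(5)[OF F that] by simp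
      moreover have "\<epsilon> (d 1 y) = 0" using free_resolutionD(8)[OF F \<open>d 1 y \<in> F 0\<close>] that by blast
      ultimately show ?thesis
        using f free_resolutionD(8)[OF G, of "f (d 1 y)"] by (auto simp: image_subset_iff)
    qed
    then show "\<exists>f. PP 0 f" using f unfolding PP_def by (intro exI[of _ f]) simp
  next
    fix f n assume f: "PP n f"
    have lin: "linear_on s s' (F (int n + 1)) (\<lambda>x. f (d (int n + 1) x))"
      using f free_resolutionD(5)[OF F, of _ "int n + 1"]
      by (intro linear_on_compose[OF free_resolutionD(4)[OF F]]) (auto simp: PP_def)
    have sub: "(\<lambda>x. f (d (int n + 1) x)) ` F (int n + 1) \<subseteq> d' (int n + 1) ` G (int n + 1)"
      using f by (auto simp: PP_def)
    from linear_lift_through_surjection[OF s s' s' free_resolutionD(2)[OF F]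
        free_resolution_subspace[OF G] lin free_resolutionD(4)[OF G] sub]
    obtain g where g: "linear_on s s' (F (int n + 1)) g" "g ` F (int n + 1) \<subseteq> G (int n + 1)"
      "\<And>x. x \<in> F (int n + 1) \<Longrightarrow> d' (int n + 1) (g x) = f (d (int n + 1) x)"
      by blast
    have f0: "f 0 = 0"
      using f by (intro linear_on_zero[OF s s' free_resolution_subspace[OF F, of "int n"]])
        (auto simp: PP_def)
    have "g (d (int n + 2) y) \<in> d' (int n + 2) ` G (int n + 2)" if y: "y \<in> F (int n + 2)" for y
    proof -
      have dy: "d (int n + 2) y \<in> F (int n + 1)" using free_resolutionD(5)[OF F y] by (simp add: add.commute)
      have "d (int n + 1) (d (int n + 2) y) = 0" using free_resolution_dd[OF F y] by (simp add: add.commute)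
      then have "d' (int n + 1) (g (d (int n + 2) y)) = 0" using g(3)[OF dy] f0 by simp
      then show ?thesis
        using free_resolutionD(9)[OF G, of "int n + 1" "g (d (int n + 2) y)"] g(2) dy
        by (simp add: image_subset_iff add.assoc)
    qed
    then show "\<exists>g. PP (Suc n) g \<and> QQ n f g"
      using g unfolding PP_def QQ_def by (intro exI[of _ g]) (simp add: add.commute add.assoc)
  qed
  then obtain f where PP: "\<And>n. PP n (f n)" and QQ: "\<And>n. QQ n (f n) (f (Suc n))" by blast
  define f' where "f' t = (if t < 0 then (\<lambda>_. 0) else f (nat t))" for t
  have "chain_map s F d s' G d' f'"
    unfolding chain_map_def
  proof (intro allI conjI ballI)
    fix t :: int
    show "linear_on s s' (F t) (f' t)"
      using PP[of "nat t"] module.scale_zero_right[OF s']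
      by (cases "t < 0") (auto simp: f'_def PP_def intro!: linear_onI)
    show "f' t ` F t \<subseteq> G t"
      using PP[of "nat t"] module.subspace_0[OF s' free_resolution_subspace[OF G, of t]]
      by (cases "t < 0") (auto simp: f'_def PP_def)
    fix x assume x: "x \<in> F t"
    have *: "d' t (f' t x) = f' (t - 1) (d t x)" if "t \<le> 0"
    proof -
      have "d' t (f' t x) \<in> G (t - 1)"
        using x \<open>f' t ` F t \<subseteq> G t\<close> by (intro free_resolutionD(5)[OF G]) auto
      then show ?thesis using that free_resolutionD(3)[OF G, of "t - 1"] by (simp add: f'_def)
    qed
    show "d' t (f' t x) = f' (t - 1) (d t x)"
    proof (cases "t \<le> 0")
      case False
      define n where "n = nat (t - 1)"
      have n: "t = int n + 1" "nat t = Suc n" "nat (t - 1) = n" using False by (auto simp: n_def)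
      show ?thesis using QQ[of n] x False unfolding QQ_def f'_def n(2,3) by (simp add: n(1))
    qed (fact *)
  qed
  moreover have "\<forall>x\<in>F 0. \<epsilon>' (f' 0 x) = \<epsilon> x" using PP[of 0] by (simp add: PP_def f'_def)
  ultimately show ?thesis by blast
qed

text \<open>
  The difference \<open>g = \<phi> - id\<close> lifts the zero map. If \<open>h\<close> is known in lower degrees, then \<open>g - h d\<close>
  takes values in cycles, hence in boundaries, and its lift through \<open>d\<close> is the next \<open>h\<close>.
\<close>

lemma free_resolution_self_map_homotopic_id:
  fixes s :: "'r::comm_ring_1 \<Rightarrow> 'f::ab_group_add \<Rightarrow> 'f"
  assumes F: "free_resolution s F d \<epsilon> sM M" and sM: "module sM"
    and \<phi>: "chain_map s F d s F d \<phi>" and \<epsilon>: "\<And>x. x \<in> F 0 \<Longrightarrow> \<epsilon> (\<phi> 0 x) = \<epsilon> x"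
  shows "\<exists>h. \<forall>t. linear_on s s (F t) (h t) \<and> h t ` F t \<subseteq> F (t + 1) \<and>
    (\<forall>x\<in>F t. \<phi> t x - x = d (t + 1) (h t x) + h (t - 1) (d t x))"
proof -
  note s = free_resolutionD(1)[OF F]
  interpret module s by (rule s)
  note subF = free_resolution_subspace[OF F]
  define g where "g t x = \<phi> t x - x" for t x
  have lin_g: "linear_on s s (F t) (g t)" for t
    unfolding g_def by (intro linear_on_diff_maps s chain_mapD(1)[OF \<phi>]) (simp add: linear_on_def)
  have gF: "g t x \<in> F t" if "x \<in> F t" for x t
    unfolding g_def using that by (intro subspace_diff[OF subF] chain_mapD(2)[OF \<phi>])
  have dg: "d t (g t x) = g (t - 1) (d t x)" if "x \<in> F t" for x t
    using linear_on_diff[OF s s subF free_resolutionD(4)[OF F] chain_mapD(2)[OF \<phi> that] that]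
      chain_mapD(3)[OF \<phi> that] by (simp add: g_def)
  define PP where "PP n h \<longleftrightarrow> linear_on s s (F (int n)) h \<and> h ` F (int n) \<subseteq> F (int n + 1) \<and>
      (\<forall>y\<in>F (int n + 1). d (int n + 1) (h (d (int n + 1) y)) = g (int n) (d (int n + 1) y)) \<and>
      (n = 0 \<longrightarrow> (\<forall>x\<in>F 0. d 1 (h x) = g 0 x))" for n h
  define QQ where "QQ n h h' \<longleftrightarrow>
      (\<forall>x\<in>F (int n + 1). d (int n + 2) (h' x) = g (int n + 1) x - h (d (int n + 1) x))"
    for n and h h' :: "'f \<Rightarrow> 'f"
  have "\<exists>h. \<forall>n. PP n (h n) \<and> QQ n (h n) (h (Suc n))"
  proof (rule dependent_nat_choice)
    have "g 0 ` F 0 \<subseteq> d 1 ` F 1"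
    proof clarify
      fix x assume x: "x \<in> F 0"
      have "\<epsilon> (g 0 x) = 0"
        using linear_on_diff[OF s sM subF free_resolutionD(6)[OF F] chain_mapD(2)[OF \<phi> x] x] \<epsilon>[OF x]
        by (simp add: g_def)
      then show "g 0 x \<in> d 1 ` F 1" using free_resolutionD(8)[OF F gF[OF x]] by blast
    qed
    from linear_lift_through_surjection[OF s s s free_resolutionD(2)[OF F] subF[of 1] lin_g
        free_resolutionD(4)[OF F] this]
    obtain h where h: "linear_on s s (F 0) h" "h ` F 0 \<subseteq> F 1" "\<And>x. x \<in> F 0 \<Longrightarrow> d 1 (h x) = g 0 x"
      by blast
    have "d 1 y \<in> F 0" if "y \<in> F 1" for y using free_resolutionD(5)[OF F that] by simp
    then show "\<exists>h. PP 0 h" using h unfolding PP_def by (intro exI[of _ h]) simp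
  next
    fix h n assume h: "PP n h"
    have dF: "d (int n + 1) x \<in> F (int n)" if "x \<in> F (int n + 1)" for x
      using free_resolutionD(5)[OF F that] by simp
    have lin: "linear_on s s (F (int n + 1)) (\<lambda>x. g (int n + 1) x - h (d (int n + 1) x))"
      using h dF by (intro linear_on_diff_maps s lin_g linear_on_compose[OF free_resolutionD(4)[OF F]])
        (auto simp: PP_def)
    have sub: "(\<lambda>x. g (int n + 1) x - h (d (int n + 1) x)) ` F (int n + 1)
        \<subseteq> d (int n + 2) ` F (int n + 2)"
    proof clarify
      fix x assume x: "x \<in> F (int n + 1)"
      have hF: "h (d (int n + 1) x) \<in> F (int n + 1)" using h dF[OF x] by (auto simp: PP_def)
      have "d (int n + 1) (g (int n + 1) x - h (d (int n + 1) x))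
          = d (int n + 1) (g (int n + 1) x) - d (int n + 1) (h (d (int n + 1) x))"
        by (rule linear_on_diff[OF s s subF free_resolutionD(4)[OF F] gF[OF x] hF])
      also have "\<dots> = 0" using h x dg[OF x] by (simp add: PP_def)
      finally show "g (int n + 1) x - h (d (int n + 1) x) \<in> d (int n + 2) ` F (int n + 2)"
        using free_resolutionD(9)[OF F, of "int n + 1"] subspace_diff[OF subF gF[OF x] hF]
        by (simp add: add.assoc)
    qed
    from linear_lift_through_surjection[OF s s s free_resolutionD(2)[OF F] subF[of "int n + 2"] lin
        free_resolutionD(4)[OF F] sub]
    obtain h' where h': "linear_on s s (F (int n + 1)) h'" "h' ` F (int n + 1) \<subseteq> F (int n + 2)"
      "\<And>x. x \<in> F (int n + 1) \<Longrightarrow> d (int n + 2) (h' x) = g (int n + 1) x - h (d (int n + 1) x)"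
      by blast
    have h0: "h 0 = 0"
      using h by (intro linear_on_zero[OF s s subF[of "int n"]]) (auto simp: PP_def)
    have "d (int n + 2) (h' (d (int n + 2) y)) = g (int n + 1) (d (int n + 2) y)"
      if y: "y \<in> F (int n + 2)" for y
    proof -
      have dy: "d (int n + 2) y \<in> F (int n + 1)" using free_resolutionD(5)[OF F y] by (simp add: add.commute)
      show ?thesis using h'(3)[OF dy] free_resolution_dd[OF F y] h0 by (simp add: add.commute)
    qed
    then show "\<exists>h'. PP (Suc n) h' \<and> QQ n h h'"
      using h' unfolding PP_def QQ_def by (intro exI[of _ h']) (simp add: add.commute add.assoc)
  qed
  then obtain h where PP: "\<And>n. PP n (h n)" and QQ: "\<And>n. QQ n (h n) (h (Suc n))" by blast
  define h' where "h' t = (if t < 0 then (\<lambda>_. 0) else h (nat t))" for t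
  have "linear_on s s (F t) (h' t) \<and> h' t ` F t \<subseteq> F (t + 1) \<and>
    (\<forall>x\<in>F t. \<phi> t x - x = d (t + 1) (h' t x) + h' (t - 1) (d t x))" for t
  proof (intro conjI ballI)
    show "linear_on s s (F t) (h' t)"
      using PP[of "nat t"] by (cases "t < 0") (auto simp: h'_def PP_def intro!: linear_onI)
    show "h' t ` F t \<subseteq> F (t + 1)"
      using PP[of "nat t"] subspace_0[OF subF[of "t + 1"]] by (cases "t < 0") (auto simp: h'_def PP_def)
    fix x assume x: "x \<in> F t"
    consider "t < 0" | "t = 0" | "t > 0" by linarith
    then show "\<phi> t x - x = d (t + 1) (h' t x) + h' (t - 1) (d t x)"
    proof cases
      case 1
      have "d (t + 1) 0 = 0" by (rule linear_on_zero[OF s s subF free_resolutionD(4)[OF F]])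
      then show ?thesis using 1 gF[OF x] free_resolutionD(3)[OF F 1] by (simp add: h'_def g_def)
    next
      case 2
      then show ?thesis using PP[of 0] x by (simp add: h'_def PP_def g_def)
    next
      case 3
      define n where "n = nat (t - 1)"
      have n: "t = int n + 1" "nat t = Suc n" "nat (t - 1) = n" using 3 by (auto simp: n_def)
      have "d (t + 1) (h (Suc n) x) = g t x - h n (d t x)"
        using QQ[of n] x unfolding QQ_def by (simp add: n(1) add.assoc)
      then show ?thesis using 3 by (simp add: h'_def n(2,3) g_def)
    qed
  qed
  then show ?thesis by blast
qed

text \<open>
  The submodule $JA$ of $A$.
\<close>

definition ideal_multiples :: "('r::comm_ring_1 \<Rightarrow> 'f \<Rightarrow> 'f) \<Rightarrow> 'r set \<Rightarrow> 'f::ab_group_add set \<Rightarrow> 'f set"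
  where "ideal_multiples s J A = module.span s {s c a | c a. c \<in> J \<and> a \<in> A}"

lemma ideal_multiples_subset:
  assumes "module s" "module.subspace s A"
  shows "ideal_multiples s J A \<subseteq> A"
proof -
  interpret module s by fact
  show ?thesis unfolding ideal_multiples_def
    using assms(2) by (intro span_minimal) (auto intro: subspace_scale)
qed

lemma ideal_multiples_image:
  assumes m: "module s" "module s'" and A: "module.subspace s A"
    and lin: "linear_on s s' A f" and sub: "f ` A \<subseteq> B"
    and x: "x \<in> ideal_multiples s J A"
  shows "f x \<in> ideal_multiples s' J B"
proof -
  interpret m: module s by fact
  interpret m': module s' by fact
  have "m.span {s c a | c a. c \<in> J \<and> a \<in> A} \<subseteq> {x \<in> A. f x \<in> ideal_multiples s' J B}"
  proof (rule m.span_minimal)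
    show "m.subspace {x \<in> A. f x \<in> ideal_multiples s' J B}"
      by (rule subspace_linear_preimage_on[OF m A lin]) (simp add: ideal_multiples_def)
    show "{s c a | c a. c \<in> J \<and> a \<in> A} \<subseteq> {x \<in> A. f x \<in> ideal_multiples s' J B}"
    proof clarify
      fix c a assume ca: "c \<in> J" "a \<in> A"
      have "f (s c a) = s' c (f a)" by (rule linear_onD(2)[OF lin ca(2)])
      moreover have "s' c (f a) \<in> ideal_multiples s' J B"
        unfolding ideal_multiples_def using ca sub by (intro m'.span_base) auto
      ultimately show "s c a \<in> A \<and> f (s c a) \<in> ideal_multiples s' J B"
        using m.subspace_scale[OF A ca(2)] by simp
    qed
  qed
  then show ?thesis using x unfolding ideal_multiples_def by blast
qed

text \<open>
  The homology of $F/JF$, which is $F \otimes R/J$.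
\<close>

definition homology_mod ::
    "('r::comm_ring_1 \<Rightarrow> 'f \<Rightarrow> 'f) \<Rightarrow> 'r set \<Rightarrow> (int \<Rightarrow> 'f::ab_group_add set) \<Rightarrow> (int \<Rightarrow> 'f \<Rightarrow> 'f) \<Rightarrow> int \<Rightarrow>
     'f subquotient"
  where "homology_mod s J F d t = homology
    (F (t + 1), ideal_multiples s J (F (t + 1))) (d (t + 1))
    (F t, ideal_multiples s J (F t)) (d t)
    (F (t - 1), ideal_multiples s J (F (t - 1)))"

lemma mem_homology_mod:
  "x \<in> fst (homology_mod s J F d t) \<longleftrightarrow> x \<in> F t \<and> d t x \<in> ideal_multiples s J (F (t - 1))"
  "snd (homology_mod s J F d t) = d (t + 1) ` F (t + 1) + ideal_multiples s J (F t)"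
  by (simp_all add: homology_mod_def homology_def)

lemma subquotient_module_homology_mod:
  assumes F: "free_resolution s F d \<epsilon> sM M"
  shows "subquotient_module s (homology_mod s J F d t)"
proof -
  note s = free_resolutionD(1)[OF F] and subF = free_resolution_subspace[OF F]
    and lin = free_resolutionD(4)[OF F]
  interpret module s by (rule s)
  have I: "subspace (ideal_multiples s J A)" for A by (simp add: ideal_multiples_def)
  show ?thesis
    unfolding subquotient_module_def homology_mod_def homology_def fst_conv snd_conv
    by (intro conjI s subspace_linear_preimage_on[OF s s subF lin] subspace_set_plus[OF s]
        subspace_linear_image[OF s s subF lin] I)
qed

lemma chain_map_compose:
  assumes f: "chain_map s F d s' G d' f" and g: "chain_map s' G d' s'' H d'' g"
  shows "chain_map s F d s'' H d'' (\<lambda>t x. g t (f t x))"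
  unfolding chain_map_def
proof (intro allI conjI ballI)
  show "linear_on s s'' (F t) (\<lambda>x. g t (f t x))" for t
    using chain_mapD(2)[OF f] by (intro linear_on_compose[OF chain_mapD(1)[OF f] chain_mapD(1)[OF g]]) auto
qed (use chain_mapD(2,3)[OF f] chain_mapD(2,3)[OF g] in auto)

text \<open>
  A chain map is linear over the ring, so it carries $JF$ into $JG$ and acts on the homology
  of the reductions.
\<close>

lemma chain_map_homology_mod:
  assumes F: "free_resolution s F d \<epsilon> sM M" and G: "free_resolution s' G d' \<epsilon>' sM M"
    and f: "chain_map s F d s' G d' f"
  shows "x \<in> fst (homology_mod s J F d t) \<Longrightarrow> f t x \<in> fst (homology_mod s' J G d' t)"
    and "x \<in> snd (homology_mod s J F d t) \<Longrightarrow> f t x \<in> snd (homology_mod s' J G d' t)"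
proof -
  note s = free_resolutionD(1)[OF F] and s' = free_resolutionD(1)[OF G]
    and subF = free_resolution_subspace[OF F]
  have I: "f t x \<in> ideal_multiples s' J (G t)" if "x \<in> ideal_multiples s J (F t)" for t x
    using chain_mapD(2)[OF f] that
    by (intro ideal_multiples_image[OF s s' subF chain_mapD(1)[OF f]]) auto
  show "f t x \<in> fst (homology_mod s' J G d' t)" if "x \<in> fst (homology_mod s J F d t)"
    using that chain_mapD(2,3)[OF f, of x t] I by (auto simp: mem_homology_mod)
  assume "x \<in> snd (homology_mod s J F d t)"
  then obtain y w where yw: "y \<in> F (t + 1)" "w \<in> ideal_multiples s J (F t)" "x = d (t + 1) y + w"
    unfolding mem_homology_mod by (auto elim!: set_plus_elim)
  have "f t x = f t (d (t + 1) y) + f t w" unfolding yw(3)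
    using free_resolutionD(5)[OF F yw(1)] ideal_multiples_subset[OF s subF[of t]] yw(2)
    by (intro linear_onD(1)[OF chain_mapD(1)[OF f]]) auto
  also have "f t (d (t + 1) y) = d' (t + 1) (f (t + 1) y)" using chain_mapD(3)[OF f yw(1)] by simp
  finally show "f t x \<in> snd (homology_mod s' J G d' t)"
    unfolding mem_homology_mod using I[OF yw(2)] chain_mapD(2)[OF f yw(1)]
    by (auto intro!: set_plus_intro)
qed

text \<open>
  The homotopy is linear over the ring as well: if $dx \in JF$, then $h\,d\,x \in JF$, and what
  remains of $\phi x - x$ is the boundary $d\,h\,x$.
\<close>

lemma self_map_homology_mod:
  assumes F: "free_resolution s F d \<epsilon> sM M" and sM: "module sM"
    and \<phi>: "chain_map s F d s F d \<phi>" "\<And>x. x \<in> F 0 \<Longrightarrow> \<epsilon> (\<phi> 0 x) = \<epsilon> x"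
    and x: "x \<in> fst (homology_mod s J F d t)"
  shows "\<phi> t x - x \<in> snd (homology_mod s J F d t)"
proof -
  note s = free_resolutionD(1)[OF F] and subF = free_resolution_subspace[OF F]
  from free_resolution_self_map_homotopic_id[OF F sM \<phi>] obtain h where
    h: "\<And>t. linear_on s s (F t) (h t)" "\<And>t. h t ` F t \<subseteq> F (t + 1)"
      "\<And>t x. x \<in> F t \<Longrightarrow> \<phi> t x - x = d (t + 1) (h t x) + h (t - 1) (d t x)" by blast
  have "h (t - 1) (d t x) \<in> ideal_multiples s J (F (t - 1 + 1))"
    using x by (intro ideal_multiples_image[OF s s subF h(1,2)]) (auto simp: mem_homology_mod)
  then show ?thesis using h(2)[of t] h(3)[of x t] x
    by (auto simp: mem_homology_mod intro!: set_plus_intro)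
qed

text \<open>
  Lifts of the identity of \<open>M\<close> in both directions are inverse to each other up to homotopy, hence
  inverse on the homology of the reductions.
\<close>

lemma homology_mod_resolution_independent:
  fixes s :: "'r::comm_ring_1 \<Rightarrow> 'f::ab_group_add \<Rightarrow> 'f" and s' :: "'r \<Rightarrow> 'g::ab_group_add \<Rightarrow> 'g"
  assumes F: "free_resolution s F d \<epsilon> sM M" and G: "free_resolution s' G d' \<epsilon>' sM M" and sM: "module sM"
  shows "\<exists>f. quotient_iso s (homology_mod s J F d t) s' (homology_mod s' J G d' t) f"
proof -
  interpret F: module s by (rule free_resolutionD(1)[OF F])
  interpret G: module s' by (rule free_resolutionD(1)[OF G])
  obtain f where f: "chain_map s F d s' G d' f" "\<And>x. x \<in> F 0 \<Longrightarrow> \<epsilon>' (f 0 x) = \<epsilon> x"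
    using free_resolution_chain_map_exists[OF F G sM] by blast
  obtain g where g: "chain_map s' G d' s F d g" "\<And>x. x \<in> G 0 \<Longrightarrow> \<epsilon> (g 0 x) = \<epsilon>' x"
    using free_resolution_chain_map_exists[OF G F sM] by blast
  have egf: "\<epsilon> (g 0 (f 0 x)) = \<epsilon> x" if "x \<in> F 0" for x
    using f(2)[OF that] g(2)[OF chain_mapD(2)[OF f(1) that]] by simp
  have efg: "\<epsilon>' (f 0 (g 0 x)) = \<epsilon>' x" if "x \<in> G 0" for x
    using g(2)[OF that] f(2)[OF chain_mapD(2)[OF g(1) that]] by simp
  let ?Q = "homology_mod s J F d t" and ?Q' = "homology_mod s' J G d' t"
  note SQ = subquotient_module_homology_mod[OF F, of J t]
    and SQ' = subquotient_module_homology_mod[OF G, of J t]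
  have sQ: "F.subspace (snd ?Q)" "G.subspace (snd ?Q')" using SQ SQ' by (auto simp: subquotient_module_def)
  have "quotient_iso s ?Q s' ?Q' (f t)"
  proof (rule quotient_isoI[OF SQ SQ'])
    show "linear_on s s' (fst ?Q) (f t)"
      by (rule linear_on_subset[OF chain_mapD(1)[OF f(1)]]) (auto simp: mem_homology_mod)
    show "f t x \<in> fst ?Q'" if "x \<in> fst ?Q" for x using that by (rule chain_map_homology_mod[OF F G f(1)])
    show "f t x \<in> snd ?Q' \<longleftrightarrow> x \<in> snd ?Q" if x: "x \<in> fst ?Q" for x
    proof
      assume "f t x \<in> snd ?Q'"
      then have "g t (f t x) \<in> snd ?Q" by (rule chain_map_homology_mod(2)[OF G F g(1)])
      from F.subspace_diff[OF sQ(1) this self_map_homology_mod[OF F sM chain_map_compose[OF f(1) g(1)] egf x]]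
      show "x \<in> snd ?Q" by simp
    qed (rule chain_map_homology_mod(2)[OF F G f(1)])
    show "\<exists>x\<in>fst ?Q. y - f t x \<in> snd ?Q'" if y: "y \<in> fst ?Q'" for y
    proof (rule bexI[of _ "g t y"])
      show "y - f t (g t y) \<in> snd ?Q'"
        using G.subspace_neg[OF sQ(2) self_map_homology_mod[OF G sM chain_map_compose[OF g(1) f(1)] efg y]]
        by simp
      show "g t y \<in> fst ?Q" using y by (rule chain_map_homology_mod(1)[OF G F g(1)])
    qed
  qed
  then show ?thesis by blast
qed

section \<open>Tensoring with the trivial module\<close>

lemma subquotient_module_restrict_scalars:
  assumes "subquotient_module s Q"
    and h: "h 1 = 1" "\<And>a b. h (a + b) = h a + h b" "\<And>a b. h (a * b) = h a * h b"
  shows "subquotient_module (\<lambda>c. s (h c)) Q"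
proof -
  interpret s: module s using assms by (simp add: subquotient_module_def)
  have m: "module (\<lambda>c. s (h c))"
    by unfold_locales (simp_all add: h s.scale_right_distrib s.scale_left_distrib)
  have "module.subspace (\<lambda>c. s (h c)) A" if "s.subspace A" for A
    using that by (intro module.subspaceI[OF m])
      (auto intro: s.subspace_0 s.subspace_add s.subspace_scale)
  then show ?thesis using assms m by (auto simp: subquotient_module_def)
qed

text \<open>
  Needed because Tor is a module over the polynomial ring, whereas the direct sums of homology
  groups are only vector spaces over the field.
\<close>

lemma quotient_iso_restrict_scalars:
  assumes iso: "quotient_iso s Q s' Q' f"
    and h: "h 1 = 1" "\<And>a b. h (a + b) = h a + h b" "\<And>a b. h (a * b) = h a * h b"
  shows "quotient_iso (\<lambda>c. s (h c)) Q (\<lambda>c. s' (h c)) Q' f"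
proof (rule quotient_isoI)
  note D = quotient_isoD[OF iso]
  show "subquotient_module (\<lambda>c. s (h c)) Q" "subquotient_module (\<lambda>c. s' (h c)) Q'"
    using D(1,2) h by (auto intro: subquotient_module_restrict_scalars)
  show "linear_on (\<lambda>c. s (h c)) (\<lambda>c. s' (h c)) (fst Q) f"
    using D(3) by (simp add: linear_on_def)
qed (use quotient_isoD[OF iso] in auto)

lemma Const_add: "Const (a + b) = (Const a + Const b :: ('m, 'k::comm_ring_1) mpoly)"
  by (simp add: Const_def single_add)

lemma Const_mult: "Const (a * b) = (Const a * Const b :: ('m, 'k::comm_ring_1) mpoly)"
  by (simp add: Const_def mult_single)

lemma Const_1: "Const 1 = (1 :: ('m, 'k::comm_ring_1) mpoly)"
  by (simp add: Const_def)

lemma Const_0: "Const 0 = (0 :: ('m, 'k::comm_ring_1) mpoly)"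
  by (simp add: Const_def)

text \<open>
  The ideal $(x_1, \dots, x_m)$, the annihilator of the trivial module.
\<close>

definition irrelevant_ideal :: "('m, 'k::comm_ring_1) mpoly set"
  where "irrelevant_ideal = {c. lookup c 0 = 0}"

text \<open>
  On representatives, the map $A \otimes \mathbf k \to A/\mathfrak m A$, $a \otimes n \mapsto na$.
\<close>

definition tensor_contract :: "(('m, 'k::comm_ring_1) mpoly \<Rightarrow> 'a \<Rightarrow> 'a) \<Rightarrow> ('a \<times> 'k \<Rightarrow>\<^sub>0 ('m, 'k) mpoly) \<Rightarrow> 'a::ab_group_add"
  where "tensor_contract s = lin_ext s (\<lambda>(a, n). s (Const n) a)"

lemma sum_scale_single: "sum_scale (*) c (single g (1::'r::comm_ring_1)) = single g c"
  by (rule poly_mapping_eqI) (simp add: lookup_sum_scale lookup_single when_def)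

lemma tensor_map_eq_lin_ext:
  "tensor_map f = lin_ext (sum_scale (*)) (\<lambda>(a, n). single (f a, n) (1::'r::comm_ring_1))"
  unfolding tensor_map_def lin_ext_def
  by (intro ext sum.cong refl) (auto simp: sum_scale_single)

context
  fixes s :: "('m, 'k::field) mpoly \<Rightarrow> 'a::ab_group_add \<Rightarrow> 'a"
  assumes s: "module s"
begin

interpretation module s by (rule s)

interpretation P: module "sum_scale (*) :: ('m, 'k) mpoly \<Rightarrow> ('a \<times> 'k \<Rightarrow>\<^sub>0 ('m, 'k) mpoly) \<Rightarrow> _"
  by (rule module_sum_scale)

lemma linear_tensor_contract: "linear_on (sum_scale (*)) s A (tensor_contract s)"
  unfolding tensor_contract_def by (rule linear_lin_ext[OF s])

lemma tensor_contract_single: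
  "tensor_contract s (single (a, n) 1) = s (Const n) a"
  unfolding tensor_contract_def by (simp add: lin_ext_single[OF s])

lemma tensor_contract_diff: "tensor_contract s (p - q) = tensor_contract s p - tensor_contract s q"
  by (rule linear_on_diff[OF P.module_axioms s P.subspace_UNIV linear_tensor_contract]) auto

lemma tensor_contract_scale: "tensor_contract s (sum_scale (*) c p) = s c (tensor_contract s p)"
  by (rule linear_onD(2)[OF linear_tensor_contract UNIV_I])

lemma tensor_contract_in:
  assumes "subspace A" "p \<in> fst (tensor_product s A trivial_scale UNIV)"
  shows "tensor_contract s p \<in> A"
  using assms(2) unfolding tensor_contract_def lin_ext_def tensor_product_def Let_def
  by (intro subspace_sum[OF assms(1)] subspace_scale[OF assms(1)])
    (auto intro!: subspace_scale[OF assms(1)])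

lemma subspace_tensor_product:
  "P.subspace (fst (tensor_product s A trivial_scale UNIV))"
  "P.subspace (snd (tensor_product s A trivial_scale UNIV))"
proof -
  show "P.subspace (fst (tensor_product s A trivial_scale UNIV))"
    unfolding tensor_product_def Let_def fst_conv keys_span_single(2)[symmetric]
    by (rule P.subspace_span)
  show "P.subspace (snd (tensor_product s A trivial_scale UNIV))"
    unfolding tensor_product_def Let_def snd_conv by (rule P.subspace_span)
qed

context
  fixes A :: "'a set"
  assumes A: "subspace A"
begin

abbreviation (input) "rel \<equiv> snd (tensor_product s A (trivial_scale :: ('m, 'k) mpoly \<Rightarrow> _) UNIV)"
abbreviation (input) "gen a n \<equiv> single (a, n) (1 :: ('m, 'k) mpoly)"

lemma rel_add: "a \<in> A \<Longrightarrow> a' \<in> A \<Longrightarrow> gen (a + a') n - gen a n - gen a' n \<in> rel"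
  unfolding tensor_product_def Let_def snd_conv by (rule P.span_base) blast

lemma rel_scale: "a \<in> A \<Longrightarrow> gen (s c a) n - sum_scale (*) c (gen a n) \<in> rel"
  unfolding tensor_product_def Let_def snd_conv by (rule P.span_base) blast

lemma rel_trivial: "a \<in> A \<Longrightarrow> gen a (lookup c 0 * n) - sum_scale (*) c (gen a n) \<in> rel"
  unfolding tensor_product_def Let_def snd_conv trivial_scale_def by (rule P.span_base) blast

text \<open>
  Of the bilinearity relations only $a \otimes cn = c(a \otimes n)$ is not sent to 0; here the scalar
  $c$ acts on $n$ through its constant term $c_0$, so the image is $(c_0 - c)na$.
\<close>

lemma tensor_contract_rel:
  assumes p: "p \<in> rel"
  shows "tensor_contract s p \<in> ideal_multiples s irrelevant_ideal A"
proof -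
  let ?M = "ideal_multiples s irrelevant_ideal A"
  have sub: "P.subspace {p \<in> UNIV. tensor_contract s p \<in> ?M}"
    by (rule subspace_linear_preimage_on[OF P.module_axioms s P.subspace_UNIV linear_tensor_contract])
      (simp add: ideal_multiples_def)
  have 0: "0 \<in> ?M" by (simp add: ideal_multiples_def span_zero)
  \<comment> \<open>Additivity in both factors and homogeneity in the first one become 0; the fourth kind does not.\<close>
  have "rel \<subseteq> {p \<in> UNIV. tensor_contract s p \<in> ?M}"
    unfolding tensor_product_def Let_def snd_conv
  proof (rule P.span_minimal[OF _ sub], safe)
    fix a n and c :: "('m, 'k) mpoly" assume a: "a \<in> A"
    have "tensor_contract s (gen a (trivial_scale c n) - sum_scale (*) c (gen a n))
      = s (Const (lookup c 0) - c) (s (Const n) a)"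
      by (simp add: tensor_contract_diff tensor_contract_scale tensor_contract_single trivial_scale_def
          Const_mult scale_left_diff_distrib left_diff_distrib)
    also have "\<dots> \<in> ?M"
    proof -
      have "Const (lookup c 0) - c \<in> irrelevant_ideal"
        by (simp add: irrelevant_ideal_def lookup_minus Const_def)
      then show ?thesis
        unfolding ideal_multiples_def using subspace_scale[OF A a, of "Const n"]
        by (intro span_base) blast
    qed
    finally show "tensor_contract s (gen a (trivial_scale c n) - sum_scale (*) c (gen a n)) \<in> ?M" .
  qed (auto simp: tensor_contract_diff tensor_contract_scale tensor_contract_single Const_add
      scale_right_distrib scale_left_distrib mult.commute 0)
  then show ?thesis using p by auto
qed

text \<open>
  Because $a \otimes n = a \otimes n1 = na \otimes 1$, every tensor is congruent to one
  of the form $x \otimes 1$.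
\<close>

lemma gen_tensor_contract_rel:
  assumes "p \<in> fst (tensor_product s A (trivial_scale :: ('m, 'k) mpoly \<Rightarrow> _) UNIV)"
  shows "p - gen (tensor_contract s p) 1 \<in> rel"
proof -
  note R = subspace_tensor_product(2)[of A]
  let ?S = "{p \<in> fst (tensor_product s A (trivial_scale :: ('m, 'k) mpoly \<Rightarrow> _) UNIV). p - gen (tensor_contract s p) 1 \<in> rel}"
  note Z = subspace_tensor_product(1)[of A]
  have lin: "tensor_contract s (p + q) = tensor_contract s p + tensor_contract s q" for p q
    by (rule linear_onD(1)[OF linear_tensor_contract UNIV_I UNIV_I])
  have "P.span ((\<lambda>g. single g 1) ` (A \<times> UNIV)) \<subseteq> ?S"
  proof (rule P.span_minimal)
    show "P.subspace ?S"
    proof (rule P.subspaceI)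
      have "gen (s 0 0) 1 - sum_scale (*) 0 (gen 0 1) \<in> rel" by (rule rel_scale[OF subspace_0[OF A]])
      then have "gen 0 1 \<in> rel" by simp
      moreover have "tensor_contract s 0 = 0"
        using tensor_contract_diff[of 0 0] by simp
      ultimately show "0 \<in> ?S" using P.subspace_0[OF Z] P.subspace_neg[OF R] by simp
    next
      fix p q assume pq: "p \<in> ?S" "q \<in> ?S"
      let ?x = "tensor_contract s p" and ?y = "tensor_contract s q"
      have "(p - gen ?x 1) + (q - gen ?y 1) - (gen (?x + ?y) 1 - gen ?x 1 - gen ?y 1) \<in> rel"
      proof (rule P.subspace_diff[OF R P.subspace_add[OF R]])
        show "p - gen ?x 1 \<in> rel" "q - gen ?y 1 \<in> rel" using pq by simp_all
        show "gen (?x + ?y) 1 - gen ?x 1 - gen ?y 1 \<in> rel"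
          using pq by (intro rel_add tensor_contract_in[OF A]) simp_all
      qed
      then have "p + q - gen (?x + ?y) 1 \<in> rel" by (simp add: algebra_simps)
      then show "p + q \<in> ?S" using pq P.subspace_add[OF Z] by (simp add: lin)
    next
      fix c p assume p: "p \<in> ?S"
      let ?x = "tensor_contract s p"
      have "sum_scale (*) c (p - gen ?x 1) - (gen (s c ?x) 1 - sum_scale (*) c (gen ?x 1)) \<in> rel"
      proof (rule P.subspace_diff[OF R P.subspace_scale[OF R]])
        show "p - gen ?x 1 \<in> rel" using p by simp
        show "gen (s c ?x) 1 - sum_scale (*) c (gen ?x 1) \<in> rel"
          using p by (intro rel_scale tensor_contract_in[OF A]) simp
      qed
      then have "sum_scale (*) c p - gen (s c ?x) 1 \<in> rel" by (simp add: P.scale_right_diff_distrib)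
      then show "sum_scale (*) c p \<in> ?S" using p P.subspace_scale[OF Z] by (simp add: tensor_contract_scale)
    qed
    show "(\<lambda>g. single g 1) ` (A \<times> UNIV) \<subseteq> ?S"
    proof clarify
      fix a and n :: 'k assume a: "a \<in> A"
      have "(gen a (lookup (Const n :: ('m, 'k) mpoly) 0 * 1) - sum_scale (*) (Const n) (gen a 1))
          - (gen (s (Const n) a) 1 - sum_scale (*) (Const n) (gen a 1)) \<in> rel"
        by (rule P.subspace_diff[OF R rel_trivial[OF a] rel_scale[OF a]])
      then have "gen a n - gen (s (Const n) a) 1 \<in> rel" by (simp add: Const_def)
      then show "gen a n \<in> fst (tensor_product s A trivial_scale UNIV) \<and>
          gen a n - gen (tensor_contract s (gen a n)) 1 \<in> rel"
        using a by (simp add: tensor_contract_single) (simp add: tensor_product_def Let_def)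
    qed
  qed
  then show ?thesis using assms unfolding keys_span_single(2) by (auto simp: tensor_product_def Let_def)
qed

text \<open>
  If $c$ has no constant term, then $ca \otimes 1 = a \otimes c1 = a \otimes 0$.
\<close>

lemma gen_ideal_multiples_rel:
  assumes "x \<in> ideal_multiples s irrelevant_ideal A"
  shows "gen x 1 \<in> rel"
proof -
  note R = subspace_tensor_product(2)[of A]
  have scale: "gen (s c x) 1 \<in> rel" if "sum_scale (*) c (gen x (1::'k)) \<in> rel" "x \<in> A"
    for c :: "('m, 'k) mpoly" and x
    using P.subspace_add[OF R rel_scale[OF that(2), of c 1] that(1)] by simp
  have "span {s c a | c a. c \<in> irrelevant_ideal \<and> a \<in> A} \<subseteq> {x \<in> A. gen x 1 \<in> rel}"
  proof (rule span_minimal)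
    show "subspace {x \<in> A. gen x 1 \<in> rel}"
    proof (rule subspaceI)
      show "0 \<in> {x \<in> A. gen x 1 \<in> rel}"
        using scale[of 0 0] subspace_0[OF A] P.subspace_0[OF R] by simp
      show "x + y \<in> {x \<in> A. gen x 1 \<in> rel}" if "x \<in> {x \<in> A. gen x 1 \<in> rel}" "y \<in> {x \<in> A. gen x 1 \<in> rel}" for x y
        using P.subspace_add[OF R P.subspace_add[OF R rel_add[of x y 1]], of "gen x 1" "gen y 1"] that
          subspace_add[OF A] by simp
      show "s c x \<in> {x \<in> A. gen x 1 \<in> rel}" if "x \<in> {x \<in> A. gen x 1 \<in> rel}" for c x
        using that scale P.subspace_scale[OF R] subspace_scale[OF A] by simp
    qed
    show "{s c a | c a. c \<in> irrelevant_ideal \<and> a \<in> A} \<subseteq> {x \<in> A. gen x 1 \<in> rel}"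
    proof clarify
      fix c :: "('m, 'k) mpoly" and a assume c: "c \<in> irrelevant_ideal" and a: "a \<in> A"
      have 0: "gen a 0 \<in> rel" using rel_trivial[OF a, of 0 0] by simp
      have "gen a 0 - sum_scale (*) c (gen a 1) \<in> rel"
        using rel_trivial[OF a, of c 1] c by (simp add: irrelevant_ideal_def)
      from P.subspace_diff[OF R 0 this] have "sum_scale (*) c (gen a 1) \<in> rel" by simp
      from scale[OF this a] show "s c a \<in> A \<and> gen (s c a) 1 \<in> rel" using subspace_scale[OF A a] by simp
    qed
  qed
  then show ?thesis using assms unfolding ideal_multiples_def by blast
qed

text \<open>
  This is the isomorphism $A \otimes \mathbf k \cong A/\mathfrak m A$.
\<close>

lemma tensor_product_rel_iff:
  assumes p: "p \<in> fst (tensor_product s A (trivial_scale :: ('m, 'k) mpoly \<Rightarrow> _) UNIV)"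
  shows "p \<in> rel \<longleftrightarrow> tensor_contract s p \<in> ideal_multiples s irrelevant_ideal A"
  using tensor_contract_rel gen_ideal_multiples_rel[of "tensor_contract s p"]
    P.subspace_add[OF subspace_tensor_product(2) gen_tensor_contract_rel[OF p], of "gen (tensor_contract s p) 1"]
  by auto

end

lemma linear_tensor_map: "linear_on (sum_scale (*)) (sum_scale (*)) X (tensor_map f :: ('a \<times> 'k \<Rightarrow>\<^sub>0 ('m, 'k) mpoly) \<Rightarrow> ('a \<times> 'k \<Rightarrow>\<^sub>0 ('m, 'k) mpoly))"
  unfolding tensor_map_eq_lin_ext by (rule linear_lin_ext[OF module_sum_scale])

lemma tensor_map_in:
  assumes "f ` A \<subseteq> B" "p \<in> fst (tensor_product s A (trivial_scale :: ('m, 'k) mpoly \<Rightarrow> _) UNIV)"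
  shows "tensor_map f p \<in> fst (tensor_product s B (trivial_scale :: ('m, 'k) mpoly \<Rightarrow> _) UNIV)"
  unfolding tensor_map_def
proof (intro P.subspace_sum[OF subspace_tensor_product(1)])
  fix g assume "g \<in> keys p"
  then have "fst g \<in> A" using assms(2) by (auto simp: tensor_product_def Let_def)
  then have "f (fst g) \<in> B" using assms(1) by auto
  then show "(case g of (a, n) \<Rightarrow> single (f a, n) (lookup p (a, n)))
    \<in> fst (tensor_product s B (trivial_scale :: ('m, 'k) mpoly \<Rightarrow> _) UNIV)"
    by (cases g) (simp add: tensor_product_def Let_def)
qed

lemma tensor_contract_tensor_map:
  assumes A: "subspace A" and f: "linear_on s s A f" 
    and p: "p \<in> fst (tensor_product s A (trivial_scale :: ('m, 'k) mpoly \<Rightarrow> _) UNIV)"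
  shows "tensor_contract s (tensor_map f p) = f (tensor_contract s p)"
proof -
  have keys: "fst g \<in> A" if "g \<in> keys p" for g
    using p that by (auto simp: tensor_product_def Let_def)
  have "tensor_contract s (tensor_map f p) =
      (\<Sum>g\<in>keys p. tensor_contract s (sum_scale (*) (lookup p g)
        (case g of (a, n) \<Rightarrow> single (f a, n) 1)))"
    unfolding tensor_map_eq_lin_ext lin_ext_def[of "sum_scale (*)"]
    by (rule linear_on_sum[OF P.module_axioms s P.subspace_UNIV linear_tensor_contract]) auto
  also have "\<dots> = (\<Sum>g\<in>keys p. f (s (lookup p g) (case g of (a, n) \<Rightarrow> s (Const n) a)))"
  proof (rule sum.cong[OF refl])
    fix g assume "g \<in> keys p"
    then have "fst g \<in> A" by (rule keys)
    then show "tensor_contract s (sum_scale (*) (lookup p g)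
        (case g of (a, n) \<Rightarrow> single (f a, n) 1)) =
      f (s (lookup p g) (case g of (a, n) \<Rightarrow> s (Const n) a))"
      using linear_onD(2)[OF f] subspace_scale[OF A]
      by (auto simp: tensor_contract_scale tensor_contract_single split: prod.split)
  qed
  also have "\<dots> = f (tensor_contract s p)"
    unfolding tensor_contract_def lin_ext_def
    using keys by (intro linear_on_sum[OF s s A f, symmetric] subspace_scale[OF A])
      (auto split: prod.split intro!: subspace_scale[OF A])
  finally show ?thesis .
qed

end

text \<open>
  The isomorphism $F_t \otimes \mathbf k \cong F_t/\mathfrak m F_t$ is natural in $F_t$
  (\<open>tensor_contract_tensor_map\<close>), so it passes to homology.
\<close>

lemma Tor_trivial_iso_homology_mod:
  fixes s :: "('m, 'k::field) mpoly \<Rightarrow> 'f::ab_group_add \<Rightarrow> 'f"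
  assumes F: "free_resolution s F d \<epsilon> sM M"
  shows "quotient_iso (sum_scale (*)) (Tor s F d trivial_scale (UNIV :: 'k set) t)
    s (homology_mod s irrelevant_ideal F d t) (tensor_contract s)"
proof -
  note s = free_resolutionD(1)[OF F] and subF = free_resolution_subspace[OF F]
    and lin = free_resolutionD(4)[OF F]
  interpret module s by (rule s)
  interpret P: module "sum_scale (*) :: ('m, 'k) mpoly \<Rightarrow> ('f \<times> 'k \<Rightarrow>\<^sub>0 ('m, 'k) mpoly) \<Rightarrow> _"
    by (rule module_sum_scale)
  let ?Q = "Tor s F d trivial_scale (UNIV :: 'k set) t" and ?Q' = "homology_mod s irrelevant_ideal F d t"
  let ?T = "\<lambda>t. tensor_product s (F t) (trivial_scale :: ('m, 'k) mpoly \<Rightarrow> _) UNIV"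
  let ?I = "\<lambda>t. ideal_multiples s irrelevant_ideal (F t)"
  note sub = subspace_tensor_product[OF s]
  have dF: "d t ` F t \<subseteq> F (t - 1)" for t using free_resolutionD(5)[OF F] by auto
  have Z': "x \<in> fst ?Q' \<longleftrightarrow> x \<in> F t \<and> d t x \<in> ?I (t - 1)" for x
    by (simp add: homology_mod_def homology_def)
  have Z: "p \<in> fst ?Q \<longleftrightarrow> p \<in> fst (?T t) \<and> tensor_contract s p \<in> fst ?Q'" for p
    using tensor_product_rel_iff[OF s subF[of "t - 1"] tensor_map_in[OF s dF, of p t]]
      tensor_contract_tensor_map[OF s subF lin, of p t] tensor_contract_in[OF s subF, of p t]
    by (auto simp: Z' Tor_def homology_def)
  have B: "snd ?Q = tensor_map (d (t + 1)) ` fst (?T (t + 1)) + snd (?T t)"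
    by (simp add: Tor_def homology_def)
  have B': "snd ?Q' = d (t + 1) ` F (t + 1) + ?I t"
    by (simp add: homology_mod_def homology_def)
  have gen: "single (x, 1) 1 \<in> fst (?T t)" "tensor_contract s (single (x, 1) 1) = x"
    if "x \<in> F t" for x t
    using that by (simp_all add: tensor_product_def Let_def tensor_contract_single[OF s] Const_1)
  show ?thesis
  proof (rule quotient_isoI)
    have "P.subspace (fst ?Q)" unfolding Tor_def homology_def fst_conv
      by (rule subspace_linear_preimage_on[OF P.module_axioms P.module_axioms sub(1) linear_tensor_map[OF s] sub(2)])
    moreover have "P.subspace (snd ?Q)" unfolding B
      by (intro subspace_set_plus[OF P.module_axioms] sub
          subspace_linear_image[OF P.module_axioms P.module_axioms _ linear_tensor_map[OF s]])
    ultimately show "subquotient_module (sum_scale (*)) ?Q"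
      by (simp add: subquotient_module_def P.module_axioms)
    show "subquotient_module s ?Q'" by (rule subquotient_module_homology_mod[OF F])
    show "linear_on (sum_scale (*)) s (fst ?Q) (tensor_contract s)" by (rule linear_tensor_contract[OF s])
    show "tensor_contract s p \<in> fst ?Q'" if "p \<in> fst ?Q" for p using that Z by blast
    show "\<exists>p\<in>fst ?Q. y - tensor_contract s p \<in> snd ?Q'" if y: "y \<in> fst ?Q'" for y
    proof (rule bexI[of _ "single (y, 1) 1"])
      have "subspace (snd ?Q')"
        using subquotient_module_homology_mod[OF F] by (simp add: subquotient_module_def)
      then show "y - tensor_contract s (single (y, 1) 1) \<in> snd ?Q'"
        using y gen(2)[of y t] subspace_0[of "snd ?Q'"] by (simp add: Z')
      show "single (y, 1) 1 \<in> fst ?Q" using y gen[of y t] by (simp add: Z Z')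
    qed
    show "tensor_contract s p \<in> snd ?Q' \<longleftrightarrow> p \<in> snd ?Q" if "p \<in> fst ?Q" for p
    proof
      have p: "p \<in> fst (?T t)" using that Z by blast
      assume "tensor_contract s p \<in> snd ?Q'"
      then obtain y w where yw: "y \<in> F (t + 1)" "w \<in> ?I t" "tensor_contract s p = d (t + 1) y + w"
        unfolding B' by (auto elim!: set_plus_elim)
      let ?q = "tensor_map (d (t + 1)) (single (y, 1) 1)"
      have q: "?q \<in> fst (?T t)"
        using tensor_map_in[OF s _ gen(1)[OF yw(1)], of "d (t + 1)" "F t"] dF[of "t + 1"] by simp
      have "tensor_contract s ?q = d (t + 1) y"
        using tensor_contract_tensor_map[OF s subF lin gen(1)[OF yw(1)]] gen(2)[OF yw(1)] by simp
      then have "tensor_contract s (p - ?q) = w" by (simp add: tensor_contract_diff[OF s] yw(3))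
      then have "p - ?q \<in> snd (?T t)"
        using tensor_product_rel_iff[OF s subF P.subspace_diff[OF sub(1) p q]] yw(2) by simp
      from set_plus_intro[OF imageI[OF gen(1)[OF yw(1)]] this, of "tensor_map (d (t + 1))"]
      show "p \<in> snd ?Q" unfolding B by simp
    next
      assume "p \<in> snd ?Q"
      then obtain q r where qr: "q \<in> fst (?T (t + 1))" "r \<in> snd (?T t)" "p = tensor_map (d (t + 1)) q + r"
        unfolding B by (auto elim!: set_plus_elim)
      have "tensor_contract s p = d (t + 1) (tensor_contract s q) + tensor_contract s r"
        unfolding qr(3) using linear_onD(1)[OF linear_tensor_contract[OF s] UNIV_I UNIV_I]
          tensor_contract_tensor_map[OF s subF lin qr(1)] by simp
      then show "tensor_contract s p \<in> snd ?Q'"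
        unfolding B' using tensor_contract_in[OF s subF qr(1)] tensor_contract_rel[OF s subF qr(2)]
        by (auto intro!: set_plus_intro)
    qed
  qed
qed

section \<open>A complex of free modules over the polynomial ring\<close>

instance tgen :: finite
proof
  have "(UNIV :: tgen set) = {TE, TN, TNbar, TI}" using tgen.exhaust by blast
  then show "finite (UNIV :: tgen set)" by (metis finite.emptyI finite_insert)
qed

text \<open>
  The subtraction of exponents is truncated, hence the case distinction.
\<close>

lemma lookup_single_mult:
  fixes k d :: "'m \<Rightarrow>\<^sub>0 nat" and q :: "('m, 'k::comm_ring_1) mpoly"
  shows "lookup (single k a * q) d =
    (if \<forall>i. lookup k i \<le> lookup d i then a * lookup q (d - k) else 0)"
proof -
  have le: "(\<forall>i. lookup k i \<le> lookup d i) \<longleftrightarrow> d = k + (d - k)"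
    by (auto simp: poly_mapping_eq_iff fun_eq_iff lookup_add lookup_minus)
      (metis le_add1)
  have "lookup (single k a * q) d =
      (\<Sum>l. (a when k = l) * (\<Sum>m. lookup q m when d = l + m))"
    by (simp add: lookup_mult lookup_single)
  also have "\<dots> = (\<Sum>l. a * (\<Sum>m. lookup q m when d = l + m) when k = l)"
    by (simp add: when_mult)
  also have "\<dots> = a * (\<Sum>m. lookup q m when d = k + m)"
    by simp
  also have "(\<Sum>m. lookup q m when d = k + m) =
      (if d = k + (d - k) then lookup q (d - k) else 0)"
  proof (cases "d = k + (d - k)")
    case True
    have "(d = k + m) = (m = d - k)" for m
      using True by (metis add_diff_cancel_left')
    then show ?thesis using True by simp
  next
    case False
    then have "d \<noteq> k + m" for m by (metis add_diff_cancel_left')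
    then show ?thesis using False by simp
  qed
  finally show ?thesis unfolding le by (simp split: if_splits)
qed

lemma lookup_mult_at_0:
  fixes p q :: "('m, 'k::comm_ring_1) mpoly"
  shows "lookup (p * q) 0 = lookup p 0 * lookup q 0"
proof -
  have 0: "0 = l + m \<longleftrightarrow> l = 0 \<and> m = 0" for l m :: "'m \<Rightarrow>\<^sub>0 nat"
    by (auto simp: poly_mapping_eq_iff fun_eq_iff lookup_add)
  have "lookup (p * q) 0 =
      (\<Sum>l. lookup p l * (\<Sum>m. lookup q m when l = 0 \<and> m = 0))"
    by (simp add: lookup_mult 0)
  also have "\<dots> = (\<Sum>l. lookup p l * ((\<Sum>m. lookup q m when m = 0)) when l = 0)"
    by (rule Sum_any.cong) (auto simp: when_def)
  also have "\<dots> = lookup p 0 * lookup q 0" by simp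
  finally show ?thesis .
qed

lemma Var_power: "Var i ^ n = (single (single i n) 1 :: ('m, 'k::comm_ring_1) mpoly)"
  by (induction n) (simp_all add: Var_def mult_single single_add[symmetric])

lemma prod_Var_power:
  "(\<Prod>i\<in>A. Var i ^ r i) = (single (\<Sum>i\<in>A. single i (r i)) 1 :: ('m, 'k::comm_ring_1) mpoly)"
  by (induction A rule: infinite_finite_induct) (simp_all add: Var_power mult_single)

lemma lookup_exponent_sum:
  "finite A \<Longrightarrow> lookup (\<Sum>i\<in>A. single i (r i :: nat)) j = (if j \<in> A then r j else 0)"
  by (simp add: lookup_sum lookup_single when_def)

text \<open>
  The quotient on division by the monomial with exponent \<open>k\<close>: terms that are not divisible by
  it are dropped.
\<close>

definition monomial_quotient :: "('m \<Rightarrow>\<^sub>0 nat) \<Rightarrow> ('m, 'k::comm_ring_1) mpoly \<Rightarrow> ('m, 'k) mpoly"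
  where "monomial_quotient k q = Poly_Mapping.map_key (\<lambda>c. c + k) q"

lemma lookup_monomial_quotient:
  "lookup (monomial_quotient k q) c = lookup q (c + k)"
  unfolding monomial_quotient_def by (subst map_key.rep_eq) (simp_all add: inj_def)

lemma monomial_quotient_add: "monomial_quotient k (p + q) = monomial_quotient k p + monomial_quotient k q"
  and monomial_quotient_uminus: "monomial_quotient k (- p) = - monomial_quotient k p"
  and monomial_quotient_diff: "monomial_quotient k (p - q) = monomial_quotient k p - monomial_quotient k q"
  and monomial_quotient_0: "monomial_quotient k 0 = 0"
  by (rule poly_mapping_eqI; simp add: lookup_monomial_quotient lookup_add lookup_minus)+

lemma monomial_quotient_sum: "monomial_quotient k (\<Sum>i\<in>A. f i) = (\<Sum>i\<in>A. monomial_quotient k (f i))"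
  by (induction A rule: infinite_finite_induct) (simp_all add: monomial_quotient_add monomial_quotient_0)

lemma monomial_quotient_monomial_mult:
  "monomial_quotient k (single k 1 * q) = q"
  by (rule poly_mapping_eqI) (simp add: lookup_monomial_quotient lookup_single_mult lookup_add)

lemma monomial_quotient_commute:
  "monomial_quotient k (monomial_quotient l q) = monomial_quotient l (monomial_quotient k q)"
  by (rule poly_mapping_eqI) (simp add: lookup_monomial_quotient add_ac)

lemma monomial_quotient_Var_mult:
  assumes "i \<noteq> j"
  shows "monomial_quotient (single i m) (Var j ^ n * q) =
    Var j ^ n * monomial_quotient (single i m) q"
proof (rule poly_mapping_eqI)
  fix c
  have le: "(\<forall>l. lookup (single j n) l \<le> lookup (c + single i m) l)
    \<longleftrightarrow> (\<forall>l. lookup (single j n) l \<le> lookup c l)"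
    using assms by (auto simp: lookup_add lookup_single when_def)
  have "c + single i m - single j n = c - single j n + single i m"
    using assms by (auto simp: poly_mapping_eq_iff fun_eq_iff lookup_add lookup_minus lookup_single when_def)
  then show "lookup (monomial_quotient (single i m) (Var j ^ n * q)) c =
      lookup (Var j ^ n * monomial_quotient (single i m) q) c"
    by (simp add: lookup_monomial_quotient Var_power lookup_single_mult le)
qed

lemma lookup_zero_of_monomial_quotient_zero:
  assumes "monomial_quotient (single i n) q = 0" "n \<le> lookup c i"
  shows "lookup q c = 0"
proof -
  have "c = (c - single i n) + single i n"
    using assms(2) by (auto simp: poly_mapping_eq_iff fun_eq_iff lookup_add lookup_minus lookup_single when_def)
  then have "lookup q c =
      lookup (monomial_quotient (single i n) q) (c - single i n)"
    by (simp add: lookup_monomial_quotient)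
  then show ?thesis using assms(1) by simp
qed

text \<open>
  The terms for $(i, j)$ and $(j, i)$ cancel. In characteristic 2 antisymmetry says nothing about the
  diagonal, which is therefore required to vanish.
\<close>

lemma sum_antisymmetric_eq_0:
  fixes f :: "'i::linorder \<Rightarrow> 'i \<Rightarrow> 'r::ab_group_add"
  assumes "finite A" and anti: "\<And>i j. i \<in> A \<Longrightarrow> j \<in> A \<Longrightarrow> i \<noteq> j \<Longrightarrow> f j i = - f i j"
    and diag: "\<And>i. i \<in> A \<Longrightarrow> f i i = 0"
  shows "(\<Sum>i\<in>A. \<Sum>j\<in>A. f i j) = 0"
proof -
  let ?L = "\<lambda>i j. if j < i then f i j else 0" and ?U = "\<lambda>i j. if i < j then f i j else 0"
  have "(\<Sum>i\<in>A. \<Sum>j\<in>A. f i j) = (\<Sum>i\<in>A. \<Sum>j\<in>A. ?L i j + ?U i j)"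
    by (intro sum.cong refl) (auto simp: diag dest: antisym_conv3)
  also have "\<dots> = (\<Sum>i\<in>A. \<Sum>j\<in>A. ?L i j) + (\<Sum>i\<in>A. \<Sum>j\<in>A. ?U i j)"
    by (simp add: sum.distrib)
  also have "(\<Sum>i\<in>A. \<Sum>j\<in>A. ?U i j) = (\<Sum>j\<in>A. \<Sum>i\<in>A. ?U i j)" by (rule sum.swap)
  also have "\<dots> = (\<Sum>j\<in>A. \<Sum>i\<in>A. - ?L j i)"
  proof (intro sum.cong refl)
    fix j i assume "j \<in> A" "i \<in> A"
    then show "?U i j = - ?L j i" using anti[of j i] by (cases "i < j") auto
  qed
  finally show ?thesis by (simp add: sum_negf)
qed

definition tsign :: "'m::{finite,linorder} \<Rightarrow> ('m \<Rightarrow> tgen) \<Rightarrow> 'r::comm_ring_1"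
  where "tsign i b = (- 1) ^ card {j. j < i \<and> b j = TNbar}"

lemma tsign_cases: "tsign i b = (1 :: 'r::comm_ring_1) \<or> tsign i b = (- 1 :: 'r)"
  unfolding tsign_def by (metis neg_one_even_power neg_one_odd_power)

lemma tsign_square:
  fixes x :: "'r::comm_ring_1"
  shows "tsign i b * (tsign i b * x) = x"
  using tsign_cases[of i b, where 'r = 'r] by auto

lemma tsign_upd_ge: "\<not> j < i \<Longrightarrow> tsign i (b(j := g)) = tsign i b"
proof -
  assume "\<not> j < i"
  then have "{l. l < i \<and> (b(j := g)) l = TNbar} = {l. l < i \<and> b l = TNbar}" by auto
  then show ?thesis by (simp add: tsign_def)
qed

lemma tsign_upd_less: 
  assumes "j < i" "b j \<noteq> TNbar"
  shows "tsign i (b(j := TNbar)) = - tsign i b"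
proof -
  have "{l. l < i \<and> (b(j := TNbar)) l = TNbar} = insert j {l. l < i \<and> b l = TNbar}" using assms by auto
  then show ?thesis using assms by (simp add: tsign_def)
qed

text \<open>
  Whichever of the two factors comes first changes the sign of the other one, and only that
  sign; this is what makes the square of the differential vanish.
\<close>

lemma tsign_swap:
  assumes "i \<noteq> j" "b i \<noteq> TNbar" "b j \<noteq> TNbar"
  shows "tsign j b * tsign i (b(j := TNbar)) = - (tsign i b * tsign j (b(i := TNbar)) :: 'r::comm_ring_1)"
  using assms by (cases i j rule: linorder_cases) (auto simp: tsign_upd_less tsign_upd_ge)

lemma tdeg_upd: "b i \<noteq> TNbar \<Longrightarrow> tdeg (b(i := TNbar)) = tdeg b + 1"
proof -
  assume "b i \<noteq> TNbar"
  moreover have "{j. (b(i := TNbar)) j = TNbar} = insert i {j. b j = TNbar}" by auto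
  ultimately show ?thesis by (simp add: tdeg_def)
qed

lemma lookup_Abs_finite [simp]:
  fixes f :: "'a::finite \<Rightarrow> 'b::zero"
  shows "lookup (Abs_poly_mapping f) = f"
  by (rule lookup_Abs_poly_mapping) simp

text \<open>
  The basis tensors of $T_*(L)$ of degree \<open>t\<close> in which the generator $\mathrm i$ does not occur.
\<close>

definition res_basis :: "'m::finite set set \<Rightarrow> int \<Rightarrow> ('m \<Rightarrow> tgen) set"
  where "res_basis L t = {b. (\<forall>i. b i \<noteq> TI) \<and> {i. b i \<in> {TE, TNbar}} \<in> L \<and> tdeg b = t}"

definition res_module :: "'m::finite set set \<Rightarrow> int \<Rightarrow> (('m \<Rightarrow> tgen) \<Rightarrow>\<^sub>0 ('m, 'k::field) mpoly) set"
  where "res_module L t = {p. keys p \<subseteq> res_basis L t}"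

lemma res_moduleD: "p \<in> res_module L t \<Longrightarrow> lookup p b \<noteq> 0 \<Longrightarrow> b \<in> res_basis L t"
  by (auto simp: res_module_def in_keys_iff)

lemma res_moduleI: "(\<And>b. lookup p b \<noteq> 0 \<Longrightarrow> b \<in> res_basis L t) \<Longrightarrow> p \<in> res_module L t"
  by (auto simp: res_module_def in_keys_iff)

lemma res_module_span: "res_module L t =
    module.span (sum_scale (*)) ((\<lambda>b. single b 1) ` res_basis L t)"
  by (simp add: res_module_def keys_span_single)

lemma subspace_res_module: "module.subspace (sum_scale (*)) (res_module L t)"
  unfolding res_module_span by (rule module.subspace_span[OF module_sum_scale])

context
  fixes r :: "'m::{finite,linorder} \<Rightarrow> nat"
begin

text \<open>
  The coefficients in $d\bar{\mathrm n} = \mathrm n - x^r \mathrm e$.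
\<close>

definition res_coeff :: "'m \<Rightarrow> tgen \<Rightarrow> ('m, 'k::field) mpoly"
  where "res_coeff i g = (case g of TN \<Rightarrow> 1 | TE \<Rightarrow> - (Var i ^ r i) | _ \<Rightarrow> 0)"

text \<open>
  The differential is given by its coefficient at each basis tensor \<open>b\<close>: the tensors whose boundary
  contains \<open>b\<close> are the \<open>b(i := TNbar)\<close>. In this form linearity and all formulas below reduce to
  identities between finite sums.
\<close>

definition res_diff :: "(('m \<Rightarrow> tgen) \<Rightarrow>\<^sub>0 ('m, 'k::field) mpoly) \<Rightarrow> (('m \<Rightarrow> tgen) \<Rightarrow>\<^sub>0 ('m, 'k) mpoly)"
  where "res_diff p = Abs_poly_mapping
    (\<lambda>b. \<Sum>i\<in>UNIV. tsign i b * res_coeff i (b i) * lookup p (b(i := TNbar)))"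

text \<open>
  The tensor product of the augmentations $\mathrm e \mapsto 1$, $\mathrm n \mapsto x^r$.
\<close>

definition res_aug :: "(('m \<Rightarrow> tgen) \<Rightarrow>\<^sub>0 ('m, 'k::field) mpoly) \<Rightarrow> ('m, 'k) mpoly"
  where "res_aug p = (\<Sum>b | \<forall>i. b i \<in> {TE, TN}. (\<Prod>i | b i = TN. Var i ^ r i) * lookup p b)"

lemma lookup_res_diff: "lookup (res_diff p) b =
    (\<Sum>i\<in>UNIV. tsign i b * res_coeff i (b i) * lookup p (b(i := TNbar)))"
  by (simp add: res_diff_def)

lemma linear_res_diff: "linear_on (sum_scale (*)) (sum_scale (*)) A res_diff"
  by (rule linear_onI; rule poly_mapping_eqI)
    (simp_all add: lookup_res_diff lookup_add lookup_sum_scale distrib_left sum.distrib sum_distrib_left mult_ac)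

lemma linear_res_aug: "linear_on (sum_scale (*)) (*) A res_aug"
  by (rule linear_onI)
    (simp_all add: res_aug_def lookup_add lookup_sum_scale algebra_simps sum.distrib sum_distrib_left)

lemma res_diff_in:
  assumes L: "simplicial_complex L" and p: "p \<in> res_module L t"
  shows "res_diff p \<in> res_module L (t - 1)"
proof (rule res_moduleI)
  fix b assume "lookup (res_diff p) b \<noteq> 0"
  then obtain i where i: "tsign i b * res_coeff i (b i) * lookup p (b(i := TNbar)) \<noteq> 0"
    unfolding lookup_res_diff by (meson sum.not_neutral_contains_not_neutral)
  then have bi: "b i = TE \<or> b i = TN" by (cases "b i") (auto simp: res_coeff_def)
  have b: "b(i := TNbar) \<in> res_basis L t" using res_moduleD[OF p] i by fastforce
  have "{j. b j \<in> {TE, TNbar}} \<subseteq> {j. (b(i := TNbar)) j \<in> {TE, TNbar}}" by auto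
  then have "{j. b j \<in> {TE, TNbar}} \<in> L"
    using b L unfolding simplicial_complex_def res_basis_def by blast
  moreover have "b j \<noteq> TI" for j
    using b bi by (cases "j = i") (auto simp: res_basis_def fun_upd_def split: if_splits)
  ultimately show "b \<in> res_basis L (t - 1)"
    using b bi tdeg_upd[of b i] by (auto simp: res_basis_def)
qed

lemma res_diff_res_diff:
  fixes p :: "('m \<Rightarrow> tgen) \<Rightarrow>\<^sub>0 ('m, 'k::field) mpoly"
  shows "res_diff (res_diff p) = 0"
proof (rule poly_mapping_eqI)
  fix b
  have "lookup (res_diff (res_diff p)) b = (\<Sum>i\<in>UNIV. \<Sum>j\<in>UNIV.
      tsign i b * res_coeff i (b i) * (tsign j (b(i := TNbar)) * res_coeff j ((b(i := TNbar)) j) *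
        lookup p (b(i := TNbar, j := TNbar))))"
    by (simp add: lookup_res_diff sum_distrib_left)
  also have "\<dots> = 0"
  proof (rule sum_antisymmetric_eq_0)
    fix i j :: 'm assume ij: "i \<noteq> j"
    show "tsign j b * res_coeff j (b j) * (tsign i (b(j := TNbar)) * res_coeff i ((b(j := TNbar)) i) *
        lookup p (b(j := TNbar, i := TNbar))) =
      - (tsign i b * res_coeff i (b i) * (tsign j (b(i := TNbar)) * res_coeff j ((b(i := TNbar)) j) *
        lookup p (b(i := TNbar, j := TNbar))))"
    proof (cases "b i = TNbar \<or> b j = TNbar")
      case True
      then show ?thesis using ij by (auto simp: res_coeff_def)
    next
      case False
      let ?w = "res_coeff i (b i) * res_coeff j (b j) * lookup p (b(i := TNbar, j := TNbar))"
      have "b(j := TNbar, i := TNbar) = b(i := TNbar, j := TNbar)" using ij by (rule fun_upd_twist[symmetric])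
      then have "tsign j b * res_coeff j (b j) * (tsign i (b(j := TNbar)) * res_coeff i ((b(j := TNbar)) i) *
          lookup p (b(j := TNbar, i := TNbar))) = tsign j b * tsign i (b(j := TNbar)) * ?w"
        using ij by (simp add: mult_ac)
      also have "\<dots> = - (tsign i b * tsign j (b(i := TNbar)) * ?w)"
        using tsign_swap[of i j b, where 'r = "('m, 'k) mpoly"] ij False by simp
      also have "tsign i b * tsign j (b(i := TNbar)) * ?w =
        tsign i b * res_coeff i (b i) * (tsign j (b(i := TNbar)) * res_coeff j ((b(i := TNbar)) j) *
          lookup p (b(i := TNbar, j := TNbar)))"
        using ij by (simp add: mult_ac)
      finally show ?thesis .
    qed
  qed (auto simp: res_coeff_def)
  finally show "lookup (res_diff (res_diff p)) b = lookup 0 b" by simp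
qed

text \<open>
  For fixed \<open>i\<close> the contributions of \<open>b(i := TE)\<close> and \<open>b(i := TN)\<close> cancel, as the augmentation of
  $\mathrm n$ is $x^r$ times that of $\mathrm e$.
\<close>

lemma res_aug_res_diff:
  fixes p :: "('m \<Rightarrow> tgen) \<Rightarrow>\<^sub>0 ('m, 'k::field) mpoly"
  shows "res_aug (res_diff p) = 0"
proof -
  let ?B = "{b. \<forall>i. b i \<in> {TE, TN}} :: ('m \<Rightarrow> tgen) set"
  let ?m = "\<lambda>b. \<Prod>i | b i = TN. Var i ^ r i :: ('m, 'k) mpoly"
  let ?f = "\<lambda>i b. ?m b * (tsign i b * res_coeff i (b i) * lookup p (b(i := TNbar)))"
  have "(\<Sum>b\<in>?B. ?f i b) = 0" for i
  proof -
    let ?E = "{b \<in> ?B. b i = TE}" and ?N = "{b \<in> ?B. b i = TN}"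
    have "?B = ?E \<union> ?N" by auto
    then have "(\<Sum>b\<in>?B. ?f i b) = sum (?f i) (?E \<union> ?N)" by (rule arg_cong[where f = "sum (?f i)"])
    also have "\<dots> = (\<Sum>b\<in>?E. ?f i b) + (\<Sum>b\<in>?N. ?f i b)"
      by (rule sum.union_disjoint) auto
    also have "(\<Sum>b\<in>?N. ?f i b) = (\<Sum>b\<in>?E. - ?f i b)"
    proof (rule sum.reindex_bij_witness[of _ "\<lambda>b. b(i := TN)" "\<lambda>b. b(i := TE)"])
      fix b assume b: "b \<in> ?N"
      then have bi: "b i = TN" by simp
      have eq: "{j. b j = TN} = insert i {j. (b(i := TE)) j = TN}" using bi by auto
      have "?m b = Var i ^ r i * ?m (b(i := TE))" unfolding eq by (subst prod.insert) auto
      moreover have "tsign i (b(i := TE)) = (tsign i b :: ('m, 'k) mpoly)" by (rule tsign_upd_ge) simp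
      ultimately show "- ?f i (b(i := TE)) = ?f i b" using bi by (simp add: res_coeff_def mult_ac)
    qed (auto simp: fun_upd_idem)
    also have "(\<Sum>b\<in>?E. ?f i b) + (\<Sum>b\<in>?E. - ?f i b) = 0" unfolding sum_negf by (rule right_minus)
    finally show ?thesis .
  qed
  then have "(\<Sum>i\<in>UNIV. \<Sum>b\<in>?B. ?f i b) = 0" by simp
  then show ?thesis
    unfolding res_aug_def lookup_res_diff sum_distrib_left by (subst sum.swap)
qed

end

section \<open>Exactness of the complex\<close>

text \<open>
  In the factor \<open>i\<close> this is $x^c \mathrm e \mapsto -x^{c-r}\bar{\mathrm n}$ for $c \ge r$, all other
  basis elements going to 0. It is linear over the field only.
\<close>

definition res_homotopy ::
    "('m::{finite,linorder} \<Rightarrow> nat) \<Rightarrow> 'm \<Rightarrow> (('m \<Rightarrow> tgen) \<Rightarrow>\<^sub>0 ('m, 'k::field) mpoly) \<Rightarrow> (('m \<Rightarrow> tgen) \<Rightarrow>\<^sub>0 ('m, 'k) mpoly)"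
  where "res_homotopy r i p = Abs_poly_mapping (\<lambda>b. if b i = TNbar
    then - (tsign i b * monomial_quotient (single i (r i)) (lookup p (b(i := TE)))) else 0)"

lemma lookup_res_homotopy: "lookup (res_homotopy r i p) b = (if b i = TNbar
    then - (tsign i b * monomial_quotient (single i (r i)) (lookup p (b(i := TE)))) else 0)"
  by (simp add: res_homotopy_def)

lemma res_homotopy_in:
  assumes "p \<in> res_module L t"
  shows "res_homotopy r i p \<in> res_module L (t + 1)"
proof (rule res_moduleI)
  fix b assume "lookup (res_homotopy r i p) b \<noteq> 0"
  then have bi: "b i = TNbar" and "lookup p (b(i := TE)) \<noteq> 0"
    by (auto simp: lookup_res_homotopy monomial_quotient_0 split: if_splits)
  then have b: "b(i := TE) \<in> res_basis L t" using res_moduleD[OF assms] by blast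
  have "{j. b j \<in> {TE, TNbar}} = {j. (b(i := TE)) j \<in> {TE, TNbar}}" using bi by auto
  moreover have "tdeg b = tdeg (b(i := TE)) + 1"
    using tdeg_upd[of "b(i := TE)" i] bi by (simp add: fun_upd_idem)
  moreover have "b j \<noteq> TI" for j
    using b bi by (cases "j = i") (auto simp: res_basis_def fun_upd_def split: if_splits)
  ultimately show "b \<in> res_basis L (t + 1)" using b by (simp add: res_basis_def)
qed

lemma monomial_quotient_tsign_mult: "monomial_quotient k (tsign i b * q) = tsign i b * monomial_quotient k q"
  using tsign_cases[of i b] by (metis monomial_quotient_uminus mult_1 mult_minus1)

lemma monomial_quotient_Var_power:
  "monomial_quotient (single i (n::nat)) (Var i ^ n * q) = q"
  by (simp add: Var_power monomial_quotient_monomial_mult)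

text \<open>
  Since $h\,d\,p = 0$, the left-hand side is $(1 - d h - h d)p$. In the factor \<open>i\<close> this operator kills
  $\bar{\mathrm n}$, keeps of $x^c\mathrm e$ only the terms with $c < r$, and turns the others
  into $x^{c-r}\mathrm n$.
\<close>

lemma lookup_cycle_minus_boundary:
  fixes p :: "('m::{finite,linorder} \<Rightarrow> tgen) \<Rightarrow>\<^sub>0 ('m, 'k::field) mpoly"
  assumes cycle: "res_diff r p = 0"
  shows "lookup (p - res_diff r (res_homotopy r i p)) b =
    (case b i of
      TN \<Rightarrow> lookup p b + monomial_quotient (single i (r i)) (lookup p (b(i := TE)))
    | TE \<Rightarrow> lookup p b - Var i ^ r i * monomial_quotient (single i (r i)) (lookup p b)
    | TNbar \<Rightarrow> 0
    | TI \<Rightarrow> lookup p b)"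
proof -
  let ?S = "monomial_quotient (single i (r i)) :: ('m, 'k) mpoly \<Rightarrow> _"
  let ?h = "lookup (res_homotopy r i p)"
  let ?f = "\<lambda>j. tsign j b * res_coeff r j (b j) * ?h (b(j := TNbar))"
  have dh: "lookup (res_diff r (res_homotopy r i p)) b = (\<Sum>j\<in>UNIV. ?f j)"
    by (rule lookup_res_diff)
  also have "\<dots> = ?f i + (\<Sum>j\<in>UNIV - {i}. ?f j)" by (rule sum.remove) auto
  finally have dh: "lookup (res_diff r (res_homotopy r i p)) b = ?f i + (\<Sum>j\<in>UNIV - {i}. ?f j)" .
  have fi: "?f i = - (res_coeff r i (b i) * ?S (lookup p (b(i := TE))))"
    by (simp add: lookup_res_homotopy tsign_upd_ge mult_ac tsign_square)
  show ?thesis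
  proof (cases "b i = TNbar")
    case False
    have "(\<Sum>j\<in>UNIV - {i}. ?f j) = 0"
      using False by (intro sum.neutral) (auto simp: lookup_res_homotopy)
    then have "lookup (res_diff r (res_homotopy r i p)) b =
        - (res_coeff r i (b i) * ?S (lookup p (b(i := TE))))"
      unfolding dh fi by simp
    moreover have "b(i := TE) = b" if "b i = TE" using that by (simp add: fun_upd_idem)
    ultimately show ?thesis using False
      by (cases "b i") (simp_all add: lookup_minus res_coeff_def)
  next
    case True
    let ?b = "b(i := TE)"
    let ?g = "\<lambda>j. tsign j ?b * res_coeff r j (?b j) * lookup p (?b(j := TNbar))"
    have "0 = tsign i b * ?S (lookup (res_diff r p) ?b)"
      by (simp add: cycle monomial_quotient_0)
    also have "lookup (res_diff r p) ?b = (\<Sum>j\<in>UNIV. ?g j)" by (rule lookup_res_diff)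
    also have "\<dots> = ?g i + (\<Sum>j\<in>UNIV - {i}. ?g j)" by (rule sum.remove) auto
    also have "?g i = - (tsign i b * (Var i ^ r i * lookup p b))"
      using True by (simp add: res_coeff_def tsign_upd_ge fun_upd_idem mult_ac)
    also have "tsign i b * ?S (- (tsign i b * (Var i ^ r i * lookup p b)) + (\<Sum>j\<in>UNIV - {i}. ?g j)) =
        - lookup p b + (\<Sum>j\<in>UNIV - {i}. tsign i b * ?S (?g j))"
      by (simp add: monomial_quotient_add monomial_quotient_diff right_diff_distrib monomial_quotient_uminus monomial_quotient_tsign_mult
          monomial_quotient_Var_power monomial_quotient_sum distrib_left sum_distrib_left tsign_square)
    also have "(\<Sum>j\<in>UNIV - {i}. tsign i b * ?S (?g j)) = (\<Sum>j\<in>UNIV - {i}. ?f j)"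
    proof (rule sum.cong[OF refl])
      fix j assume "j \<in> UNIV - {i}"
      then have ij: "i \<noteq> j" by simp
      show "tsign i b * ?S (?g j) = ?f j"
      proof (cases "b j = TNbar")
        case True
        then show ?thesis using ij by (simp add: res_coeff_def monomial_quotient_0)
      next
        case False
        have S: "?S (res_coeff r j g * q) = res_coeff r j g * ?S q" for g q
          using monomial_quotient_Var_mult[OF ij]
          by (cases g) (simp_all add: res_coeff_def monomial_quotient_uminus monomial_quotient_0)
        have e: "?b(j := TNbar) = b(j := TNbar, i := TE)" using ij by (rule fun_upd_twist)
        \<comment> \<open>Raising the factors \<open>i\<close> and \<open>j\<close> in the two possible orders gives opposite signs.\<close>
        have "tsign j ?b * tsign i (?b(j := TNbar)) = - (tsign i ?b * tsign j (?b(i := TNbar)) :: ('m, 'k) mpoly)"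
          using ij False by (intro tsign_swap) auto
        then have sg: "tsign j ?b * tsign i (b(j := TNbar)) = - (tsign i b * tsign j b :: ('m, 'k) mpoly)"
          using True by (simp add: e tsign_upd_ge fun_upd_idem)
        have "- (tsign j b * tsign i (b(j := TNbar))) = (tsign i b * tsign j ?b :: ('m, 'k) mpoly)"
        proof -
          have "tsign i (b(j := TNbar)) * (tsign i b * (tsign j ?b * tsign i (b(j := TNbar)))) =
            tsign i (b(j := TNbar)) * (tsign i b * (- (tsign i b * tsign j b :: ('m, 'k) mpoly)))"
            by (simp add: sg)
          then show ?thesis by (simp add: mult_ac tsign_square)
        qed
        note signs = this
        let ?q = "res_coeff r j (b j) * ?S (lookup p (b(j := TNbar, i := TE)))"
        have "tsign i b * ?S (?g j) = tsign i b * tsign j ?b * ?q"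
          using ij by (simp add: mult.assoc monomial_quotient_tsign_mult S e)
        moreover have "?f j = - (tsign j b * tsign i (b(j := TNbar))) * ?q"
          using True ij by (simp add: lookup_res_homotopy mult_ac)
        ultimately show ?thesis by (simp only: signs)
      qed
    qed
    finally have "lookup p b = (\<Sum>j\<in>UNIV - {i}. ?f j)" by simp
    then show ?thesis using True fi by (simp add: lookup_minus dh res_coeff_def)
  qed
qed

text \<open>
  The normal form in the factor \<open>i\<close>: no $\bar{\mathrm n}$, and $x^c\mathrm e$ only for $c < r_i$.
\<close>

definition reduced_at :: "('m::{finite,linorder} \<Rightarrow> nat) \<Rightarrow> 'm \<Rightarrow> (('m \<Rightarrow> tgen) \<Rightarrow>\<^sub>0 ('m, 'k::field) mpoly) \<Rightarrow> bool"
  where "reduced_at r i p \<longleftrightarrow> (\<forall>b. (b i = TNbar \<longrightarrow> lookup p b = 0) \<and>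
    (b i = TE \<longrightarrow> monomial_quotient (single i (r i)) (lookup p b) = 0))"

lemma reduced_at_cycle_minus_boundary:
  assumes "res_diff r p = 0"
  shows "reduced_at r i (p - res_diff r (res_homotopy r i p))"
  unfolding reduced_at_def lookup_cycle_minus_boundary[OF assms]
  by (simp add: monomial_quotient_diff monomial_quotient_Var_power)

text \<open>
  The homotopies of different factors involve different variables, so a normal form reached in
  one factor is not destroyed by treating another one.
\<close>

lemma reduced_at_preserved:
  assumes "res_diff r p = 0" and red: "reduced_at r j p" and ij: "i \<noteq> j"
  shows "reduced_at r j (p - res_diff r (res_homotopy r i p))"
  unfolding reduced_at_def lookup_cycle_minus_boundary[OF assms(1)]
proof (intro allI conjI impI)
  fix b :: "'a \<Rightarrow> tgen"
  let ?S = "\<lambda>i. monomial_quotient (single i (r i))"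
  have N: "lookup p b' = 0" if "b' j = TNbar" for b'
    using red that by (simp add: reduced_at_def)
  have E: "?S j (lookup p b') = 0" if "b' j = TE" for b'
    using red that by (simp add: reduced_at_def)
  let ?c = "case b i of
      TN \<Rightarrow> lookup p b + ?S i (lookup p (b(i := TE)))
    | TE \<Rightarrow> lookup p b - Var i ^ r i * ?S i (lookup p b)
    | TNbar \<Rightarrow> 0
    | TI \<Rightarrow> lookup p b"
  show "?c = 0" if "b j = TNbar"
    using that ij by (cases "b i") (simp_all add: N monomial_quotient_0)
  show "?S j ?c = 0" if "b j = TE"
  proof -
    have S: "?S j (?S i q) = ?S i (?S j q)" for q :: "('a, 'b) mpoly" by (rule monomial_quotient_commute)
    show ?thesis using that ij
      by (cases "b i") (simp_all add: E S monomial_quotient_0 monomial_quotient_add monomial_quotient_diff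
          monomial_quotient_Var_mult)
  qed
qed

text \<open>
  The factors are treated one at a time; after each step the cycle has changed by a boundary.
\<close>

lemma cycle_homologous_to_reduced:
  assumes L: "simplicial_complex L" and z: "z \<in> res_module L t" "res_diff r z = 0" and fin: "finite J"
  shows "\<exists>y\<in>res_module L (t + 1). \<forall>j\<in>J. reduced_at r j (z - res_diff r y)"
  using fin
proof induction
  case empty
  show ?case using module.subspace_0[OF module_sum_scale subspace_res_module[of L "t + 1"]] by blast
next
  case (insert i J)
  then obtain y where y: "y \<in> res_module L (t + 1)" "\<And>j. j \<in> J \<Longrightarrow> reduced_at r j (z - res_diff r y)"
    by blast
  note sub = subspace_res_module
  note M = module_sum_scale
  have lin: "res_diff r (a + b) = res_diff r a + res_diff r b" "res_diff r (a - b) = res_diff r a - res_diff r b"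
    for a b :: "('a \<Rightarrow> tgen) \<Rightarrow>\<^sub>0 ('a, 'b) mpoly"
    using linear_onD(1)[OF linear_res_diff UNIV_I UNIV_I]
      linear_on_diff[OF M M module.subspace_UNIV[OF M] linear_res_diff UNIV_I UNIV_I] by auto
  let ?w = "z - res_diff r y"
  have "?w \<in> res_module L t"
    using module.subspace_diff[OF M sub z(1)] res_diff_in[OF L y(1)] by simp
  then have h: "res_homotopy r i ?w \<in> res_module L (t + 1)" by (rule res_homotopy_in)
  have cyc: "res_diff r ?w = 0" by (simp add: lin z res_diff_res_diff)
  show ?case
  proof (intro bexI ballI)
    show "y + res_homotopy r i ?w \<in> res_module L (t + 1)"
      by (rule module.subspace_add[OF M sub y(1) h])
    fix j assume "j \<in> insert i J"
    then have "reduced_at r j (?w - res_diff r (res_homotopy r i ?w))"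
      using reduced_at_cycle_minus_boundary[OF cyc] reduced_at_preserved[OF cyc y(2)] insert(2)
      by (cases "j = i") auto
    then show "reduced_at r j (z - res_diff r (y + res_homotopy r i ?w))"
      by (simp add: lin diff_diff_eq)
  qed
qed

text \<open>
  In normal form the coefficient of a monomial $x^d$ in the augmentation comes from a single basis
  tensor, the one with $\mathrm n$ exactly where $d_i \ge r_i$. So all coefficients of \<open>p\<close> can be
  read off from its augmentation.
\<close>

lemma res_aug_inj_on_reduced:
  assumes p: "p \<in> res_module L 0" and red: "\<And>j. reduced_at r j p" and aug: "res_aug r p = 0"
  shows "p = 0"
proof (rule poly_mapping_eqI)
  fix b :: "'a \<Rightarrow> tgen"
  let ?B = "{b. \<forall>i. b i \<in> {TE, TN}} :: ('a \<Rightarrow> tgen) set"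
  let ?k = "\<lambda>b :: 'a \<Rightarrow> tgen. \<Sum>i | b i = TN. single i (r i)"
  have k: "lookup (?k b) i = (if b i = TN then r i else 0)" for b i
    by (simp add: lookup_exponent_sum)
  have van: "lookup (lookup p b) c = 0" if "b i = TE" "r i \<le> lookup c i" for b i c
    using red[of i] that lookup_zero_of_monomial_quotient_zero[of i "r i" "lookup p b" c]
    by (simp add: reduced_at_def)
  show "lookup p b = lookup 0 b"
  proof (cases "b \<in> res_basis L 0")
    case False
    then show ?thesis using res_moduleD[OF p] by auto
  next
    case True
    then have "b i \<noteq> TNbar" "b i \<noteq> TI" for i by (auto simp: res_basis_def tdeg_def)
    then have b: "b \<in> ?B" by (simp add: tgen.exhaust) (metis tgen.exhaust)
    have "lookup (lookup p b) c = 0" for c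
    proof (cases "\<exists>i. b i = TE \<and> r i \<le> lookup c i")
      case True
      then show ?thesis using van by blast
    next
      case False
      \<comment> \<open>The augmentation of the term \<open>c\<close> at \<open>b\<close>; no other \<open>b'\<close> contributes to this exponent.\<close>
      let ?d = "c + ?k b"
      let ?f = "\<lambda>b'. lookup ((\<Prod>i | b' i = TN. Var i ^ r i) * lookup p b') ?d"
      have f: "?f b' = (if \<forall>i. lookup (?k b') i \<le> lookup ?d i
          then lookup (lookup p b') (?d - ?k b') else 0)" for b'
        by (simp add: prod_Var_power lookup_single_mult)
      have "0 = (\<Sum>b'\<in>?B. ?f b')"
        using arg_cong[OF aug, of "\<lambda>q. lookup q ?d"] by (simp add: res_aug_def lookup_sum)
      also have "\<dots> = (\<Sum>b'\<in>?B. if b' = b then ?f b else 0)"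
      proof (rule sum.cong[OF refl])
        fix b' assume b': "b' \<in> ?B"
        show "?f b' = (if b' = b then ?f b else 0)"
        proof (cases "b' = b")
          case neq: False
          then obtain i where i: "b' i \<noteq> b i" by auto
          show ?thesis
          proof (cases "b i = TE")
            case True
            then have "b' i = TN" "lookup c i < r i" using i b' False by (auto simp: not_le) 
            then have "\<not> lookup (?k b') i \<le> lookup ?d i"
              using True unfolding lookup_add k by simp
            then have nle: "\<not> (\<forall>i. lookup (?k b') i \<le> lookup ?d i)" by blast
            have "?f b' = 0" unfolding f by (rule if_not_P[OF nle])
            then show ?thesis using neq by simp
          next
            case bi: False
            then have "b i = TN" "b' i = TE" using b b' i by force+
            then have 0: "lookup (lookup p b') (?d - ?k b') = 0"
              by (intro van) (auto simp: lookup_minus lookup_add k)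
            have "?f b' = 0" unfolding f 0 by (rule if_cancel)
            then show ?thesis using neq by simp
          qed
        qed simp
      qed
      also have "\<dots> = ?f b" using b by simp
      also have "\<dots> = lookup (lookup p b) c" unfolding f by (simp add: lookup_add)
      finally show ?thesis by simp
    qed
    then show ?thesis by (intro poly_mapping_eqI) simp
  qed
qed

lemma mem_dual_complex_iff: "\<sigma> \<in> dual_complex K \<longleftrightarrow> UNIV - \<sigma> \<notin> K"
  unfolding dual_complex_def by (auto simp: double_diff)

lemma simplicial_complex_dual:
  assumes "simplicial_complex K"
  shows "simplicial_complex (dual_complex K)"
  unfolding simplicial_complex_def
proof (intro ballI allI impI)
  fix \<tau> \<sigma> assume "\<tau> \<in> dual_complex K" "\<sigma> \<subseteq> \<tau>"
  then have "UNIV - \<tau> \<notin> K" "UNIV - \<tau> \<subseteq> UNIV - \<sigma>" by (auto simp: mem_dual_complex_iff)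
  then show "\<sigma> \<in> dual_complex K" using assms unfolding mem_dual_complex_iff simplicial_complex_def by blast
qed

lemma module_times: "module ((*) :: 'r::comm_ring_1 \<Rightarrow> 'r \<Rightarrow> 'r)"
  by unfold_locales (simp_all add: algebra_simps)

lemma res_aug_single:
  assumes "\<forall>i. b i \<in> {TE, TN}"
  shows "res_aug r (single b 1) = (\<Prod>i | b i = TN. Var i ^ r i)"
proof -
  have "res_aug r (single b 1) =
    (\<Sum>b' | \<forall>i. b' i \<in> {TE, TN}. if b' = b then \<Prod>i | b i = TN. Var i ^ r i else 0)"
    unfolding res_aug_def by (intro sum.cong refl) (auto simp: lookup_single when_def)
  also have "\<dots> = (\<Prod>i | b i = TN. Var i ^ r i)" using assms by simp
  finally show ?thesis .
qed

text \<open>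
  A tensor of factors $\mathrm e$ and $\mathrm n$ is admitted if its set of $\mathrm e$ is a face of
  the dual complex, that is, if its set of $\mathrm n$ is not a face of \<open>K\<close>; its augmentation is then
  the corresponding generator of the ideal.
\<close>

lemma res_aug_image:
  fixes K :: "'m::{finite,linorder} set set"
  shows "res_aug r ` res_module (dual_complex K) 0 = (monomial_ideal K r :: ('m, 'k::field) mpoly set)"
proof -
  interpret R: module "(*) :: ('m, 'k) mpoly \<Rightarrow> _" by (rule module_times)
  let ?G = "{\<Prod>i\<in>\<sigma>. Var i ^ r i | \<sigma>. \<sigma> \<notin> K} :: ('m, 'k) mpoly set"
  let ?M = "res_module (dual_complex K) 0 :: (('m \<Rightarrow> tgen) \<Rightarrow>\<^sub>0 ('m, 'k) mpoly) set"
  have I: "monomial_ideal K r = R.span ?G" by (simp add: monomial_ideal_def ideal_generated_def)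
  show ?thesis unfolding I
  proof (rule antisym)
    show "res_aug r ` ?M \<subseteq> R.span ?G"
    proof clarify
      fix p assume p: "p \<in> ?M"
      show "res_aug r p \<in> R.span ?G"
        unfolding res_aug_def
      proof (rule R.span_sum)
        fix b :: "'m \<Rightarrow> tgen" assume b: "b \<in> {b. \<forall>i. b i \<in> {TE, TN}}"
        show "(\<Prod>i | b i = TN. Var i ^ r i) * lookup p b \<in> R.span ?G"
        proof (cases "lookup p b = 0")
          case False
          then have "{i. b i \<in> {TE, TNbar}} \<in> dual_complex K" using res_moduleD[OF p] by (auto simp: res_basis_def)
          moreover have "UNIV - {i. b i \<in> {TE, TNbar}} = {i. b i = TN}" using b by auto
          ultimately have "(\<Prod>i | b i = TN. Var i ^ r i) \<in> ?G" by (auto simp: mem_dual_complex_iff)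
          from R.span_scale[OF R.span_base[OF this], of "lookup p b"] show ?thesis
            by (simp add: mult.commute)
        qed (simp add: R.span_zero)
      qed
    qed
    show "R.span ?G \<subseteq> res_aug r ` ?M"
    proof (rule R.span_minimal)
      show "R.subspace (res_aug r ` ?M)"
        by (rule subspace_linear_image[OF module_sum_scale R.module_axioms subspace_res_module linear_res_aug])
      show "?G \<subseteq> res_aug r ` ?M"
      proof clarify
        fix \<sigma> assume \<sigma>: "\<sigma> \<notin> K"
        define b where "b i = (if i \<in> \<sigma> then TN else TE)" for i
        have bTE: "\<forall>i. b i \<in> {TE, TN}" by (simp add: b_def)
        have "{i. b i \<in> {TE, TNbar}} = UNIV - \<sigma>" "{i. b i = TN} = \<sigma>" "{i. b i = TNbar} = {}"
          by (auto simp: b_def)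
        moreover have "UNIV - (UNIV - \<sigma>) = \<sigma>" by auto
        ultimately have "b \<in> res_basis (dual_complex K) 0"
          using \<sigma> by (simp add: res_basis_def mem_dual_complex_iff tdeg_def) (simp add: b_def)
        then have "single b 1 \<in> ?M" by (simp add: res_module_def)
        moreover have "res_aug r (single b 1) = (\<Prod>i\<in>\<sigma>. Var i ^ r i :: ('m, 'k) mpoly)"
          using res_aug_single[of b r] \<open>{i. b i = TN} = \<sigma>\<close> bTE by simp
        ultimately show "(\<Prod>i\<in>\<sigma>. Var i ^ r i) \<in> res_aug r ` ?M" by force
      qed
    qed
  qed
qed

text \<open>
  A cycle is homologous to a reduced one. In positive degree each basis tensor has a factor
  $\bar{\mathrm n}$, so the reduced cycle is 0; in degree 0 the augmentation detects it.
\<close>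

theorem free_resolution_monomial_ideal:
  fixes K :: "'m::{finite,linorder} set set"
  assumes K: "simplicial_complex K"
  shows "free_resolution (sum_scale (*)) (res_module (dual_complex K)) (\<lambda>_. res_diff r) (res_aug r)
    (*) (monomial_ideal K r :: ('m, 'k::field) mpoly set)"
proof -
  let ?M = "res_module (dual_complex K) :: int \<Rightarrow> (('m \<Rightarrow> tgen) \<Rightarrow>\<^sub>0 ('m, 'k) mpoly) set"
  note L = simplicial_complex_dual[OF K]
  note M = module_sum_scale
  have d: "res_diff r y \<in> ?M t" if "y \<in> ?M (t + 1)" for y t using res_diff_in[OF L that] by simp
  have ex: "z \<in> res_diff r ` ?M (t + 1)"
    if z: "z \<in> ?M t" "res_diff r z = 0" and t: "t \<ge> 1 \<or> t = 0 \<and> res_aug r z = 0" for z t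
  proof -
    obtain y where y: "y \<in> ?M (t + 1)" "\<And>j. reduced_at r j (z - res_diff r y)"
      using cycle_homologous_to_reduced[OF L z, of UNIV] by auto
    have w: "z - res_diff r y \<in> ?M t" by (rule module.subspace_diff[OF M subspace_res_module z(1) d[OF y(1)]])
    have "z - res_diff r y = 0"
    proof (cases "t = 0")
      case True
      have "res_aug r (z - res_diff r y) = res_aug r z - res_aug r (res_diff r y)"
        by (rule linear_on_diff[OF M module_times module.subspace_UNIV[OF M] linear_res_aug]) auto
      then have "res_aug r (z - res_diff r y) = 0" using True t by (simp add: res_aug_res_diff)
      then show ?thesis using res_aug_inj_on_reduced w y(2) True by blast
    next
      case False
      show ?thesis
      proof (rule poly_mapping_eqI)
        fix b
        have "\<exists>i. b i = TNbar" if "b \<in> res_basis (dual_complex K) t"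
          using that False by (auto simp: res_basis_def tdeg_def)
        then show "lookup (z - res_diff r y) b = lookup 0 b"
          using res_moduleD[OF w, of b] y(2) by (auto simp: reduced_at_def)
      qed
    qed
    then show ?thesis using y(1) by auto
  qed
  have neg: "?M t = {0}" if "t < 0" for t
  proof -
    have "res_basis (dual_complex K) t = {}" using that by (auto simp: res_basis_def tdeg_def)
    then show ?thesis by (auto simp: res_module_def)
  qed
  show ?thesis unfolding free_resolution_def
  proof (intro conjI allI impI)
    show "\<exists>B. \<not> module.dependent (sum_scale (*)) B \<and> module.span (sum_scale (*)) B = ?M t" for t
      using keys_span_single[of "res_basis (dual_complex K) t"] by (auto simp: res_module_def)
    show "res_diff r ` ?M t \<subseteq> ?M (t - 1)" for t using res_diff_in[OF L] by blast
    show "{x \<in> ?M 0. res_aug r x = 0} = res_diff r ` ?M 1"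
    proof (intro equalityI subsetI)
      fix x assume x: "x \<in> {x \<in> ?M 0. res_aug r x = 0}"
      then have "res_diff r x \<in> ?M (-1)" using res_diff_in[OF L, of x 0] by simp
      then have "res_diff r x = 0" using neg[of "-1"] by simp
      then show "x \<in> res_diff r ` ?M 1" using ex[of x 0] x by simp
    qed (use d[of _ 0] in \<open>auto simp: res_aug_res_diff\<close>)
    show "{x \<in> ?M t. res_diff r x = 0} = res_diff r ` ?M (t + 1)" if "1 \<le> t" for t
      using ex[of _ t] that d by (auto simp: res_diff_res_diff)
  qed (use neg in \<open>auto simp: M linear_res_diff linear_res_aug res_aug_image\<close>)
qed

section \<open>Reduction modulo the variables\<close>

lemma ideal_multiples_res_module:
  fixes L :: "'m::finite set set"
  shows "ideal_multiples (sum_scale (*)) irrelevant_ideal (res_module L t :: (('m \<Rightarrow> tgen) \<Rightarrow>\<^sub>0 ('m, 'k::field) mpoly) set) =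
    {p \<in> res_module L t. \<forall>b. lookup (lookup p b) 0 = 0}"
  (is "?I = ?R")
proof
  note M = module_sum_scale and sub = subspace_res_module
  show "?I \<subseteq> ?R" unfolding ideal_multiples_def
  proof (rule module.span_minimal[OF M])
    show "module.subspace (sum_scale (*)) ?R"
      using module.subspace_0[OF M sub] module.subspace_add[OF M sub] module.subspace_scale[OF M sub]
      by (intro module.subspaceI[OF M]) (auto simp: lookup_add lookup_sum_scale lookup_mult_at_0)
    show "{sum_scale (*) c a | c a. c \<in> irrelevant_ideal \<and> a \<in> res_module L t} \<subseteq> ?R"
      using module.subspace_scale[OF M sub]
      by (auto simp: irrelevant_ideal_def lookup_sum_scale lookup_mult_at_0)
  qed
  show "?R \<subseteq> ?I"
  proof clarify
    fix p :: "('m \<Rightarrow> tgen) \<Rightarrow>\<^sub>0 ('m, 'k) mpoly"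
    assume p: "p \<in> res_module L t" "\<forall>b. lookup (lookup p b) 0 = 0"
    have "p = (\<Sum>b\<in>keys p. sum_scale (*) (lookup p b) (single b 1))"
      by (rule poly_mapping_eqI)
        (simp add: lookup_sum lookup_sum_scale lookup_single when_def in_keys_iff if_distrib cong: if_cong)
    also have "\<dots> \<in> ?I"
      unfolding ideal_multiples_def
    proof (intro module.span_sum[OF M] module.span_base[OF M])
      fix b assume "b \<in> keys p"
      then have "single b (1 :: ('m, 'k) mpoly) \<in> res_module L t" using p by (auto simp: res_module_def)
      moreover have "lookup p b \<in> irrelevant_ideal" using p by (simp add: irrelevant_ideal_def)
      ultimately show "sum_scale (*) (lookup p b) (single b 1)
          \<in> {sum_scale (*) c a | c a. c \<in> irrelevant_ideal \<and> a \<in> (res_module L t :: (('m \<Rightarrow> tgen) \<Rightarrow>\<^sub>0 ('m, 'k) mpoly) set)}"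
        by blast
    qed
    finally show "p \<in> ?I" .
  qed
qed

text \<open>
  The differential of $T_*$ rewritten by coefficients, so that it can be compared with
  that of the resolution.
\<close>

lemma lookup_tdiff:
  fixes p :: "('m::{finite,linorder} \<Rightarrow> tgen) \<Rightarrow>\<^sub>0 'k::field"
  shows "lookup (tdiff p) b =
    (\<Sum>i | b i = TN. tsign i b * lookup p (b(i := TNbar)))"
proof -
  let ?g = "\<lambda>c i. if c i = TNbar \<and> c(i := TN) = b then tsign i c * lookup p c else 0"
  have "lookup (tdiff p) b = (\<Sum>c\<in>keys p. \<Sum>i | c i = TNbar.
      lookup (single (c(i := TN)) (tsign i c * lookup p c)) b)"
    by (simp add: tdiff_def lookup_sum tsign_def)
  also have "\<dots> = (\<Sum>c\<in>keys p. \<Sum>i\<in>UNIV. ?g c i)"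
    by (intro sum.cong refl sum.mono_neutral_cong_left) (auto simp: lookup_single when_def)
  also have "\<dots> = (\<Sum>c\<in>UNIV. \<Sum>i\<in>UNIV. ?g c i)"
    by (intro sum.mono_neutral_left) (auto simp: in_keys_iff intro!: sum.neutral)
  also have "\<dots> = (\<Sum>i\<in>UNIV. \<Sum>c\<in>UNIV. ?g c i)" by (rule sum.swap)
  also have "\<dots> = (\<Sum>i\<in>UNIV. if b i = TN then tsign i b * lookup p (b(i := TNbar)) else 0)"
  proof (rule sum.cong[OF refl])
    fix i
    have "c i = TNbar \<and> c(i := TN) = b \<longleftrightarrow> b i = TN \<and> c = b(i := TNbar)" for c
      by (auto simp: fun_upd_idem)
    then have "(\<Sum>c\<in>UNIV. ?g c i) =
        (\<Sum>c\<in>UNIV. if c = b(i := TNbar) then (if b i = TN then tsign i c * lookup p c else 0) else 0)"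
      by (intro sum.cong refl) simp
    also have "\<dots> = (if b i = TN then tsign i b * lookup p (b(i := TNbar)) else 0)"
      by (simp add: tsign_upd_ge)
    finally show "(\<Sum>c\<in>UNIV. ?g c i) = (if b i = TN then tsign i b * lookup p (b(i := TNbar)) else 0)" .
  qed
  finally show ?thesis by (simp add: sum.If_cases)
qed

lemma linear_tdiff: "linear_on (sum_scale (*)) (sum_scale (*)) A tdiff"
  by (rule linear_onI; rule poly_mapping_eqI)
    (simp_all add: lookup_tdiff lookup_add lookup_sum_scale distrib_left sum.distrib sum_distrib_left mult_ac)

lemma tbasis_iff:
  assumes "simplicial_complex L"
  shows "b \<in> tbasis L \<longleftrightarrow> {i. b i \<in> {TE, TNbar}} \<in> L"
proof
  assume "b \<in> tbasis L"
  then obtain \<tau> where \<tau>: "\<tau> \<in> L" "\<And>i. b i \<in> (if i \<in> \<tau> then {TE, TN, TNbar, TI} else {TN, TI})"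
    by (auto simp: tbasis_def)
  have "{i. b i \<in> {TE, TNbar}} \<subseteq> \<tau>"
  proof clarify
    fix i assume "b i \<in> {TE, TNbar}"
    then show "i \<in> \<tau>" using \<tau>(2)[of i] by (auto split: if_splits)
  qed
  then show "{i. b i \<in> {TE, TNbar}} \<in> L" using assms \<tau>(1) by (auto simp: simplicial_complex_def)
next
  assume "{i. b i \<in> {TE, TNbar}} \<in> L"
  moreover have "b i \<in> (if i \<in> {i. b i \<in> {TE, TNbar}} then {TE, TN, TNbar, TI} else {TN, TI})" for i
    by (cases "b i") auto
  ultimately show "b \<in> tbasis L" unfolding tbasis_def by blast
qed

text \<open>
  The summand of $T_*(L)$ with $\mathrm e$ on $\sigma$ and index $\mathrm n$ on the complement of
  $\sigma$ leaves no room for $\mathrm i$.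
\<close>

lemma res_basis_iff_tchain_basis:
  assumes "simplicial_complex L"
  shows "b \<in> res_basis L t \<and> {i. b i = TE} = \<sigma> \<longleftrightarrow>
    b \<in> tbasis L \<and> {i. b i = TE} = \<sigma> \<and> {i. b i \<in> {TN, TNbar}} = UNIV - \<sigma> \<and> tdeg b = t"
proof -
  have "{i. b i \<in> {TN, TNbar}} = UNIV - {i. b i = TE} \<longleftrightarrow> (\<forall>i. b i \<noteq> TI)"
  proof
    assume "{i. b i \<in> {TN, TNbar}} = UNIV - {i. b i = TE}"
    then have "b i = TE \<or> b i \<in> {TN, TNbar}" for i by blast
    then show "\<forall>i. b i \<noteq> TI" by (metis empty_iff insert_iff tgen.distinct)
  next
    assume "\<forall>i. b i \<noteq> TI"
    then have "b i \<in> {TN, TNbar} \<longleftrightarrow> b i \<noteq> TE" for i by (cases "b i") auto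
    then show "{i. b i \<in> {TN, TNbar}} = UNIV - {i. b i = TE}" by auto
  qed
  then show ?thesis unfolding tbasis_iff[OF assms] res_basis_def by auto
qed

text \<open>
  Sets all variables to 0 and sorts the basis tensors by their set of factors $\mathrm e$, which
  the differential of $T_*$ does not change.
\<close>

definition constant_part ::
    "(('m::finite \<Rightarrow> tgen) \<Rightarrow>\<^sub>0 ('m, 'k::field) mpoly) \<Rightarrow> ('m set \<Rightarrow>\<^sub>0 (('m \<Rightarrow> tgen) \<Rightarrow>\<^sub>0 'k))"
  where "constant_part p = Abs_poly_mapping (\<lambda>\<sigma>. Abs_poly_mapping
    (\<lambda>b. if {i. b i = TE} = \<sigma> then lookup (lookup p b) 0 else 0))"

lemma lookup_constant_part: "lookup (lookup (constant_part p) \<sigma>) b =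
    (if {i. b i = TE} = \<sigma> then lookup (lookup p b) 0 else 0)"
  by (simp add: constant_part_def)

lemma lookup_tsign_mult: "lookup (tsign i b * q :: ('m, 'k::field) mpoly) c = tsign i b * lookup q c"
proof (cases "tsign i b = (1 :: 'k)")
  case True
  then have "even (card {j. j < i \<and> b j = TNbar}) \<or> (1::'k) = - 1" 
    unfolding tsign_def by (metis neg_one_odd_power)
  then show ?thesis
    by (cases "even (card {j. j < i \<and> b j = TNbar})") (auto simp: tsign_def)
next
  case False
  then have "odd (card {j. j < i \<and> b j = TNbar})" by (auto simp: tsign_def)
  then show ?thesis by (simp add: tsign_def)
qed

text \<open>
  The term $x^r\mathrm e$ of $d\bar{\mathrm n}$ has no constant part because $r > 0$.
\<close>

lemma constant_part_res_diff:
  fixes p :: "('m::{finite,linorder} \<Rightarrow> tgen) \<Rightarrow>\<^sub>0 ('m, 'k::field) mpoly"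
  assumes r: "\<And>i. r i > 0"
  shows "lookup (constant_part (res_diff r p)) \<sigma> = tdiff (lookup (constant_part p) \<sigma>)"
proof (rule poly_mapping_eqI)
  fix b :: "'m \<Rightarrow> tgen"
  have c: "lookup (tsign i b * res_coeff r i (b i) * q) 0 =
      (if b i = TN then tsign i b * lookup q 0 else 0)" for i and q :: "('m, 'k) mpoly"
  proof (cases "b i")
    case TE
    have "lookup (Var i ^ r i :: ('m, 'k) mpoly) 0 = 0"
    proof -
      have "lookup (single i (r i)) i \<noteq> lookup 0 i" using r[of i] by simp
      then have "single i (r i) \<noteq> 0" by metis
      then show ?thesis by (simp add: Var_power lookup_single when_def)
    qed
    then show ?thesis using TE by (simp add: res_coeff_def lookup_mult_at_0)
  qed (simp_all add: res_coeff_def lookup_tsign_mult)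
  have "(if {i. b i = TE} = \<sigma> then (\<Sum>i | b i = TN. tsign i b * lookup (lookup p (b(i := TNbar))) 0) else 0)
    = (\<Sum>i | b i = TN. tsign i b * lookup (lookup (constant_part p) \<sigma>) (b(i := TNbar)))"
  proof -
    have e: "{j. (b(i := TNbar)) j = TE} = {j. b j = TE}" if "b i = TN" for i using that by auto
    have "(\<Sum>i | b i = TN. tsign i b * lookup (lookup (constant_part p) \<sigma>) (b(i := TNbar))) =
      (\<Sum>i | b i = TN. if {j. b j = TE} = \<sigma> then tsign i b * lookup (lookup p (b(i := TNbar))) 0 else 0)"
      by (intro sum.cong refl) (simp add: lookup_constant_part e del: fun_upd_apply)
    from this[symmetric] show ?thesis by (rule trans[rotated]) simp
  qed
  moreover have "lookup (lookup (constant_part (res_diff r p)) \<sigma>) b =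
    (if {i. b i = TE} = \<sigma> then (\<Sum>i | b i = TN. tsign i b * lookup (lookup p (b(i := TNbar))) 0) else 0)"
    by (simp add: lookup_constant_part lookup_res_diff lookup_sum c sum.If_cases)
  ultimately show "lookup (lookup (constant_part (res_diff r p)) \<sigma>) b =
      lookup (tdiff (lookup (constant_part p) \<sigma>)) b"
    by (simp only: lookup_tdiff)
qed

lemma linear_constant_part:
  "linear_on (\<lambda>c. sum_scale (*) (Const c)) (sum_scale (sum_scale (*))) A constant_part"
proof (rule linear_onI; (rule poly_mapping_eqI)+)
  fix x y \<sigma> b
  show "lookup (lookup (constant_part (x + y)) \<sigma>) b =
      lookup (lookup (constant_part x + constant_part y) \<sigma>) b"
    by (simp add: lookup_constant_part lookup_add)
  show "lookup (lookup (constant_part (sum_scale (*) (Const c) x)) \<sigma>) b =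
      lookup (lookup (sum_scale (sum_scale (*)) c (constant_part x)) \<sigma>) b" for c
    by (simp add: lookup_constant_part lookup_sum_scale_module[OF module_sum_scale] lookup_sum_scale
        lookup_mult_at_0 Const_def)
qed

lemma subspace_keys: "module.subspace (sum_scale (*)) {p. keys p \<subseteq> G}"
  unfolding keys_span_single(2)[symmetric] by (rule module.subspace_span[OF module_sum_scale])

lemma subspace_tchains: "module.subspace (sum_scale (*)) (tchains K \<sigma> \<omega> t)"
  unfolding tchains_def by (rule subspace_keys)

lemma subquotient_module_thomology: "subquotient_module (sum_scale (*)) (thomology K \<sigma> \<omega> t)"
proof -
  note M = module_sum_scale
  show ?thesis
    unfolding thomology_def homology_def subquotient_module_def fst_conv snd_conv
    by (intro conjI M subspace_linear_preimage_on[OF M M subspace_tchains linear_tdiff]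
        subspace_set_plus[OF M] subspace_linear_image[OF M M subspace_tchains linear_tdiff]
        module.subspace_single_0[OF M])
qed

lemma mem_thomology:
  "x \<in> fst (thomology K \<sigma> \<omega> t) \<longleftrightarrow> x \<in> tchains K \<sigma> \<omega> t \<and> tdiff x = 0"
  "x \<in> snd (thomology K \<sigma> \<omega> t) \<longleftrightarrow> x \<in> tdiff ` tchains K \<sigma> \<omega> (t + 1)"
  by (auto simp: thomology_def homology_def set_plus_def)

lemma constant_part_in:
  assumes L: "simplicial_complex L" and p: "p \<in> res_module L t"
  shows "keys (constant_part p) \<subseteq> L"
    and "lookup (constant_part p) \<sigma> \<in> tchains L \<sigma> (UNIV - \<sigma>) t"
proof -
  have b: "b \<in> res_basis L t \<and> {i. b i = TE} = \<sigma>"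
    if "lookup (lookup (constant_part p) \<sigma>) b \<noteq> 0" for b \<sigma>
    using that res_moduleD[OF p, of b]
    by (cases "lookup p b = 0") (auto simp: lookup_constant_part split: if_splits)
  show "lookup (constant_part p) \<sigma> \<in> tchains L \<sigma> (UNIV - \<sigma>) t"
    using b[of \<sigma>] unfolding res_basis_iff_tchain_basis[OF L] tchains_def
    by (auto simp: in_keys_iff)
  show "keys (constant_part p) \<subseteq> L"
  proof
    fix \<sigma> assume "\<sigma> \<in> keys (constant_part p)"
    then obtain b where "lookup (lookup (constant_part p) \<sigma>) b \<noteq> 0"
      by (metis in_keys_iff lookup_zero poly_mapping_eqI)
    from b[OF this] have "{i. b i \<in> {TE, TNbar}} \<in> L" "\<sigma> \<subseteq> {i. b i \<in> {TE, TNbar}}" by (auto simp: res_basis_def)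
    then show "\<sigma> \<in> L" using L by (auto simp: simplicial_complex_def)
  qed
qed

lemma constant_part_surj:
  fixes y :: "'m::finite set \<Rightarrow> (('m \<Rightarrow> tgen) \<Rightarrow>\<^sub>0 'k::field)"
  assumes L: "simplicial_complex L" and y: "\<And>\<sigma>. \<sigma> \<in> L \<Longrightarrow> y \<sigma> \<in> tchains L \<sigma> (UNIV - \<sigma>) t"
  shows "\<exists>p\<in>res_module L t. \<forall>\<sigma>\<in>L. lookup (constant_part p) \<sigma> = y \<sigma>"
proof -
  define p :: "('m \<Rightarrow> tgen) \<Rightarrow>\<^sub>0 ('m, 'k) mpoly" where "p = Abs_poly_mapping (\<lambda>b.
    if {i. b i = TE} \<in> L then Const (lookup (y {i. b i = TE}) b) else 0)"
  have lp: "lookup p b = (if {i. b i = TE} \<in> L then Const (lookup (y {i. b i = TE}) b) else 0)" for b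
    by (simp add: p_def)
  have basis: "b \<in> res_basis L t \<and> {i. b i = TE} = \<sigma>" if "lookup (y \<sigma>) b \<noteq> 0" "\<sigma> \<in> L" for b \<sigma>
    unfolding res_basis_iff_tchain_basis[OF L] using y[OF that(2)] that(1) by (auto simp: tchains_def in_keys_iff)
  show ?thesis
  proof (intro bexI ballI)
    show "p \<in> res_module L t"
    proof (rule res_moduleI)
      fix b assume "lookup p b \<noteq> 0"
      then have "{i. b i = TE} \<in> L" "lookup (y {i. b i = TE}) b \<noteq> 0"
        by (auto simp: lp Const_0 split: if_splits)
      then show "b \<in> res_basis L t" using basis by blast
    qed
    fix \<sigma> assume \<sigma>: "\<sigma> \<in> L"
    show "lookup (constant_part p) \<sigma> = y \<sigma>"
    proof (rule poly_mapping_eqI)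
      fix b show "lookup (lookup (constant_part p) \<sigma>) b = lookup (y \<sigma>) b"
        using basis[OF _ \<sigma>, of b] \<sigma> by (auto simp: lookup_constant_part lp Const_def)
    qed
  qed
qed

text \<open>
  The constant part identifies $F/\mathfrak m F$ with the direct sum of the chain complexes, so
  cycles, boundaries and preimages can be compared degree by degree.
\<close>

lemma homology_mod_res_iso_direct_sum:
  fixes K :: "'m::{finite,linorder} set set"
  assumes K: "simplicial_complex K" and r: "\<And>i. r i > 0"
  defines "L \<equiv> dual_complex K"
  shows "quotient_iso (\<lambda>c. sum_scale (*) (Const c))
      (homology_mod (sum_scale (*)) irrelevant_ideal (res_module L :: int \<Rightarrow> (('m \<Rightarrow> tgen) \<Rightarrow>\<^sub>0 ('m, 'k::field) mpoly) set) (\<lambda>_. res_diff r) t)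
    (sum_scale (sum_scale (*))) (direct_sum L (\<lambda>\<sigma>. thomology L \<sigma> (UNIV - \<sigma>) t)) constant_part"
proof -
  let ?Q = "homology_mod (sum_scale (*)) irrelevant_ideal (res_module L :: int \<Rightarrow> (('m \<Rightarrow> tgen) \<Rightarrow>\<^sub>0 ('m, 'k) mpoly) set) (\<lambda>_. res_diff r) t"
  let ?Q' = "direct_sum L (\<lambda>\<sigma>. thomology L \<sigma> (UNIV - \<sigma>) t) :: ('m set \<Rightarrow>\<^sub>0 (('m \<Rightarrow> tgen) \<Rightarrow>\<^sub>0 'k)) subquotient"
  have L: "simplicial_complex L" unfolding L_def by (rule simplicial_complex_dual[OF K])
  note F = free_resolution_monomial_ideal[OF K, of r, folded L_def, where 'k = 'k]
  note M = module_sum_scale and sub = subspace_res_module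
  let ?cp = "\<lambda>p \<sigma>. lookup (constant_part p) \<sigma>"
  have const0: "(\<forall>b. lookup (lookup p b) 0 = 0) \<longleftrightarrow> (\<forall>\<sigma>\<in>L. ?cp p \<sigma> = 0)"
    if p: "p \<in> res_module L u" for p :: "('m \<Rightarrow> tgen) \<Rightarrow>\<^sub>0 ('m, 'k) mpoly" and u
  proof
    assume "\<forall>b. lookup (lookup p b) 0 = 0"
    then show "\<forall>\<sigma>\<in>L. ?cp p \<sigma> = 0" by (auto intro!: poly_mapping_eqI simp: lookup_constant_part)
  next
    assume a: "\<forall>\<sigma>\<in>L. ?cp p \<sigma> = 0"
    have "?cp p \<sigma> = 0" for \<sigma>
      using a constant_part_in(1)[OF L p] by (cases "\<sigma> \<in> L") (auto simp: in_keys_iff)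
    then have "lookup (?cp p {i. b i = TE}) b = 0" for b by simp
    then show "\<forall>b. lookup (lookup p b) 0 = 0" by (simp add: lookup_constant_part)
  qed
  have Z: "p \<in> fst ?Q \<longleftrightarrow> p \<in> res_module L t \<and> (\<forall>\<sigma>\<in>L. tdiff (?cp p \<sigma>) = 0)" for p
    using const0[OF res_diff_in[OF L, of p t r]] res_diff_in[OF L, of p t r]
    by (auto simp: homology_mod_def homology_def ideal_multiples_res_module constant_part_res_diff[OF r])
  have B: "snd ?Q = res_diff r ` res_module L (t + 1) + {p \<in> res_module L t. \<forall>b. lookup (lookup p b) 0 = 0}"
    by (simp add: homology_mod_def homology_def ideal_multiples_res_module)
  have lin: "constant_part (x + y) = constant_part x + constant_part y" for x y :: "('m \<Rightarrow> tgen) \<Rightarrow>\<^sub>0 ('m, 'k) mpoly"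
    by (rule linear_onD(1)[OF linear_constant_part UNIV_I UNIV_I])
  have SQ': "subquotient_module (sum_scale (sum_scale (*))) ?Q'"
    by (rule subquotient_module_direct_sum[OF M subquotient_module_thomology])
  show ?thesis
  proof (rule quotient_isoI)
    show "subquotient_module (\<lambda>c. sum_scale (*) (Const c)) ?Q"
      by (rule subquotient_module_restrict_scalars[OF subquotient_module_homology_mod[OF F] Const_1 Const_add Const_mult])
    show "subquotient_module (sum_scale (sum_scale (*))) ?Q'" by (fact SQ')
    show "linear_on (\<lambda>c. sum_scale (*) (Const c)) (sum_scale (sum_scale (*))) (fst ?Q) constant_part"
      by (rule linear_constant_part)
    fix p assume p: "p \<in> fst ?Q"
    then have pM: "p \<in> res_module L t" by (simp add: Z)
    show "constant_part p \<in> fst ?Q'"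
      using p constant_part_in[OF L pM] by (auto simp: Z direct_sum_def mem_thomology)
    show "constant_part p \<in> snd ?Q' \<longleftrightarrow> p \<in> snd ?Q"
    proof
      assume "constant_part p \<in> snd ?Q'"
      then have "\<forall>\<sigma>\<in>L. \<exists>y. y \<in> tchains L \<sigma> (UNIV - \<sigma>) (t + 1) \<and> ?cp p \<sigma> = tdiff y"
        by (auto simp: direct_sum_def mem_thomology)
      then obtain y where y: "\<And>\<sigma>. \<sigma> \<in> L \<Longrightarrow> y \<sigma> \<in> tchains L \<sigma> (UNIV - \<sigma>) (t + 1)"
        "\<And>\<sigma>. \<sigma> \<in> L \<Longrightarrow> ?cp p \<sigma> = tdiff (y \<sigma>)" by metis
      obtain q where q: "q \<in> res_module L (t + 1)" "\<And>\<sigma>. \<sigma> \<in> L \<Longrightarrow> ?cp q \<sigma> = y \<sigma>"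
        using constant_part_surj[OF L y(1)] by blast
      let ?w = "p - res_diff r q"
      have w: "?w \<in> res_module L t"
        using module.subspace_diff[OF M sub pM] res_diff_in[OF L q(1)] by simp
      have "constant_part p = constant_part ?w + constant_part (res_diff r q)"
        using lin[of ?w "res_diff r q"] by simp
      then have "?cp ?w \<sigma> = 0" if "\<sigma> \<in> L" for \<sigma>
        using y(2)[OF that] q(2)[OF that] by (simp add: lookup_add constant_part_res_diff[OF r])
      then have "?w \<in> {p \<in> res_module L t. \<forall>b. lookup (lookup p b) 0 = 0}"
        using const0[OF w] w by simp
      from set_plus_intro[OF imageI[OF q(1), of "res_diff r"] this] show "p \<in> snd ?Q" unfolding B by simp
    next
      assume "p \<in> snd ?Q"
      then obtain q w where qw: "q \<in> res_module L (t + 1)" "w \<in> res_module L t"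
        "\<forall>b. lookup (lookup w b) 0 = 0" "p = res_diff r q + w"
        unfolding B by (auto elim!: set_plus_elim)
      have "?cp p \<sigma> = tdiff (?cp q \<sigma>)" if "\<sigma> \<in> L" for \<sigma>
        using const0[OF qw(2)] qw(3) that by (simp add: qw(4) lin lookup_add constant_part_res_diff[OF r])
      then show "constant_part p \<in> snd ?Q'"
        using constant_part_in[OF L pM] constant_part_in[OF L qw(1)] by (auto simp: direct_sum_def mem_thomology)
    qed
  next
    fix y assume y: "y \<in> fst ?Q'"
    then have yc: "lookup y \<sigma> \<in> tchains L \<sigma> (UNIV - \<sigma>) t" "tdiff (lookup y \<sigma>) = 0"
      if "\<sigma> \<in> L" for \<sigma> using that by (auto simp: direct_sum_def mem_thomology)
    obtain p where p: "p \<in> res_module L t" "\<And>\<sigma>. \<sigma> \<in> L \<Longrightarrow> ?cp p \<sigma> = lookup y \<sigma>"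
      using constant_part_surj[OF L yc(1)] by blast
    have "constant_part p = y"
    proof (rule poly_mapping_eqI)
      fix \<sigma> show "?cp p \<sigma> = lookup y \<sigma>"
      proof (cases "\<sigma> \<in> L")
        case False
        then have "\<sigma> \<notin> keys (constant_part p)" "\<sigma> \<notin> keys y"
          using constant_part_in(1)[OF L p(1)] y by (auto simp: direct_sum_def)
        then show ?thesis by (simp add: in_keys_iff)
      qed (fact p(2))
    qed
    moreover have "0 \<in> snd ?Q'"
      using SQ' module.subspace_0 unfolding subquotient_module_def by blast
    ultimately show "\<exists>p\<in>fst ?Q. y - constant_part p \<in> snd ?Q'"
      using p yc by (intro bexI[of _ p]) (auto simp: Z)
  qed
qed

section \<open>Alexander duality\<close>

definition vsign :: "'m::linorder \<Rightarrow> 'm set \<Rightarrow> 'r::comm_ring_1"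
  where "vsign i N = (- 1) ^ card {j \<in> N. j < i}"

lemma vsign_square:
  fixes x :: "'r::comm_ring_1"
  shows "vsign i N * (vsign i N * x) = x"
  by (cases "even (card {j \<in> N. j < i})") (simp_all add: vsign_def)

lemma vsign_remove_less:
  assumes "finite N" "j \<in> N" "j < i"
  shows "vsign i (N - {j}) = (- vsign i N :: 'r::comm_ring_1)"
proof -
  have "{l \<in> N. l < i} = insert j {l \<in> N - {j}. l < i}" using assms by auto
  then show ?thesis using assms by (simp add: vsign_def)
qed

lemma vsign_remove_ge:
  assumes "\<not> j < i"
  shows "vsign i (N - {j}) = vsign i N"
proof -
  have "{l \<in> N - {j}. l < i} = {l \<in> N. l < i}" using assms by auto
  then show ?thesis by (simp add: vsign_def)
qed

lemma vsign_insert_same: "vsign i (insert i N) = vsign i N"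
proof -
  have "{l \<in> insert i N. l < i} = {l \<in> N. l < i}" by auto
  then show ?thesis by (simp add: vsign_def)
qed

lemma vsign_diff:
  assumes "finite \<omega>" "N \<subseteq> \<omega>"
  shows "vsign i \<omega> = (vsign i N * vsign i (\<omega> - N) :: 'r::comm_ring_1)"
proof -
  have "card {j \<in> \<omega>. j < i} = card ({j \<in> N. j < i} \<union> {j \<in> \<omega> - N. j < i})"
    using assms by (intro arg_cong[where f = card]) auto
  also have "\<dots> = card {j \<in> N. j < i} + card {j \<in> \<omega> - N. j < i}"
    using assms finite_subset[OF assms(2,1)] by (intro card_Un_disjoint) auto
  finally show ?thesis by (simp add: vsign_def power_add)
qed

text \<open>
  The coboundary of the full simplex on the vertices, with the functions on faces of all
  dimensions kept together.
\<close>

definition coboundary :: "('m::linorder set \<Rightarrow> 'k::field) \<Rightarrow> 'm set \<Rightarrow> 'k"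
  where "coboundary f N = (\<Sum>i\<in>N. vsign i N * f (N - {i}))"

text \<open>
  The contraction of the full simplex onto its vertex \<open>v\<close>, seen on cochains.
\<close>

definition contraction :: "'m \<Rightarrow> ('m set \<Rightarrow> 'k::field) \<Rightarrow> 'm set \<Rightarrow> 'k"
  where "contraction v f N = (if v \<in> N then 0 else f (insert v N))"

lemma coboundary_cong:
  "(\<And>M. M \<subseteq> N \<Longrightarrow> f M = g M) \<Longrightarrow> coboundary f N = coboundary g N"
  unfolding coboundary_def by (intro sum.cong refl) auto

lemma coboundary_diff: "coboundary (\<lambda>N. f N - g N) N = coboundary f N - coboundary g N"
  and coboundary_uminus: "coboundary (\<lambda>N. - f N) N = - coboundary f N"
  by (simp_all add: coboundary_def right_diff_distrib sum_subtractf sum_negf)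

lemma coboundary_coboundary:
  assumes "finite N"
  shows "coboundary (coboundary f) N = (0 :: 'k::field)"
proof -
  let ?g = "\<lambda>i j. if i = j then 0 else vsign i N * (vsign j (N - {i}) * f (N - {i} - {j}))"
  have "coboundary (coboundary f) N = (\<Sum>i\<in>N. \<Sum>j\<in>N - {i}. ?g i j)"
    unfolding coboundary_def by (auto simp: sum_distrib_left intro!: sum.cong split: if_splits)
  also have "\<dots> = (\<Sum>i\<in>N. \<Sum>j\<in>N. ?g i j)"
    using assms by (intro sum.cong refl sum.mono_neutral_left) auto
  also have "\<dots> = 0"
  proof (rule sum_antisymmetric_eq_0)
    fix i j assume ij: "i \<in> N" "j \<in> N" "i \<noteq> j"
    have "N - {i} - {j} = N - {j} - {i}" by auto
    moreover have "vsign j N * vsign i (N - {j}) = (- (vsign i N * vsign j (N - {i})) :: 'k)"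
      using ij assms by (cases i j rule: linorder_cases) (simp_all add: vsign_remove_less vsign_remove_ge)
    ultimately show "?g j i = - ?g i j" using ij by (simp add: mult.assoc[symmetric])
  qed (use assms in auto)
  finally show ?thesis .
qed

text \<open>
  As \<open>v\<close> is the smallest vertex, adding or removing it carries the sign $+1$ and reverses the
  sign of every other vertex.
\<close>

lemma coboundary_contraction:
  assumes fin: "finite N" and v: "\<And>i. i \<in> N \<Longrightarrow> v \<le> i"
  shows "coboundary (contraction v f) N + contraction v (coboundary f) N = (f N :: 'k::field)"
proof (cases "v \<in> N")
  case True
  have "vsign i N * contraction v f (N - {i}) = (if i = v then f N else 0)" if "i \<in> N" for i
  proof (cases "i = v")
    case True
    have "{j \<in> N. j < v} = {}" using v by (auto simp: not_less)
    then have "vsign v N = (1 :: 'k)" by (simp only: vsign_def card.empty power_0)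
    then show ?thesis using \<open>v \<in> N\<close> True by (simp add: contraction_def insert_absorb)
  qed (use True in \<open>simp add: contraction_def\<close>)
  then have "coboundary (contraction v f) N = f N"
    unfolding coboundary_def using True fin by simp
  then show ?thesis using True by (simp add: contraction_def)
next
  case False
  have "{j \<in> insert v N. j < v} = {}" using v by (auto simp: not_less)
  then have v1: "vsign v (insert v N) = (1 :: 'k)" by (simp only: vsign_def card.empty power_0)
  have *: "vsign i (insert v N) * f (insert v N - {i}) = - (vsign i N * contraction v f (N - {i}))"
    if i: "i \<in> N" for i
  proof -
    have "v < i" using v[OF i] False i by (metis order_le_imp_less_or_eq)
    then have "vsign i (insert v N - {v}) = (- vsign i (insert v N) :: 'k)"
      using fin by (intro vsign_remove_less) auto
    moreover have "insert v N - {v} = N" "insert v N - {i} = insert v (N - {i})"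
      using False \<open>v < i\<close> by auto
    ultimately show ?thesis using False by (simp add: contraction_def)
  qed
  have "contraction v (coboundary f) N = coboundary f (insert v N)" using False by (simp add: contraction_def)
  also have "\<dots> = f N + (\<Sum>i\<in>N. vsign i (insert v N) * f (insert v N - {i}))"
    unfolding coboundary_def using False fin by (simp add: v1)
  also have "\<dots> = f N - coboundary (contraction v f) N"
    by (simp add: * coboundary_def sum_negf)
  finally show ?thesis by simp
qed

text \<open>
  The basis tensor with $\bar{\mathrm n}$ on \<open>N\<close>, $\mathrm n$ on the rest of \<open>\<omega>\<close>, and \<open>a\<close> outside \<open>\<omega>\<close>.
\<close>

definition face_tensor :: "tgen \<Rightarrow> 'm set \<Rightarrow> 'm set \<Rightarrow> 'm \<Rightarrow> tgen"
  where "face_tensor a \<omega> N i = (if i \<in> \<omega> then if i \<in> N then TNbar else TN else a)"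

lemma face_tensor_sets:
  assumes "N \<subseteq> \<omega>" "a = TE \<or> a = TI"
  shows "{i. face_tensor a \<omega> N i = TNbar} = N" "{i. face_tensor a \<omega> N i = TN} = \<omega> - N"
    "{i. face_tensor a \<omega> N i \<in> {TN, TNbar}} = \<omega>"
    "{i. face_tensor a \<omega> N i = TE} = (if a = TE then UNIV - \<omega> else {})"
    "{i. face_tensor a \<omega> N i \<in> {TE, TNbar}} = (if a = TE then (UNIV - \<omega>) \<union> N else N)"
    "tdeg (face_tensor a \<omega> N) = int (card N)"
proof -
  show "{i. face_tensor a \<omega> N i = TNbar} = N" using assms by (auto simp: face_tensor_def)
  then show "tdeg (face_tensor a \<omega> N) = int (card N)" by (simp add: tdeg_def)
qed (use assms in \<open>auto simp: face_tensor_def split: if_splits\<close>)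

lemma face_tensor_inj:
  fixes N :: "'m::finite set"
  assumes "N \<subseteq> \<omega>" "M \<subseteq> \<omega>" "a = TE \<or> a = TI" "face_tensor a \<omega> N = face_tensor a \<omega> M"
  shows "N = M"
proof -
  have "N = {i. face_tensor a \<omega> N i = TNbar}" by (rule face_tensor_sets(1)[OF assms(1,3), symmetric])
  also have "\<dots> = M" unfolding assms(4) by (rule face_tensor_sets(1)[OF assms(2,3)])
  finally show ?thesis .
qed

lemma face_tensor_unique:
  assumes "{i. b i \<in> {TN, TNbar}} = \<omega>" "\<And>i. i \<notin> \<omega> \<Longrightarrow> b i = a"
  shows "b = face_tensor a \<omega> {i. b i = TNbar}"
proof
  fix i show "b i = face_tensor a \<omega> {i. b i = TNbar} i"
    using assms by (cases "i \<in> \<omega>") (auto simp: face_tensor_def)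
qed

lemma face_tensor_upd:
  assumes "i \<in> \<omega>"
  shows "(face_tensor a \<omega> N)(i := TNbar) = face_tensor a \<omega> (insert i N)"
  using assms by (auto simp: face_tensor_def)

lemma lookup_tdiff_face_tensor:
  fixes p :: "('m::{finite,linorder} \<Rightarrow> tgen) \<Rightarrow>\<^sub>0 'k::field"
  assumes "N \<subseteq> \<omega>" "a = TE \<or> a = TI"
  shows "lookup (tdiff p) (face_tensor a \<omega> N) =
    (\<Sum>i\<in>\<omega> - N. vsign i N * lookup p (face_tensor a \<omega> (insert i N)))"
proof -
  have "tsign i (face_tensor a \<omega> N) = (vsign i N :: 'k)" for i
  proof -
    have "{j. j < i \<and> face_tensor a \<omega> N j = TNbar} = {j \<in> N. j < i}"
      using face_tensor_sets(1)[OF assms] by blast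
    then show ?thesis by (simp add: tsign_def vsign_def)
  qed
  then show ?thesis
    unfolding lookup_tdiff face_tensor_sets(2)[OF assms]
    by (intro sum.cong refl) (simp add: face_tensor_upd)
qed

lemma tdiff_in_tchains:
  assumes K: "simplicial_complex K" and p: "p \<in> tchains K \<sigma> \<omega> t"
  shows "tdiff p \<in> tchains K \<sigma> \<omega> (t - 1)"
  unfolding tchains_def
proof (rule CollectI, rule subsetI)
  fix b assume "b \<in> keys (tdiff p)"
  then have "(\<Sum>i | b i = TN. tsign i b * lookup p (b(i := TNbar))) \<noteq> 0"
    unfolding in_keys_iff lookup_tdiff .
  then obtain i where bi: "b i = TN" and "tsign i b * lookup p (b(i := TNbar)) \<noteq> 0"
    using sum.not_neutral_contains_not_neutral by blast
  then have "b(i := TNbar) \<in> keys p" by (auto simp: in_keys_iff)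
  then have b: "b(i := TNbar) \<in> tbasis K" "{j. (b(i := TNbar)) j = TE} = \<sigma>"
    "{j. (b(i := TNbar)) j \<in> {TN, TNbar}} = \<omega>" "tdeg (b(i := TNbar)) = t"
    using p unfolding tchains_def by blast+
  have "{j. b j \<in> {TE, TNbar}} \<subseteq> {j. (b(i := TNbar)) j \<in> {TE, TNbar}}" by auto
  then have "b \<in> tbasis K"
    using b(1) K unfolding tbasis_iff[OF K] by (auto simp: simplicial_complex_def)
  moreover have "{j. b j = TE} = {j. (b(i := TNbar)) j = TE}"
    "{j. b j \<in> {TN, TNbar}} = {j. (b(i := TNbar)) j \<in> {TN, TNbar}}" using bi by auto
  moreover have "tdeg b = t - 1" using b(4) tdeg_upd[of b i] bi by simp
  ultimately show "b \<in> {b \<in> tbasis K. {i. b i = TE} = \<sigma> \<and> {i. b i \<in> {TN, TNbar}} = \<omega> \<and> tdeg b = t - 1}"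
    using b by simp
qed

lemma module_fun_scale: "module (fun_scale :: 'k::comm_ring_1 \<Rightarrow> ('v \<Rightarrow> 'k) \<Rightarrow> _)"
  by unfold_locales (auto simp: fun_scale_def plus_fun_def algebra_simps)

lemma subspace_tcochains: "module.subspace fun_scale (tcochains K \<sigma> \<omega> t)"
  by (rule module.subspaceI[OF module_fun_scale])
    (auto simp: tcochains_def linear_on_def fun_scale_def plus_fun_def zero_fun_def algebra_simps)

lemma linear_tcodiff: "linear_on fun_scale fun_scale A (tcodiff K \<sigma> \<omega> t)"
  by (rule linear_onI) (auto simp: tcodiff_def fun_scale_def plus_fun_def)

lemma subquotient_module_tcohomology: "subquotient_module fun_scale (tcohomology K \<sigma> \<omega> t)"
proof -
  note M = module_fun_scale
  show ?thesis
    unfolding tcohomology_def homology_def subquotient_module_def fst_conv snd_conv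
    by (intro conjI M subspace_linear_preimage_on[OF M M subspace_tcochains linear_tcodiff]
        subspace_set_plus[OF M] subspace_linear_image[OF M M subspace_tcochains linear_tcodiff]
        module.subspace_single_0[OF M])
qed

lemma mem_tcohomology:
  "f \<in> fst (tcohomology K \<sigma> \<omega> t) \<longleftrightarrow> f \<in> tcochains K \<sigma> \<omega> t \<and> tcodiff K \<sigma> \<omega> t f = 0"
  "f \<in> snd (tcohomology K \<sigma> \<omega> t) \<longleftrightarrow> f \<in> tcodiff K \<sigma> \<omega> (t - 1) ` tcochains K \<sigma> \<omega> (t - 1)"
  by (auto simp: tcohomology_def homology_def set_plus_def)

context
  fixes K :: "'m::{finite,linorder} set set" and \<omega> :: "'m set"
  assumes K: "simplicial_complex K"
begin

definition faces :: "int \<Rightarrow> 'm set set"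
  where "faces u = {N. N \<subseteq> \<omega> \<and> N \<in> K \<and> int (card N) = u}"

lemma tchains_full_subcomplex_basis:
  "b \<in> tbasis K \<and> {i. b i = TE} = {} \<and> {i. b i \<in> {TN, TNbar}} = \<omega> \<and> tdeg b = u \<longleftrightarrow>
    (\<exists>N\<in>faces u. b = face_tensor TI \<omega> N)"
proof
  assume b: "b \<in> tbasis K \<and> {i. b i = TE} = {} \<and> {i. b i \<in> {TN, TNbar}} = \<omega> \<and> tdeg b = u"
  let ?N = "{i. b i = TNbar}"
  have "b i = TI" if "i \<notin> \<omega>" for i using b that by (cases "b i") auto
  then have eq: "b = face_tensor TI \<omega> ?N" using b by (intro face_tensor_unique) auto
  have "?N \<subseteq> {i. b i \<in> {TE, TNbar}}" by auto
  then have "?N \<in> K" using b K unfolding tbasis_iff[OF K] simplicial_complex_def by blast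
  moreover have "?N \<subseteq> \<omega>" using b by auto
  ultimately have "?N \<in> faces u" using b by (simp add: faces_def tdeg_def)
  then show "\<exists>N\<in>faces u. b = face_tensor TI \<omega> N" using eq by blast
next
  assume "\<exists>N\<in>faces u. b = face_tensor TI \<omega> N"
  then obtain N where "N \<subseteq> \<omega>" "N \<in> K" "int (card N) = u" "b = face_tensor TI \<omega> N"
    by (auto simp: faces_def)
  then show "b \<in> tbasis K \<and> {i. b i = TE} = {} \<and> {i. b i \<in> {TN, TNbar}} = \<omega> \<and> tdeg b = u"
    unfolding tbasis_iff[OF K] by (simp add: face_tensor_sets del: insert_iff)
qed

lemma mem_tchains_full_subcomplex:
  "p \<in> tchains K {} \<omega> u \<longleftrightarrow> keys p \<subseteq> face_tensor TI \<omega> ` faces u"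
proof -
  have "{b \<in> tbasis K. {i. b i = TE} = {} \<and> {i. b i \<in> {TN, TNbar}} = \<omega> \<and> tdeg b = u} = {b. \<exists>N\<in>faces u. b = face_tensor TI \<omega> N}"
    by (intro Collect_cong tchains_full_subcomplex_basis)
  also have "\<dots> = face_tensor TI \<omega> ` faces u" unfolding image_def by blast
  finally show ?thesis unfolding tchains_def by simp
qed

text \<open>
  The tensor for \<open>M\<close> is admitted if $([m] \setminus \omega) \cup M$ is a face of the dual complex, and its
  complement is $\omega \setminus M$.
\<close>

lemma mem_tchains_dual:
  "p \<in> tchains (dual_complex K) (UNIV - \<omega>) \<omega> t \<longleftrightarrow>
    keys p \<subseteq> face_tensor TE \<omega> ` {M. M \<subseteq> \<omega> \<and> \<omega> - M \<notin> K \<and> int (card M) = t}"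
proof -
  have "b \<in> tbasis (dual_complex K) \<and> {i. b i = TE} = UNIV - \<omega> \<and> {i. b i \<in> {TN, TNbar}} = \<omega> \<and> tdeg b = t \<longleftrightarrow>
    (\<exists>M. M \<subseteq> \<omega> \<and> \<omega> - M \<notin> K \<and> int (card M) = t \<and> b = face_tensor TE \<omega> M)" for b
  proof
    assume b: "b \<in> tbasis (dual_complex K) \<and> {i. b i = TE} = UNIV - \<omega> \<and> {i. b i \<in> {TN, TNbar}} = \<omega> \<and> tdeg b = t"
    let ?M = "{i. b i = TNbar}"
    have eq: "b = face_tensor TE \<omega> ?M" using b by (intro face_tensor_unique) auto
    have "UNIV - {i. b i \<in> {TE, TNbar}} = \<omega> - ?M" using b by auto
    then have "\<omega> - ?M \<notin> K"
      using b unfolding tbasis_iff[OF simplicial_complex_dual[OF K]] mem_dual_complex_iff by simp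
    moreover have "?M \<subseteq> \<omega>" using b by auto
    ultimately show "\<exists>M. M \<subseteq> \<omega> \<and> \<omega> - M \<notin> K \<and> int (card M) = t \<and> b = face_tensor TE \<omega> M"
      using b eq by (intro exI[of _ ?M]) (simp add: tdeg_def)
  next
    assume "\<exists>M. M \<subseteq> \<omega> \<and> \<omega> - M \<notin> K \<and> int (card M) = t \<and> b = face_tensor TE \<omega> M"
    then obtain M where M: "M \<subseteq> \<omega>" "\<omega> - M \<notin> K" "int (card M) = t" "b = face_tensor TE \<omega> M" by blast
    have "UNIV - ((UNIV - \<omega>) \<union> M) = \<omega> - M" by auto
    then show "b \<in> tbasis (dual_complex K) \<and> {i. b i = TE} = UNIV - \<omega> \<and> {i. b i \<in> {TN, TNbar}} = \<omega> \<and> tdeg b = t"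
      using M unfolding tbasis_iff[OF simplicial_complex_dual[OF K]] mem_dual_complex_iff
      by (simp add: face_tensor_sets del: insert_iff)
  qed
  then have "{b \<in> tbasis (dual_complex K). {i. b i = TE} = UNIV - \<omega> \<and> {i. b i \<in> {TN, TNbar}} = \<omega> \<and> tdeg b = t}
      = {b. \<exists>M. M \<subseteq> \<omega> \<and> \<omega> - M \<notin> K \<and> int (card M) = t \<and> b = face_tensor TE \<omega> M}"
    by (intro Collect_cong)
  also have "\<dots> = face_tensor TE \<omega> ` {M. M \<subseteq> \<omega> \<and> \<omega> - M \<notin> K \<and> int (card M) = t}"
    unfolding image_def by blast
  finally show ?thesis unfolding tchains_def by simp
qed

text \<open>
  The functional whose value on the face \<open>N\<close> is \<open>g N\<close>.
\<close>

definition cochain_of :: "int \<Rightarrow> ('m set \<Rightarrow> 'k::field) \<Rightarrow> (('m \<Rightarrow> tgen) \<Rightarrow>\<^sub>0 'k) \<Rightarrow> 'k"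
  where "cochain_of u g p = (if p \<in> tchains K {} \<omega> u
    then \<Sum>N\<in>faces u. lookup p (face_tensor TI \<omega> N) * g N else 0)"

lemma inj_face_tensor: "inj_on (face_tensor TI \<omega>) (faces u)"
proof (rule inj_onI)
  fix N M assume "N \<in> faces u" "M \<in> faces u" "face_tensor TI \<omega> N = face_tensor TI \<omega> M"
  then show "N = M" by (intro face_tensor_inj[of N \<omega> M TI]) (simp_all add: faces_def)
qed

lemma cochain_of_in: "cochain_of u g \<in> tcochains K {} \<omega> u"
proof -
  note M = module_sum_scale
  have "linear_on (sum_scale (*)) (*) (tchains K {} \<omega> u) (cochain_of u g)"
    by (rule linear_onI)
      (simp_all add: cochain_of_def module.subspace_add[OF M subspace_tchains]
        module.subspace_scale[OF M subspace_tchains] lookup_add lookup_sum_scale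
        distrib_right sum.distrib sum_distrib_left mult.assoc)
  then show ?thesis by (simp add: tcochains_def cochain_of_def)
qed

lemma face_in_tchains: "N \<in> faces u \<Longrightarrow> single (face_tensor TI \<omega> N) (1::'k::field) \<in> tchains K {} \<omega> u"
  by (simp add: mem_tchains_full_subcomplex)

lemma cochain_of_face:
  assumes "N \<in> faces u"
  shows "cochain_of u g (single (face_tensor TI \<omega> N) 1) = g N"
proof -
  have "cochain_of u g (single (face_tensor TI \<omega> N) 1) =
      (\<Sum>M\<in>faces u. lookup (single (face_tensor TI \<omega> N) 1) (face_tensor TI \<omega> M) * g M)"
    by (simp add: cochain_of_def face_in_tchains[OF assms])
  also have "\<dots> = (\<Sum>M\<in>faces u. if M = N then g N else 0)"
    using inj_onD[OF inj_face_tensor _ assms] by (intro sum.cong refl) (auto simp: lookup_single when_def)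
  also have "\<dots> = g N" using assms by simp
  finally show ?thesis .
qed

lemma cochain_of_eq_iff: "cochain_of u g = cochain_of u g' \<longleftrightarrow> (\<forall>N\<in>faces u. g N = g' N)"
proof
  assume "cochain_of u g = cochain_of u g'"
  then show "\<forall>N\<in>faces u. g N = g' N" using cochain_of_face by metis
next
  assume "\<forall>N\<in>faces u. g N = g' N"
  then show "cochain_of u g = cochain_of u g'" by (auto simp: cochain_of_def fun_eq_iff)
qed

lemma cochain_of_surj:
  fixes f :: "(('m \<Rightarrow> tgen) \<Rightarrow>\<^sub>0 'k::field) \<Rightarrow> 'k"
  assumes f: "f \<in> tcochains K {} \<omega> u"
  shows "f = cochain_of u (\<lambda>N. f (single (face_tensor TI \<omega> N) 1))"
proof
  fix p :: "('m \<Rightarrow> tgen) \<Rightarrow>\<^sub>0 'k"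
  let ?s = "\<lambda>N. single (face_tensor TI \<omega> N) (1::'k)"
  let ?l = "\<lambda>N. lookup p (face_tensor TI \<omega> N)"
  note M = module_sum_scale and sub = subspace_tchains
  have lin: "linear_on (sum_scale (*)) (*) (tchains K {} \<omega> u) f" using f by (simp add: tcochains_def)
  show "f p = cochain_of u (\<lambda>N. f (?s N)) p"
  proof (cases "p \<in> tchains K {} \<omega> u")
    case True
    have "p = (\<Sum>N\<in>faces u. sum_scale (*) (?l N) (?s N))"
    proof (rule poly_mapping_eqI)
      fix b
      have "lookup (\<Sum>N\<in>faces u. sum_scale (*) (?l N) (?s N)) b =
          (\<Sum>N\<in>faces u. if face_tensor TI \<omega> N = b then ?l N else 0)"
        by (simp add: lookup_sum lookup_sum_scale lookup_single when_def if_distrib cong: if_cong)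
      also have "\<dots> = lookup p b"
      proof (cases "b \<in> face_tensor TI \<omega> ` faces u")
        case True
        then obtain N where N: "N \<in> faces u" "b = face_tensor TI \<omega> N" by blast
        have "(\<Sum>M\<in>faces u. if face_tensor TI \<omega> M = b then ?l M else 0) = (\<Sum>M\<in>faces u. if M = N then ?l N else 0)"
          using inj_onD[OF inj_face_tensor _ _ N(1)] N(2) by (intro sum.cong refl) auto
        then show ?thesis using N by simp
      next
        case False
        then have "lookup p b = 0"
          using True unfolding mem_tchains_full_subcomplex by (auto simp: in_keys_iff)
        moreover have "(\<Sum>M\<in>faces u. if face_tensor TI \<omega> M = b then ?l M else 0) = 0"
          using False by (intro sum.neutral) auto
        ultimately show ?thesis by simp
      qed
      finally show "lookup p b = lookup (\<Sum>N\<in>faces u. sum_scale (*) (?l N) (?s N)) b" by simp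
    qed
    then have "f p = f (\<Sum>N\<in>faces u. sum_scale (*) (?l N) (?s N))" by simp
    also have "\<dots> = (\<Sum>N\<in>faces u. f (sum_scale (*) (?l N) (?s N)))"
      by (rule linear_on_sum[OF M module_times sub lin])
        (intro module.subspace_scale[OF M sub] face_in_tchains)
    also have "\<dots> = (\<Sum>N\<in>faces u. ?l N * f (?s N))"
      by (intro sum.cong refl linear_onD(2)[OF lin] face_in_tchains)
    finally show ?thesis using True by (simp add: cochain_of_def)
  next
    case False
    then show ?thesis using f by (simp add: tcochains_def cochain_of_def)
  qed
qed

text \<open>
  Both sides are sums over the pairs of a face and a codimension-one face of it. The pairs
  \<open>(N, i)\<close> for which \<open>insert i N\<close> is not in \<open>K\<close> contribute nothing, since the chain vanishes there.
\<close>

lemma tcodiff_cochain_of: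
  fixes g :: "'m set \<Rightarrow> 'k::field"
  shows "tcodiff K {} \<omega> u (cochain_of u g) = cochain_of (u + 1) (coboundary g)"
proof
  fix p :: "('m \<Rightarrow> tgen) \<Rightarrow>\<^sub>0 'k"
  show "tcodiff K {} \<omega> u (cochain_of u g) p = cochain_of (u + 1) (coboundary g) p"
  proof (cases "p \<in> tchains K {} \<omega> (u + 1)")
    case True
    let ?l = "\<lambda>N. lookup p (face_tensor TI \<omega> N)"
    let ?A = "Sigma (faces u) (\<lambda>N. \<omega> - N)" and ?B = "Sigma (faces (u + 1)) (\<lambda>N. N)"
    have l0: "?l N = 0" if "N \<subseteq> \<omega>" "N \<notin> faces (u + 1)" for N
    proof (rule ccontr)
      assume "?l N \<noteq> 0"
      then obtain M where M: "M \<in> faces (u + 1)" "face_tensor TI \<omega> N = face_tensor TI \<omega> M"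
        using True unfolding mem_tchains_full_subcomplex by (auto simp: in_keys_iff)
      then have "N = M" using that(1) by (intro face_tensor_inj[of N \<omega> M TI]) (simp_all add: faces_def)
      then show False using M that by simp
    qed
    have "tdiff p \<in> tchains K {} \<omega> u" using tdiff_in_tchains[OF K True] by simp
    then have "tcodiff K {} \<omega> u (cochain_of u g) p =
        (\<Sum>N\<in>faces u. (\<Sum>i\<in>\<omega> - N. vsign i N * ?l (insert i N)) * g N)"
      using True unfolding tcodiff_def cochain_of_def
      by (auto intro!: sum.cong simp: lookup_tdiff_face_tensor faces_def)
    also have "\<dots> = (\<Sum>(N, i)\<in>?A. vsign i N * ?l (insert i N) * g N)"
      unfolding sum_distrib_right by (subst sum.Sigma) auto
    also have "\<dots> = (\<Sum>(N, i)\<in>{(N, i) \<in> ?A. insert i N \<in> K}. vsign i N * ?l (insert i N) * g N)"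
    proof (rule sum.mono_neutral_right)
      show "\<forall>x\<in>?A - {(N, i) \<in> ?A. insert i N \<in> K}. (case x of (N, i) \<Rightarrow> vsign i N * ?l (insert i N) * g N) = 0"
      proof
        fix x assume "x \<in> ?A - {(N, i) \<in> ?A. insert i N \<in> K}"
        then obtain N i where x: "x = (N, i)" "insert i N \<subseteq> \<omega>" "insert i N \<notin> faces (u + 1)"
          by (auto simp: faces_def)
        from l0[OF x(2,3)] show "(case x of (N, i) \<Rightarrow> vsign i N * ?l (insert i N) * g N) = 0" by (simp add: x(1))
      qed
    qed auto
    also have "\<dots> = (\<Sum>(N, i)\<in>?B. ?l N * (vsign i N * g (N - {i})))"
    proof (rule sum.reindex_bij_witness[of _ "\<lambda>(N, i). (N - {i}, i)" "\<lambda>(N, i). (insert i N, i)"])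
      fix x assume "x \<in> ?B"
      then obtain N i where x: "x = (N, i)" "N \<in> faces (u + 1)" "i \<in> N" by auto
      have "card N = Suc (card (N - {i}))" using x(3) card_Suc_Diff1[of N i] by simp
      moreover have "N - {i} \<in> K" using x(2) K unfolding faces_def simplicial_complex_def by blast
      ultimately show "(case x of (N, i) \<Rightarrow> (N - {i}, i)) \<in> {(N, i) \<in> ?A. insert i N \<in> K}"
        using x by (auto simp: faces_def insert_absorb)
    next
      fix x assume "x \<in> {(N, i) \<in> ?A. insert i N \<in> K}"
      then obtain N i where x: "x = (N, i)" "N \<in> faces u" "i \<in> \<omega> - N" "insert i N \<in> K" by auto
      show "(case x of (N, i) \<Rightarrow> (insert i N, i)) \<in> ?B"
        using x by (auto simp: faces_def)
      show "(case case x of (N, i) \<Rightarrow> (insert i N, i) of (N, i) \<Rightarrow> ?l N * (vsign i N * g (N - {i}))) =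
          (case x of (N, i) \<Rightarrow> vsign i N * ?l (insert i N) * g N)"
        using x by (simp add: vsign_insert_same mult_ac)
    qed auto
    also have "\<dots> = (\<Sum>N\<in>faces (u + 1). \<Sum>i\<in>N. ?l N * (vsign i N * g (N - {i})))"
      by (subst sum.Sigma) auto
    also have "\<dots> = cochain_of (u + 1) (coboundary g) p"
      using True by (simp add: cochain_of_def coboundary_def sum_distrib_left)
    finally show ?thesis .
  qed (simp add: tcodiff_def cochain_of_def)
qed

text \<open>
  The sign of \<open>N\<close> in the duality between chains and cochains; it is chosen so that passing to
  complements turns the boundary into the coboundary without further signs.
\<close>

definition orientation :: "'m set \<Rightarrow> 'r::comm_ring_1"
  where "orientation N = (\<Prod>i\<in>N. vsign i \<omega>)"

lemma orientation_square:
  fixes x :: "'r::comm_ring_1"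
  shows "orientation N * (orientation N * x) = x"
proof -
  have "orientation N * orientation N = (\<Prod>i\<in>N. vsign i \<omega> * vsign i \<omega> :: 'r)"
    by (simp add: orientation_def prod.distrib)
  also have "\<dots> = 1" using vsign_square[of _ \<omega> "1 :: 'r"] by simp
  finally show ?thesis by (simp add: mult.assoc[symmetric])
qed

text \<open>
  Passing to complements makes a chain of the dual complex a cochain of the full simplex on \<open>\<omega>\<close>
  that vanishes on \<open>K\<close>.
\<close>

definition dual_function :: "(('m \<Rightarrow> tgen) \<Rightarrow>\<^sub>0 'k::field) \<Rightarrow> 'm set \<Rightarrow> 'k"
  where "dual_function z N = orientation N * lookup z (face_tensor TE \<omega> (\<omega> - N))"

definition dual_chain :: "('m set \<Rightarrow> 'k::field) \<Rightarrow> (('m \<Rightarrow> tgen) \<Rightarrow>\<^sub>0 'k)"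
  where "dual_chain f = Abs_poly_mapping (\<lambda>b. let M = {i. b i = TNbar} in
    if M \<subseteq> \<omega> \<and> b = face_tensor TE \<omega> M then orientation (\<omega> - M) * f (\<omega> - M) else 0)"

text \<open>
  The sign of a vertex in \<open>\<omega>\<close> is the product of its signs in \<open>N\<close> and in the
  complement of \<open>N\<close>.
\<close>

lemma dual_function_tdiff:
  fixes z :: "('m \<Rightarrow> tgen) \<Rightarrow>\<^sub>0 'k::field"
  assumes N: "N \<subseteq> \<omega>"
  shows "dual_function (tdiff z) N = coboundary (dual_function z) N"
proof -
  have "\<omega> - (\<omega> - N) = N" using N by auto
  then have "dual_function (tdiff z) N = (\<Sum>i\<in>N. orientation N * (vsign i (\<omega> - N) * lookup z (face_tensor TE \<omega> (insert i (\<omega> - N)))))"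
    unfolding dual_function_def by (subst lookup_tdiff_face_tensor) (auto simp: sum_distrib_left)
  also have "\<dots> = (\<Sum>i\<in>N. vsign i N * dual_function z (N - {i}))"
  proof (rule sum.cong[OF refl])
    fix i assume i: "i \<in> N"
    then have e: "insert i (\<omega> - N) = \<omega> - (N - {i})" using N by auto
    have "orientation N = (vsign i \<omega> * orientation (N - {i}) :: 'k)"
      unfolding orientation_def using i by (intro prod.remove) auto
    also have "vsign i \<omega> = (vsign i N * vsign i (\<omega> - N) :: 'k)"
      by (rule vsign_diff) (use N in auto)
    finally have o: "orientation N = (vsign i N * vsign i (\<omega> - N) * orientation (N - {i}) :: 'k)" .
    show "orientation N * (vsign i (\<omega> - N) * lookup z (face_tensor TE \<omega> (insert i (\<omega> - N)))) =
        vsign i N * dual_function z (N - {i})"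
      unfolding dual_function_def e o by (simp add: mult_ac vsign_square)
  qed
  finally show ?thesis by (simp add: coboundary_def)
qed

lemma dual_function_dual_chain:
  assumes "N \<subseteq> \<omega>"
  shows "dual_function (dual_chain f) N = f N"
proof -
  have "\<omega> - (\<omega> - N) = N" using assms by auto
  then show ?thesis
    by (simp add: dual_function_def dual_chain_def face_tensor_sets(1)[of "\<omega> - N" \<omega> TE] Let_def orientation_square)
qed

lemma dual_function_eq_0:
  assumes z: "z \<in> tchains (dual_complex K) (UNIV - \<omega>) \<omega> t" and N: "N \<subseteq> \<omega>"
    and "N \<in> K \<or> int (card N) \<noteq> int (card \<omega>) - t"
  shows "dual_function z N = 0"
proof (rule ccontr)
  assume "dual_function z N \<noteq> 0"
  then have "face_tensor TE \<omega> (\<omega> - N) \<in> keys z" by (auto simp: dual_function_def in_keys_iff)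
  then obtain M where M: "M \<subseteq> \<omega>" "\<omega> - M \<notin> K" "int (card M) = t" "face_tensor TE \<omega> (\<omega> - N) = face_tensor TE \<omega> M"
    using z unfolding mem_tchains_dual by auto
  have "\<omega> - N = M" using M(1,4) by (intro face_tensor_inj[of _ \<omega> _ TE]) simp_all
  then have "N = \<omega> - M" using N by auto
  moreover have "card (\<omega> - M) = card \<omega> - card M" "card M \<le> card \<omega>"
    using M(1) by (auto intro: card_Diff_subset card_mono finite_subset)
  ultimately show False using M assms(3) by auto
qed

lemma dual_function_inj:
  assumes z: "z \<in> tchains (dual_complex K) (UNIV - \<omega>) \<omega> t" and 0: "\<And>N. N \<subseteq> \<omega> \<Longrightarrow> dual_function z N = 0"
  shows "z = 0"
proof (rule poly_mapping_eqI, rule ccontr)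
  fix b assume b: "lookup z b \<noteq> lookup 0 b"
  then obtain M where M: "M \<subseteq> \<omega>" "b = face_tensor TE \<omega> M"
    using z unfolding mem_tchains_dual by (auto simp: in_keys_iff)
  have "\<omega> - (\<omega> - M) = M" using M by auto
  then have "orientation (\<omega> - M) * (orientation (\<omega> - M) * lookup z b) = 0"
    using 0[of "\<omega> - M"] M by (simp add: dual_function_def)
  then show False using b unfolding orientation_square by simp
qed

lemma dual_chain_in:
  assumes f: "\<And>N. N \<subseteq> \<omega> \<Longrightarrow> N \<in> K \<or> int (card N) \<noteq> int (card \<omega>) - t \<Longrightarrow> f N = 0"
  shows "dual_chain f \<in> tchains (dual_complex K) (UNIV - \<omega>) \<omega> t"
  unfolding mem_tchains_dual
proof
  fix b assume "b \<in> keys (dual_chain f)"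
  then have b: "{i. b i = TNbar} \<subseteq> \<omega>" "b = face_tensor TE \<omega> {i. b i = TNbar}" "f (\<omega> - {i. b i = TNbar}) \<noteq> 0"
    by (auto simp: dual_chain_def in_keys_iff Let_def split: if_splits)
  let ?M = "{i. b i = TNbar}"
  have "\<omega> - ?M \<notin> K" "int (card (\<omega> - ?M)) = int (card \<omega>) - t" using f[of "\<omega> - ?M"] b(3) by auto
  moreover have "card (\<omega> - ?M) = card \<omega> - card ?M" "card ?M \<le> card \<omega>"
    using b(1) by (auto intro: card_Diff_subset card_mono finite_subset)
  ultimately have "?M \<in> {M. M \<subseteq> \<omega> \<and> \<omega> - M \<notin> K \<and> int (card M) = t}" using b(1) by auto
  then show "b \<in> face_tensor TE \<omega> ` {M. M \<subseteq> \<omega> \<and> \<omega> - M \<notin> K \<and> int (card M) = t}" using b(2) by blast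
qed

text \<open>
  Let \<open>Z\<close> be the relative cocycle that corresponds to the cycle \<open>z\<close>. On the full simplex \<open>Z\<close> is the
  coboundary of its contraction, so the restriction of the contraction to \<open>K\<close> is a cocycle of \<open>K\<close>;
  this is the inverse of the connecting homomorphism of the pair, written on cochains. If \<open>Z\<close> is the
  coboundary of a relative cochain \<open>Y\<close>, the homotopy formula shows that the image is the coboundary
  of minus the contraction of \<open>Y\<close>. If the image is the coboundary of \<open>g\<close>, with \<open>g\<close> extended by 0,
  the contraction of \<open>Z\<close> minus the coboundary of \<open>g\<close> is a relative cochain with coboundary \<open>Z\<close>.
  A cocycle \<open>g\<close> of \<open>K\<close>, extended by 0, is the image of the chain that corresponds to its coboundary.
\<close>

lemma alexander_duality:
  assumes \<omega>: "\<omega> \<noteq> {}"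
  defines "v \<equiv> Min \<omega>" and "u t \<equiv> int (card \<omega>) - t - 1"
  shows "quotient_iso (sum_scale (*)) (thomology (dual_complex K) (UNIV - \<omega>) \<omega> t :: (('m \<Rightarrow> tgen) \<Rightarrow>\<^sub>0 'k::field) subquotient)
    fun_scale (tcohomology K {} \<omega> (u t))
    (\<lambda>z. cochain_of (u t) (contraction v (dual_function z)))"
proof -
  let ?L = "dual_complex K" and ?\<sigma> = "UNIV - \<omega>"
  let ?Q = "thomology ?L ?\<sigma> \<omega> t :: (('m \<Rightarrow> tgen) \<Rightarrow>\<^sub>0 'k) subquotient" and ?Q' = "tcohomology K {} \<omega> (u t)"
  let ?c = "\<lambda>z. cochain_of (u t) (contraction v (dual_function z))"
  note M = module_sum_scale and sub = subspace_tchains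
  have vw: "v \<in> \<omega>" "\<And>i. i \<in> \<omega> \<Longrightarrow> v \<le> i" using \<omega> by (auto simp: v_def)
  have homotopy: "coboundary (contraction v f) N + contraction v (coboundary f) N = f N"
    if "N \<subseteq> \<omega>" for N and f :: "'m set \<Rightarrow> 'k"
    by (rule coboundary_contraction) (use that vw in auto)
  have tt: "u t + 1 = int (card \<omega>) - t" "u t - 1 + 1 = u t" "u t = int (card \<omega>) - (t + 1)" by (auto simp: u_def)
  have contr_cong: "contraction v f N = contraction v g N" if "\<And>M. M \<subseteq> \<omega> \<Longrightarrow> f M = g M" "N \<subseteq> \<omega>"
    for N and f g :: "'m set \<Rightarrow> 'k" using that vw(1) by (simp add: contraction_def)
  have cob_cong: "coboundary f N = coboundary g N" if "\<And>M. M \<subseteq> \<omega> \<Longrightarrow> f M = g M" "N \<subseteq> \<omega>"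
    for N and f g :: "'m set \<Rightarrow> 'k" using that by (intro coboundary_cong) auto
  have tdiff_tchains: "tdiff z \<in> tchains ?L ?\<sigma> \<omega> t" if "z \<in> tchains ?L ?\<sigma> \<omega> (t + 1)" for z t
    using tdiff_in_tchains[OF simplicial_complex_dual[OF K] that] by simp
  have extend: "\<exists>g'. cochain_of w g = cochain_of w g' \<and> (\<forall>N. N \<notin> faces w \<longrightarrow> g' N = 0)" for w and g :: "'m set \<Rightarrow> 'k"
    by (rule exI[of _ "\<lambda>N. if N \<in> faces w then g N else 0"]) (simp add: cochain_of_eq_iff)
  have cob_card: "coboundary g N = 0"
    if g: "\<And>N. N \<notin> faces w \<Longrightarrow> g N = 0" and N: "int (card N) \<noteq> w + 1" for w N and g :: "'m set \<Rightarrow> 'k"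
    unfolding coboundary_def
  proof (intro sum.neutral ballI)
    fix i assume "i \<in> N"
    then have "card N = Suc (card (N - {i}))" using card_Suc_Diff1[of N i] by simp
    then have "N - {i} \<notin> faces w" using N by (auto simp: faces_def)
    then show "vsign i N * g (N - {i}) = 0" by (simp add: g)
  qed
  show ?thesis
  proof (rule quotient_isoI)
    show "subquotient_module (sum_scale (*)) ?Q" by (rule subquotient_module_thomology)
    show "subquotient_module fun_scale ?Q'" by (rule subquotient_module_tcohomology)
    show "linear_on (sum_scale (*)) fun_scale (fst ?Q) ?c"
    proof (rule linear_onI; rule ext)
      fix x y p
      have "contraction v (dual_function (x + y)) N = contraction v (dual_function x) N + contraction v (dual_function y) N" for N
        by (simp add: contraction_def dual_function_def lookup_add distrib_left)
      then show "?c (x + y) p = (?c x + ?c y) p"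
        by (simp add: cochain_of_def plus_fun_def distrib_left sum.distrib)
    next
      fix a x p
      have "contraction v (dual_function (sum_scale (*) a x)) N = a * contraction v (dual_function x) N" for N
        by (simp add: contraction_def dual_function_def lookup_sum_scale)
      then show "?c (sum_scale (*) a x) p = fun_scale a (?c x) p"
        by (simp add: cochain_of_def fun_scale_def sum_distrib_left mult_ac)
    qed
    fix z assume "z \<in> fst ?Q"
    then have z: "z \<in> tchains ?L ?\<sigma> \<omega> t" "tdiff z = 0" by (simp_all add: mem_thomology)
    let ?Z = "dual_function z"
    have cobZ: "coboundary ?Z N = 0" if "N \<subseteq> \<omega>" for N
      unfolding dual_function_tdiff[OF that, symmetric] z(2) by (simp add: dual_function_def)
    then have hZ: "coboundary (contraction v ?Z) N = ?Z N" if "N \<subseteq> \<omega>" for N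
      using homotopy[OF that, of ?Z] vw(1) that by (simp add: contraction_def split: if_splits)
    show "?c z \<in> fst ?Q'"
      unfolding mem_tcohomology
    proof
      have "cochain_of (u t + 1) (coboundary (contraction v ?Z)) = cochain_of (u t + 1) (\<lambda>_. 0)"
        unfolding cochain_of_eq_iff using hZ dual_function_eq_0[OF z(1)] by (auto simp: faces_def)
      also have "\<dots> = 0" by (simp add: cochain_of_def fun_eq_iff)
      finally show "tcodiff K {} \<omega> (u t) (?c z) = 0" unfolding tcodiff_cochain_of .
    qed (rule cochain_of_in)
    show "?c z \<in> snd ?Q' \<longleftrightarrow> z \<in> snd ?Q"
    proof
      assume "?c z \<in> snd ?Q'"
      then obtain f where "f \<in> tcochains K {} \<omega> (u t - 1)" "?c z = tcodiff K {} \<omega> (u t - 1) f"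
        by (auto simp: mem_tcohomology)
      then have "?c z = tcodiff K {} \<omega> (u t - 1) (cochain_of (u t - 1) (\<lambda>N. f (single (face_tensor TI \<omega> N) 1)))"
        using cochain_of_surj[of f "u t - 1"] by simp
      then obtain g0 where "?c z = tcodiff K {} \<omega> (u t - 1) (cochain_of (u t - 1) g0)" by (rule that)
      then obtain g where g: "?c z = tcodiff K {} \<omega> (u t - 1) (cochain_of (u t - 1) g)"
        "\<And>N. N \<notin> faces (u t - 1) \<Longrightarrow> g N = 0" using extend[of "u t - 1" g0] by auto
      have eq: "contraction v ?Z N = coboundary g N" if "N \<in> faces (u t)" for N
        using g(1) that unfolding tcodiff_cochain_of tt(2) cochain_of_eq_iff by blast
      \<comment> \<open>The relative cochain that corrects the contraction of \<open>Z\<close>.\<close>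
      define Y where "Y N = contraction v ?Z N - coboundary g N" for N
      have "Y N = 0" if "N \<subseteq> \<omega>" "N \<in> K \<or> int (card N) \<noteq> int (card \<omega>) - (t + 1)" for N
      proof (cases "int (card N) = u t")
        case True
        then show ?thesis using that eq[of N] by (simp add: Y_def faces_def tt(3))
      next
        case False
        have "contraction v ?Z N = 0"
        proof (cases "v \<in> N")
          case v: False
          have "?Z (insert v N) = 0"
            using False v that vw(1) tt(1) by (intro dual_function_eq_0[OF z(1)]) auto
          then show ?thesis by (simp add: contraction_def)
        qed (simp add: contraction_def)
        moreover have "coboundary g N = 0" by (rule cob_card[OF g(2)]) (use False tt(2) in auto)
        ultimately show ?thesis by (simp add: Y_def)
      qed
      then have y: "dual_chain Y \<in> tchains ?L ?\<sigma> \<omega> (t + 1)" by (rule dual_chain_in)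
      have "z - tdiff (dual_chain Y) = 0"
      proof (rule dual_function_inj)
        show "z - tdiff (dual_chain Y) \<in> tchains ?L ?\<sigma> \<omega> t"
          by (rule module.subspace_diff[OF M sub z(1) tdiff_tchains[OF y]])
        fix N assume N: "N \<subseteq> \<omega>"
        have "dual_function (tdiff (dual_chain Y)) N = coboundary (dual_function (dual_chain Y)) N"
          by (rule dual_function_tdiff[OF N])
        also have "\<dots> = coboundary Y N" by (rule cob_cong[OF dual_function_dual_chain N])
        also have "\<dots> = ?Z N" unfolding Y_def coboundary_diff hZ[OF N] by (simp add: coboundary_coboundary)
        finally have eq: "dual_function (tdiff (dual_chain Y)) N = ?Z N" .
        have "dual_function (z - tdiff (dual_chain Y)) N = ?Z N - dual_function (tdiff (dual_chain Y)) N"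
          by (simp add: dual_function_def lookup_minus right_diff_distrib)
        then show "dual_function (z - tdiff (dual_chain Y)) N = 0" unfolding eq by simp
      qed
      then show "z \<in> snd ?Q" using y by (auto simp: mem_thomology)
    next
      assume "z \<in> snd ?Q"
      then obtain y where y: "y \<in> tchains ?L ?\<sigma> \<omega> (t + 1)" "z = tdiff y" by (auto simp: mem_thomology)
      let ?Y = "dual_function y"
      have "contraction v ?Z N = coboundary (\<lambda>N. - contraction v ?Y N) N" if N: "N \<in> faces (u t)" for N
      proof -
        have Nw: "N \<subseteq> \<omega>" "N \<in> K" using N by (auto simp: faces_def)
        have "contraction v ?Z N = contraction v (coboundary ?Y) N"
          by (rule contr_cong[OF _ Nw(1)]) (simp add: y(2) dual_function_tdiff)
        then show ?thesis
          using homotopy[OF Nw(1), of ?Y] dual_function_eq_0[OF y(1) Nw(1)] Nw(2)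
          by (simp add: coboundary_uminus eq_neg_iff_add_eq_0 add.commute)
      qed
      then have "?c z = tcodiff K {} \<omega> (u t - 1) (cochain_of (u t - 1) (\<lambda>N. - contraction v ?Y N))"
        unfolding tcodiff_cochain_of tt(2) cochain_of_eq_iff by blast
      then show "?c z \<in> snd ?Q'" using cochain_of_in by (auto simp: mem_tcohomology)
    qed
  next
    fix c :: "(('m \<Rightarrow> tgen) \<Rightarrow>\<^sub>0 'k) \<Rightarrow> 'k"
    assume "c \<in> fst ?Q'"
    then have c: "c \<in> tcochains K {} \<omega> (u t)" "tcodiff K {} \<omega> (u t) c = 0" by (simp_all add: mem_tcohomology)
    obtain g0 where "c = cochain_of (u t) g0" using cochain_of_surj[OF c(1)] by (rule that)
    then obtain g where g: "c = cochain_of (u t) g" "\<And>N. N \<notin> faces (u t) \<Longrightarrow> g N = 0"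
      using extend[of "u t" g0] by auto
    have "cochain_of (u t + 1) (coboundary g) = cochain_of (u t + 1) (\<lambda>_. 0)"
      using c(2) unfolding g(1) tcodiff_cochain_of by (simp add: cochain_of_def fun_eq_iff)
    then have cocycle: "coboundary g N = 0" if "N \<in> faces (u t + 1)" for N
      using that unfolding cochain_of_eq_iff by blast
    \<comment> \<open>The connecting homomorphism: \<open>g\<close> is extended by 0, and its coboundary vanishes on \<open>K\<close>.\<close>
    let ?z = "dual_chain (coboundary g)"
    have z: "?z \<in> tchains ?L ?\<sigma> \<omega> t"
    proof (rule dual_chain_in)
      fix N assume N: "N \<subseteq> \<omega>" "N \<in> K \<or> int (card N) \<noteq> int (card \<omega>) - t"
      show "coboundary g N = 0"
      proof (cases "int (card N) = u t + 1")
        case True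
        then show ?thesis using N tt(1) by (intro cocycle) (auto simp: faces_def)
      qed (rule cob_card[OF g(2)])
    qed
    have "tdiff ?z \<in> tchains ?L ?\<sigma> \<omega> (t - 1)"
      using tdiff_in_tchains[OF simplicial_complex_dual[OF K] z] .
    then have "tdiff ?z = 0"
    proof (rule dual_function_inj)
      fix N assume N: "N \<subseteq> \<omega>"
      have "dual_function (tdiff ?z) N = coboundary (dual_function ?z) N" by (rule dual_function_tdiff[OF N])
      also have "\<dots> = coboundary (coboundary g) N" by (rule cob_cong[OF dual_function_dual_chain N])
      finally show "dual_function (tdiff ?z) N = 0" by (simp add: coboundary_coboundary)
    qed
    then have "?z \<in> fst ?Q" using z by (simp add: mem_thomology)
    moreover have "c - ?c ?z \<in> snd ?Q'"
    proof -
      have "g N - contraction v (dual_function ?z) N = coboundary (contraction v g) N" if "N \<in> faces (u t)" for N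
      proof -
        have N: "N \<subseteq> \<omega>" using that by (simp add: faces_def)
        have "contraction v (dual_function ?z) N = contraction v (coboundary g) N"
          by (rule contr_cong[OF dual_function_dual_chain N])
        then show ?thesis using homotopy[OF N, of g] by (simp add: algebra_simps)
      qed
      then have "cochain_of (u t) (\<lambda>N. g N - contraction v (dual_function ?z) N) =
          tcodiff K {} \<omega> (u t - 1) (cochain_of (u t - 1) (contraction v g))"
        unfolding tcodiff_cochain_of tt(2) cochain_of_eq_iff by blast
      moreover have "c - ?c ?z = cochain_of (u t) (\<lambda>N. g N - contraction v (dual_function ?z) N)"
        unfolding g(1) by (simp add: fun_eq_iff cochain_of_def fun_diff_def right_diff_distrib sum_subtractf)
      ultimately show ?thesis using cochain_of_in by (auto simp: mem_tcohomology)
    qed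
    ultimately show "\<exists>z\<in>fst ?Q. c - ?c z \<in> snd ?Q'" by blast
  qed
qed

end

section \<open>The composition ideal\<close>

lemma module_Const_mult: "module (\<lambda>c (p :: ('m, 'k::field) mpoly). Const c * p)"
  by unfold_locales (simp_all add: Const_add Const_mult Const_1 algebra_simps)

text \<open>
  The embedding of $\mathbf k[x]$ as the tensor factor \<open>i\<close> of $\mathbf k[m]$.
\<close>

definition eval_at_Var :: "'m \<Rightarrow> 'k::field poly \<Rightarrow> ('m, 'k) mpoly"
  where "eval_at_Var i q = poly (map_poly Const q) (Var i)"

lemma eval_at_Var_pCons: "eval_at_Var i (pCons c q) = Const c + Var i * eval_at_Var i q"
  by (simp add: eval_at_Var_def map_poly_pCons Const_0)

lemma eval_at_Var_monom_mult: "eval_at_Var i (monom 1 n * q) = Var i ^ n * eval_at_Var i q"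
proof (induction n)
  case (Suc n)
  have "monom 1 (Suc n) * q = pCons 0 (monom 1 n * q)" by (simp add: monom_Suc)
  then show ?case using Suc by (simp add: eval_at_Var_pCons Const_0 mult.assoc)
qed simp

lemma eval_at_Var_1: "eval_at_Var i 1 = 1"
  by (simp add: eval_at_Var_def Const_1)

lemma pure_tensor_eq: "pure_tensor y = (\<Prod>i\<in>UNIV. eval_at_Var i (y i))"
  by (simp add: pure_tensor_def eval_at_Var_def)

lemma pure_tensor_monom_mult:
  "pure_tensor (\<lambda>i. monom 1 (n i) * y i) = (\<Prod>i\<in>UNIV. Var i ^ n i) * pure_tensor y"
  by (simp add: pure_tensor_eq eval_at_Var_monom_mult prod.distrib)

lemma single_eq_prod_Var:
  fixes k :: "'m::finite \<Rightarrow>\<^sub>0 nat"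
  shows "single k a = (Const a * (\<Prod>i\<in>UNIV. Var i ^ lookup k i) :: ('m, 'k::field) mpoly)"
proof -
  have "(\<Sum>i\<in>UNIV. single i (lookup k i)) = k"
    by (rule poly_mapping_eqI) (simp add: lookup_exponent_sum)
  then show ?thesis by (simp add: prod_Var_power Const_def mult_single)
qed

text \<open>
  Multiplication by a monomial acts factor by factor on pure tensors, and every polynomial is a sum
  of multiples of monomials.
\<close>

lemma tensor_subspace_ideal:
  fixes Y :: "'m::finite \<Rightarrow> 'k::field poly set" and c :: "('m, 'k) mpoly"
  assumes Y: "\<And>i p q. p \<in> Y i \<Longrightarrow> q * p \<in> Y i" and x: "x \<in> tensor_subspace Y"
  shows "c * x \<in> tensor_subspace Y"
proof -
  interpret V: module "\<lambda>c (p :: ('m, 'k) mpoly). Const c * p" by (rule module_Const_mult)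
  let ?G = "{pure_tensor y | y. \<forall>i. y i \<in> Y i} :: ('m, 'k) mpoly set"
  have T: "tensor_subspace Y = V.span ?G" by (simp add: tensor_subspace_def)
  have monomial: "single k a * x \<in> V.span ?G" if "x \<in> V.span ?G" for k a x
  proof -
    have "V.span ?G \<subseteq> {x. single k a * x \<in> V.span ?G}"
    proof (rule V.span_minimal)
      show "V.subspace {x. single k a * x \<in> V.span ?G}"
      proof (rule V.subspaceI; clarsimp)
        show "0 \<in> V.span ?G" by (rule V.span_zero)
        show "single k a * (x + y) \<in> V.span ?G"
          if "single k a * x \<in> V.span ?G" "single k a * y \<in> V.span ?G" for x y
          using V.span_add[OF that] by (simp add: distrib_left)
        show "single k a * (Const c * x) \<in> V.span ?G"
          if "single k a * x \<in> V.span ?G" for c x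
          using V.span_scale[OF that, of c] by (simp add: mult_ac)
      qed
      show "?G \<subseteq> {x. single k a * x \<in> V.span ?G}"
      proof clarify
        fix y assume y: "\<forall>i. y i \<in> Y i"
        have eq: "single k a * pure_tensor y =
            Const a * pure_tensor (\<lambda>i. monom 1 (lookup k i) * y i)"
          by (simp add: single_eq_prod_Var pure_tensor_monom_mult mult.assoc)
        have "pure_tensor (\<lambda>i. monom 1 (lookup k i) * y i) \<in> ?G" using y Y by blast
        from V.span_scale[OF V.span_base[OF this]]
        show "single k a * pure_tensor y \<in> V.span ?G" unfolding eq .
      qed
    qed
    then show ?thesis using that by blast
  qed
  have "c = (\<Sum>k\<in>keys c. single k (lookup c k))"
    by (rule poly_mapping_eqI) (simp add: lookup_sum lookup_single when_def in_keys_iff)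
  then have "c * x = (\<Sum>k\<in>keys c. single k (lookup c k)) * x"
    by (rule arg_cong)
  also have "\<dots> = (\<Sum>k\<in>keys c. single k (lookup c k) * x)"
    by (rule sum_distrib_right)
  finally have "c * x = (\<Sum>k\<in>keys c. single k (lookup c k) * x)" .
  then show ?thesis using x monomial unfolding T by (simp add: V.span_sum)
qed

lemma ideal_generated_monom: "q \<in> ideal_generated {monom 1 n :: 'k::field poly} \<longleftrightarrow> (\<exists>p. q = monom 1 n * p)"
proof -
  interpret module "(*) :: 'k poly \<Rightarrow> _" by (rule module_times)
  show ?thesis unfolding ideal_generated_def span_singleton by (auto simp: mult.commute)
qed

text \<open>
  The generator for a non-face \<open>\<sigma>\<close> is a pure tensor with $x^{r_i}$ on \<open>\<sigma>\<close> and 1 on the face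
  \<open>UNIV - \<sigma>\<close> of the dual complex. Conversely, a pure tensor in the summand of \<open>\<tau>\<close> is a multiple of the
  generator for the non-face \<open>UNIV - \<tau>\<close>.
\<close>

theorem monomial_ideal_eq_composition_ideal:
  fixes K :: "'m::finite set set" and r :: "'m \<Rightarrow> nat"
  shows "(monomial_ideal K r :: ('m, 'k::field) mpoly set) =
    composition_ideal (dual_complex K) (\<lambda>i. ideal_generated {monom 1 (r i)})"
proof -
  interpret R: module "(*) :: ('m, 'k) mpoly \<Rightarrow> _" by (rule module_times)
  interpret V: module "\<lambda>c (p :: ('m, 'k) mpoly). Const c * p" by (rule module_Const_mult)
  let ?G = "{\<Prod>i\<in>\<sigma>. Var i ^ r i | \<sigma>. \<sigma> \<notin> K} :: ('m, 'k) mpoly set"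
  let ?Y = "\<lambda>\<tau> i. if i \<in> \<tau> then UNIV else ideal_generated {monom 1 (r i)} :: 'k poly set"
  let ?T = "\<lambda>\<tau>. tensor_subspace (?Y \<tau>) :: ('m, 'k) mpoly set"
  have I: "monomial_ideal K r = R.span ?G" by (simp add: monomial_ideal_def ideal_generated_def)
  have C: "composition_ideal (dual_complex K) (\<lambda>i. ideal_generated {monom 1 (r i)}) =
      {\<Sum>\<tau>\<in>dual_complex K. x \<tau> | x. \<forall>\<tau>\<in>dual_complex K. x \<tau> \<in> ?T \<tau>}"
    unfolding composition_ideal_def by (rule set_sum_alt) simp
  have subT: "V.subspace (?T \<tau>)" for \<tau> by (simp add: tensor_subspace_def)
  have Y: "q * p \<in> ?Y \<tau> i" if "p \<in> ?Y \<tau> i" for \<tau> i p q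
    using that by (auto simp: ideal_generated_monom mult_ac split: if_splits)
  have TI: "?T \<tau> \<subseteq> R.span ?G" if \<tau>: "\<tau> \<in> dual_complex K" for \<tau>
    unfolding tensor_subspace_def
  proof (rule V.span_minimal)
    show "V.subspace (R.span ?G)"
      by (rule V.subspaceI) (auto intro: R.span_zero R.span_add R.span_scale)
    show "{pure_tensor y | y. \<forall>i. y i \<in> ?Y \<tau> i} \<subseteq> R.span ?G"
    proof clarify
      fix y assume y: "\<forall>i. y i \<in> ?Y \<tau> i"
      let ?n = "\<lambda>i. if i \<in> UNIV - \<tau> then r i else 0"
      have "\<exists>p. y i = monom 1 (?n i) * p" for i
        using y[rule_format, of i] by (cases "i \<in> \<tau>") (simp_all add: ideal_generated_monom)
      then obtain p where "\<And>i. y i = monom 1 (?n i) * p i" by metis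
      then have "y = (\<lambda>i. monom 1 (?n i) * p i)" by blast
      then have "pure_tensor y = (\<Prod>i\<in>UNIV. Var i ^ ?n i) * pure_tensor p"
        by (simp only: pure_tensor_monom_mult)
      also have "(\<Prod>i\<in>UNIV. Var i ^ ?n i) = (\<Prod>i\<in>UNIV - \<tau>. Var i ^ r i :: ('m, 'k) mpoly)"
        by (rule prod.mono_neutral_cong_right) auto
      finally have eq: "pure_tensor y = pure_tensor p * (\<Prod>i\<in>UNIV - \<tau>. Var i ^ r i)" by (simp add: mult.commute)
      have "(\<Prod>i\<in>UNIV - \<tau>. Var i ^ r i) \<in> ?G" using \<tau> by (auto simp: mem_dual_complex_iff)
      from R.span_scale[OF R.span_base[OF this]] show "pure_tensor y \<in> R.span ?G" unfolding eq .
    qed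
  qed
  show ?thesis unfolding I C
  proof (rule antisym)
    show "{\<Sum>\<tau>\<in>dual_complex K. x \<tau> | x. \<forall>\<tau>\<in>dual_complex K. x \<tau> \<in> ?T \<tau>} \<subseteq> R.span ?G"
      using TI by (auto intro!: R.span_sum)
    show "R.span ?G \<subseteq> {\<Sum>\<tau>\<in>dual_complex K. x \<tau> | x. \<forall>\<tau>\<in>dual_complex K. x \<tau> \<in> ?T \<tau>}" (is "_ \<subseteq> ?S")
    proof (rule R.span_minimal)
      show "R.subspace ?S"
      proof (rule R.subspaceI)
        show "0 \<in> ?S" using V.subspace_0[OF subT] by (intro CollectI exI[of _ "\<lambda>_. 0"]) simp
      next
        fix a b assume "a \<in> ?S" "b \<in> ?S"
        then obtain x y where "a = (\<Sum>\<tau>\<in>dual_complex K. x \<tau>)" "b = (\<Sum>\<tau>\<in>dual_complex K. y \<tau>)"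
          "\<forall>\<tau>\<in>dual_complex K. x \<tau> \<in> ?T \<tau>" "\<forall>\<tau>\<in>dual_complex K. y \<tau> \<in> ?T \<tau>" by blast
        then show "a + b \<in> ?S"
          by (intro CollectI exI[of _ "\<lambda>\<tau>. x \<tau> + y \<tau>"]) (simp add: sum.distrib V.subspace_add[OF subT])
      next
        fix c a assume "a \<in> ?S"
        then obtain x where "a = (\<Sum>\<tau>\<in>dual_complex K. x \<tau>)" "\<forall>\<tau>\<in>dual_complex K. x \<tau> \<in> ?T \<tau>" by blast
        then show "c * a \<in> ?S"
          by (intro CollectI exI[of _ "\<lambda>\<tau>. c * x \<tau>"])
            (simp add: sum_distrib_left tensor_subspace_ideal[OF Y])
      qed
      show "?G \<subseteq> ?S"
      proof clarify
        fix \<sigma> assume \<sigma>: "\<sigma> \<notin> K"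
        let ?\<tau> = "UNIV - \<sigma>"
        have \<tau>: "?\<tau> \<in> dual_complex K" using \<sigma> by (simp add: mem_dual_complex_iff double_diff)
        let ?n = "\<lambda>i. if i \<in> \<sigma> then r i else 0"
        let ?g = "\<Prod>i\<in>\<sigma>. Var i ^ r i :: ('m, 'k) mpoly"
        have "pure_tensor (\<lambda>i. monom 1 (?n i) * 1) = (\<Prod>i\<in>UNIV. Var i ^ ?n i :: ('m, 'k) mpoly)"
          unfolding pure_tensor_monom_mult by (simp add: pure_tensor_eq eval_at_Var_1)
        also have "\<dots> = ?g" by (rule prod.mono_neutral_cong_right) auto
        finally have "?g = pure_tensor (\<lambda>i. monom 1 (?n i) * 1)" by simp
        moreover have "\<forall>i. monom 1 (?n i) * 1 \<in> ?Y ?\<tau> i" by (auto simp: ideal_generated_monom)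
        ultimately have "?g \<in> ?T ?\<tau>"
          unfolding tensor_subspace_def by (intro V.span_base) blast
        then show "\<exists>x. ?g = (\<Sum>\<tau>\<in>dual_complex K. x \<tau>) \<and> (\<forall>\<tau>\<in>dual_complex K. x \<tau> \<in> ?T \<tau>)"
          using \<tau> V.subspace_0[OF subT]
          by (intro exI[of _ "\<lambda>\<tau>. if \<tau> = ?\<tau> then ?g else 0"]) auto
      qed
    qed
  qed
qed

section \<open>Tor of the monomial ideal\<close>

theorem theorem5p9:
  fixes K :: "'m::{finite,linorder} set set" and r :: "'m \<Rightarrow> nat"
  assumes "simplicial_complex K" and "K \<noteq> {}" and "K \<noteq> Pow UNIV" and "\<And>i. r i > 0"
  defines "I \<equiv> (monomial_ideal K r :: ('m, 'k::field) mpoly set)"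
  shows "I = composition_ideal (dual_complex K) (\<lambda>i. ideal_generated {monom 1 (r i)})
    \<and> (\<forall>s (F :: int \<Rightarrow> 'f::ab_group_add set) d \<epsilon>. free_resolution s F d \<epsilon> (*) I \<longrightarrow>
        (\<forall>t. isomorphic
          (\<lambda>c. sum_scale (*) (Const c)) (Tor s F d trivial_scale (UNIV :: 'k set) t)
          (sum_scale (sum_scale (*)))
            (direct_sum (dual_complex K) (\<lambda>\<sigma>. thomology (dual_complex K) \<sigma> (UNIV - \<sigma>) t))))
    \<and> (\<forall>t. isomorphic
          (sum_scale (sum_scale ((*) :: 'k \<Rightarrow> 'k \<Rightarrow> 'k)))
            (direct_sum (dual_complex K) (\<lambda>\<sigma>. thomology (dual_complex K) \<sigma> (UNIV - \<sigma>) t))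
          (sum_scale fun_scale)
            (direct_sum {\<omega>. \<omega> \<notin> K} (\<lambda>\<omega>. tcohomology K {} \<omega> (int (card \<omega>) - t - 1))))"
proof (intro conjI allI impI)
  show "I = composition_ideal (dual_complex K) (\<lambda>i. ideal_generated {monom 1 (r i)})"
    unfolding I_def by (rule monomial_ideal_eq_composition_ideal)
next
  fix s and F :: "int \<Rightarrow> 'f set" and d \<epsilon> t
  assume "free_resolution s F d \<epsilon> (*) I"
  then have F: "free_resolution s F d \<epsilon> (*) (monomial_ideal K r :: ('m, 'k) mpoly set)"
    by (simp only: I_def)
  obtain f where f: "quotient_iso s (homology_mod s irrelevant_ideal F d t) (sum_scale (*))
      (homology_mod (sum_scale (*)) irrelevant_ideal (res_module (dual_complex K)) (\<lambda>_. res_diff r) t) f"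
    using homology_mod_resolution_independent[OF F free_resolution_monomial_ideal[OF assms(1)] module_times]
    by blast
  from quotient_iso_trans[OF Tor_trivial_iso_homology_mod[OF F] f]
  have "quotient_iso (\<lambda>c. sum_scale (*) (Const c)) (Tor s F d trivial_scale (UNIV :: 'k set) t)
      (\<lambda>c. sum_scale (*) (Const c))
      (homology_mod (sum_scale (*)) irrelevant_ideal (res_module (dual_complex K)) (\<lambda>_. res_diff r) t)
      (\<lambda>p. f (tensor_contract s p))"
    by (rule quotient_iso_restrict_scalars) (rule Const_1 Const_add Const_mult)+
  from quotient_iso_trans[OF this homology_mod_res_iso_direct_sum[OF assms(1,4)]]
  show "isomorphic (\<lambda>c. sum_scale (*) (Const c)) (Tor s F d trivial_scale (UNIV :: 'k set) t)
      (sum_scale (sum_scale (*)))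
      (direct_sum (dual_complex K) (\<lambda>\<sigma>. thomology (dual_complex K) \<sigma> (UNIV - \<sigma>) t))"
    by (rule isomorphic_if_quotient_iso)
next
  fix t
  have bij: "bij_betw (\<lambda>\<sigma>. UNIV - \<sigma>) (dual_complex K) {\<omega>. \<omega> \<notin> K}"
    by (rule bij_betw_byWitness[of _ "\<lambda>\<omega>. UNIV - \<omega>"]) (auto simp: mem_dual_complex_iff double_diff)
  have iso: "\<exists>f. quotient_iso (sum_scale (*)) (thomology (dual_complex K) \<sigma> (UNIV - \<sigma>) t)
      fun_scale (tcohomology K {} (UNIV - \<sigma>) (int (card (UNIV - \<sigma>)) - t - 1)
        :: ((('m \<Rightarrow> tgen) \<Rightarrow>\<^sub>0 'k) \<Rightarrow> 'k) subquotient) f"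
    if "\<sigma> \<in> dual_complex K" for \<sigma>
  proof -
    \<comment> \<open>The complement of a face of the dual complex is a non-face, so it is nonempty.\<close>
    have "{} \<in> K" using assms(1,2) unfolding simplicial_complex_def by blast
    then have "UNIV - \<sigma> \<noteq> {}" using that by (metis mem_dual_complex_iff)
    from alexander_duality[OF assms(1) this, of t] show ?thesis by (auto simp: double_diff)
  qed
  obtain f where f: "\<And>\<sigma>. \<sigma> \<in> dual_complex K \<Longrightarrow>
      quotient_iso (sum_scale (*)) (thomology (dual_complex K) \<sigma> (UNIV - \<sigma>) t)
      fun_scale (tcohomology K {} (UNIV - \<sigma>) (int (card (UNIV - \<sigma>)) - t - 1)
        :: ((('m \<Rightarrow> tgen) \<Rightarrow>\<^sub>0 'k) \<Rightarrow> 'k) subquotient) (f \<sigma>)"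
    using iso by metis
  obtain \<Phi> where "quotient_iso (sum_scale (sum_scale ((*) :: 'k \<Rightarrow> 'k \<Rightarrow> 'k)))
      (direct_sum (dual_complex K) (\<lambda>\<sigma>. thomology (dual_complex K) \<sigma> (UNIV - \<sigma>) t))
      (sum_scale fun_scale)
      (direct_sum {\<omega>. \<omega> \<notin> K} (\<lambda>\<omega>. tcohomology K {} \<omega> (int (card \<omega>) - t - 1))) \<Phi>"
  proof (rule quotient_iso_direct_sum[OF _ bij module_sum_scale module_fun_scale,
        where Q = "\<lambda>\<sigma>. thomology (dual_complex K) \<sigma> (UNIV - \<sigma>) t" and f = f
          and Q' = "\<lambda>\<omega>. tcohomology K {} \<omega> (int (card \<omega>) - t - 1)"])
    show "finite (dual_complex K)" by simp
  qed (use f in blast)+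
  then show "isomorphic (sum_scale (sum_scale ((*) :: 'k \<Rightarrow> 'k \<Rightarrow> 'k)))
      (direct_sum (dual_complex K) (\<lambda>\<sigma>. thomology (dual_complex K) \<sigma> (UNIV - \<sigma>) t))
      (sum_scale fun_scale)
      (direct_sum {\<omega>. \<omega> \<notin> K} (\<lambda>\<omega>. tcohomology K {} \<omega> (int (card \<omega>) - t - 1)))"
    by (rule isomorphic_if_quotient_iso)
qed

end
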